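(* Let $\overline{p}(n)$ be the number of overpartitions of $n$. The sequences $\left\{\sqrt[n]{\overline{p}(n)/n}\right\}_{n\ge 19}$ and $\left\{\sqrt[n]{\overline{p}(n)}\right\}_{n\ge 4}$ are log-convex.
   Context: An overpartition of $n$ is a nonincreasing sequence of positive integers whose sum is $n$, in which the first occurrence of each number may be overlined; $\overline{p}(n)$ denotes the number of overpartitions of $n$, with $\overline{p}(0)=1$ (for example $\overline{p}(3)=8$). A positive sequence $\{a_n\}_{n\ge n_0}$ is called log-convex if $a_n^2-a_{n-1}a_{n+1}\le 0$ for all $n\ge n_0+1$. *)

theory Defs
  imports "HOL-Analysis.Analysis"
begin

(* A part is a pair (size, overlined).  The last condition says that an overlined
   part is the first occurrence of its size in the sequence. *)
definition is_overpartition :: "nat \<Rightarrow> (nat \<times> bool) list \<Rightarrow> bool" where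
  "is_overpartition n xs \<longleftrightarrow>
     sorted_wrt (\<lambda>x y. fst x \<ge> fst y) xs \<and>
     (\<forall>x\<in>set xs. fst x > 0) \<and>
     sum_list (map fst xs) = n \<and>
     (\<forall>j<length xs. snd (xs ! j) \<longrightarrow> (\<forall>i<j. fst (xs ! i) \<noteq> fst (xs ! j)))"

definition overpartition_count :: "nat \<Rightarrow> nat" where
  "overpartition_count n = card {xs. is_overpartition n xs}"

(* The values a n with n < n0 are irrelevant: {a_n}_{n >= n0} is encoded as a total function. *)
definition log_convex_from :: "nat \<Rightarrow> (nat \<Rightarrow> real) \<Rightarrow> bool" where
  "log_convex_from n0 a \<longleftrightarrow>
     (\<forall>n\<ge>n0. a n > 0) \<and>
     (\<forall>n\<ge>n0 + 1. (a n)\<^sup>2 - a (n - 1) * a (n + 1) \<le> 0)"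

lemma length_le_sum_list_pos:
  "(\<forall>x\<in>set xs. 0 < x) \<Longrightarrow> length xs \<le> sum_list xs" for xs :: "nat list"
  by (induction xs) (auto simp: Suc_le_eq)

lemma overpartitions_subset:
  "{xs. is_overpartition n xs} \<subseteq> {xs. set xs \<subseteq> {1..n} \<times> UNIV \<and> length xs \<le> n}"
proof (clarsimp simp: is_overpartition_def, intro conjI)
  fix xs :: "(nat \<times> bool) list"
  assume pos: "\<forall>x\<in>set xs. 0 < fst x"
  show "set xs \<subseteq> {Suc 0..sum_list (map fst xs)} \<times> UNIV"
  proof
    fix x assume x: "x \<in> set xs"
    hence "fst x \<le> sum_list (map fst xs)" by (intro member_le_sum_list) auto
    thus "x \<in> {Suc 0..sum_list (map fst xs)} \<times> UNIV"
      using pos x by (cases x) (auto simp: Suc_le_eq)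
  qed
  show "length xs \<le> sum_list (map fst xs)"
    using length_le_sum_list_pos[of "map fst xs"] pos by simp
qed

lemma finite_overpartitions: "finite {xs. is_overpartition n xs}"
  by (rule finite_subset[OF overpartitions_subset finite_lists_length_le]) auto

lemma overpartition_count_0: "overpartition_count 0 = 1"
proof -
  have "{xs. is_overpartition 0 xs} = {[]}"
    by (auto simp: is_overpartition_def) (metis fst_conv list.set_intros(1) neq_Nil_conv surj_pair)+
  thus ?thesis by (simp add: overpartition_count_def)
qed

lemma overpartition_count_3: "overpartition_count 3 = 8"
proof -
  have "{xs. is_overpartition 3 xs} =
    {[(3,b)] | b. True} \<union> {[(2,b), (1,c)] | b c. True} \<union> {[(1,b), (1,False), (1,False)] | b. True}"
    (is "?L = ?R")
  proof
    show "?L \<subseteq> ?R"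
    proof
      fix xs assume "xs \<in> ?L"
      hence op: "is_overpartition 3 xs" by simp
      hence "length xs \<le> 3" using overpartitions_subset[of 3] by auto
      then consider "xs = []" | x where "xs = [x]" | x y where "xs = [x, y]"
        | x y z where "xs = [x, y, z]"
        by (cases xs; cases "tl xs"; cases "tl (tl xs)"; cases "tl (tl (tl xs))") auto
      thus "xs \<in> ?R"
      proof cases
        case (4 x y z)
        hence "fst x = 1 \<and> fst y = 1 \<and> fst z = 1" using op by (auto simp: is_overpartition_def)
        thus ?thesis using op 4
          by (cases x; cases y; cases z) (auto simp: is_overpartition_def All_less_Suc numeral_3_eq_3)
      next
        case (3 x y)
        hence "fst x = 2 \<and> fst y = 1" using op by (auto simp: is_overpartition_def)
        thus ?thesis using op 3 by (cases x; cases y) auto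
      qed (use op in \<open>auto simp: is_overpartition_def\<close>)
    qed
    show "?R \<subseteq> ?L"
      by (auto simp: is_overpartition_def less_Suc_eq)
  qed
  also have "\<dots> = {[(3,True)], [(3,False)], [(2,True),(1,True)], [(2,True),(1,False)],
      [(2,False),(1,True)], [(2,False),(1,False)],
      [(1,True),(1,False),(1,False)], [(1,False),(1,False),(1,False)]}"
    by (auto; metis (full_types))
  finally show ?thesis by (simp add: overpartition_count_def)
qed

end

theory Submission
  imports Defs "HOL-Complex_Analysis.Complex_Analysis" "HOL-Probability.Distributions"
    "HOL-Real_Asymp.Real_Asymp"
begin

text \<open>
  By Gauss, the generating function of the overpartition numbers is \<open>P q = 1 / \<theta>\<^sub>4 q\<close>, so Jacobi's
  transformation describes \<open>P (exp (- t))\<close> near \<open>t = 0\<close> up to an exponentially small relative error,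
  while away from \<open>t = 0\<close> the product for \<open>P\<close> gives \<open>\<bar>P q\<bar> \<le> P r exp (2 Re (q / (1 - q)) - 2 r / (1 - r))\<close>
  with \<open>r = \<bar>q\<bar>\<close>.  Integrating over a vertical line whose middle part is replaced by an arc of the
  circle \<open>\<bar>t\<bar> = \<pi> / (2 \<surd>n)\<close>, on which the integrand becomes a Gaussian, yields for \<open>X = \<pi> \<surd>n\<close> and
  \<open>n \<ge> 118\<close> that the number of overpartitions of \<open>n\<close> is \<open>e\<^bsup>X\<^esup> / (8 n) (1 - 1 / X + O(X\<^bsup>-3\<^esup>))\<close> with the
  constant 3.  This error is small enough to compare second differences for \<open>n \<ge> 121\<close>; the
  remaining cases follow from exact values and rational bounds for logarithms.
\<close>

section \<open>Counting overpartitions with bounded parts\<close>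

text \<open>The size of the second differences dictates the accuracy. For v(n) = p(n) / n,
  log-convexity of the n-th roots means that ln v(n) / n has nonnegative second differences, and
  these are only of order n^(-5/2), with coefficient tending slowly to 3 pi / 4 (the next term is
  smaller merely by ln n / sqrt n). An error c X^(-3) in the normalised count becomes, after
  division by n, an error of exactly that order, so the constant c matters: c = 3 leads to 14 / 125
  per term, and the four terms of a second difference lose 0.448, while 0.55 is available. The
  radius pi / (2 sqrt n) is the saddle point of n t + pi^2 / (4 t); on that circle the two summands
  are complex conjugates. The theta transformation is not taken from Poisson summation: a finite
  binomial identity yields it at rational t, and the identity theorem extends it to the half plane.
  Of the two sequences p(n) / n is the harder one. For p(n) the term ln n / n is added, which is
  itself convex for n > 6.\<close>

lemma is_overpartition_Nil: "is_overpartition n [] \<longleftrightarrow> n = 0"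
  by (auto simp: is_overpartition_def)

text \<open>The head is the first part of its size, so it may be overlined freely; the only new
  restriction falls on later parts of that size, none of which may be overlined.\<close>

lemma is_overpartition_Cons:
  "is_overpartition n (x # xs) \<longleftrightarrow>
     0 < fst x \<and> fst x \<le> n \<and> is_overpartition (n - fst x) xs \<and>
     (\<forall>y\<in>set xs. fst y \<le> fst x) \<and> (fst x, True) \<notin> set xs"
proof -
  have "(\<forall>j<length (x # xs). snd ((x # xs) ! j) \<longrightarrow>
           (\<forall>i<j. fst ((x # xs) ! i) \<noteq> fst ((x # xs) ! j))) \<longleftrightarrow>
        (\<forall>j<length xs. snd (xs ! j) \<longrightarrow> fst x \<noteq> fst (xs ! j)) \<and>
        (\<forall>j<length xs. snd (xs ! j) \<longrightarrow> (\<forall>i<j. fst (xs ! i) \<noteq> fst (xs ! j)))"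
    by (auto simp: All_less_Suc2)
  also have "(\<forall>j<length xs. snd (xs ! j) \<longrightarrow> fst x \<noteq> fst (xs ! j)) \<longleftrightarrow> (fst x, True) \<notin> set xs"
    by (auto simp: in_set_conv_nth) (metis prod.collapse)
  finally show ?thesis
    unfolding is_overpartition_def by auto
qed

text \<open>Bounding the part size replaces the infinite product by finite ones, which can be
  treated by induction on \<open>m\<close>; for \<open>n \<le> m\<close> the bound is void.\<close>

definition bounded_overpartitions :: "nat \<Rightarrow> nat \<Rightarrow> (nat \<times> bool) list set" where
  "bounded_overpartitions m n = {xs. is_overpartition n xs \<and> (\<forall>x\<in>set xs. fst x \<le> m)}"

definition bounded_count :: "nat \<Rightarrow> nat \<Rightarrow> nat" where
  "bounded_count m n = card (bounded_overpartitions m n)"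

lemma finite_bounded_overpartitions [simp]: "finite (bounded_overpartitions m n)"
  by (rule finite_subset[OF _ finite_overpartitions[of n]]) (auto simp: bounded_overpartitions_def)

lemma bounded_count_0: "bounded_count 0 n = (if n = 0 then 1 else 0)"
proof -
  have "bounded_overpartitions 0 n = (if n = 0 then {[]} else {})"
  proof (rule set_eqI)
    fix xs :: "(nat \<times> bool) list"
    show "xs \<in> bounded_overpartitions 0 n \<longleftrightarrow> xs \<in> (if n = 0 then {[]} else {})"
      by (cases xs) (auto simp: bounded_overpartitions_def is_overpartition_Nil is_overpartition_Cons)
  qed
  thus ?thesis by (simp add: bounded_count_def)
qed

lemma bounded_count_le: "bounded_count m n \<le> overpartition_count n"
  unfolding bounded_count_def overpartition_count_def bounded_overpartitions_def
  by (intro card_mono finite_overpartitions) auto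

lemma bounded_count_eq: "n \<le> m \<Longrightarrow> bounded_count m n = overpartition_count n"
  unfolding bounded_count_def overpartition_count_def bounded_overpartitions_def
  using overpartitions_subset[of n] by (intro arg_cong[where f = card]) force

text \<open>
  Removing the largest part \<open>m\<close> leaves an overpartition in which \<open>m\<close> is not overlined; this is
  why the overpartitions without an overlined \<open>m\<close> are counted alongside.
\<close>

lemma bounded_count_Suc:
  fixes m n :: nat
  defines "k \<equiv> Suc m"
  shows "bounded_count k n =
    bounded_count m n + (if k \<le> n then bounded_count k (n - k) + bounded_count m (n - k) else 0)"
proof -
  define U where "U n = {xs \<in> bounded_overpartitions k n. (k, True) \<notin> set xs}" for n
  have finU [simp]: "finite (U n)" for n
    by (rule finite_subset[of _ "bounded_overpartitions k n"]) (auto simp: U_def)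
  have le_Suc: "a \<le> m" if "a \<le> k" "a \<noteq> k" for a using that by (simp add: k_def)
  have mk: "\<not> k \<le> m" "m \<le> k" by (auto simp: k_def)
  define W where "W b n = (if k \<le> n then Cons (k, b) ` U (n - k) else {})" for b n
  have cardW: "card (W b n) = (if k \<le> n then card (U (n - k)) else 0)" for b n
    by (auto simp: W_def card_image)
  have mem_tail: "xs \<in> bounded_overpartitions m n \<or> (\<exists>b. xs \<in> W b n)"
    if "xs \<in> bounded_overpartitions k n" for xs n
  proof (cases xs)
    case Nil
    thus ?thesis using that by (auto simp: bounded_overpartitions_def)
  next
    case (Cons x ys)
    show ?thesis
    proof (cases "fst x = k")
      case True
      hence x: "x = (k, snd x)" by (metis prod.collapse)
      have "ys \<in> U (n - k)" "k \<le> n"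
        using that True by (auto simp: Cons U_def bounded_overpartitions_def is_overpartition_Cons)
      thus ?thesis using x by (auto simp: W_def Cons)
    next
      case False
      thus ?thesis using that le_Suc
        by (force simp: Cons bounded_overpartitions_def is_overpartition_Cons)
    qed
  qed
  have W_sub: "W b n \<subseteq> bounded_overpartitions k n" for b n
    by (auto simp: W_def U_def bounded_overpartitions_def is_overpartition_Cons) (auto simp: k_def)
  have sub: "bounded_overpartitions m n \<subseteq> bounded_overpartitions k n" for n
    using mk(2) by (force simp: bounded_overpartitions_def)
  have W_out: "xs \<notin> bounded_overpartitions m n" if "xs \<in> W b n" for xs b n
    using that mk(1) by (auto simp: W_def bounded_overpartitions_def split: if_splits)
  have O: "bounded_overpartitions k n = bounded_overpartitions m n \<union> (W True n \<union> W False n)" for n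
  proof -
    have "xs \<in> W True n \<union> W False n" if "xs \<in> W b n" for xs b
      using that by (cases b) auto
    thus ?thesis using mem_tail W_sub sub by blast
  qed
  have U: "U n = bounded_overpartitions m n \<union> W False n" for n
  proof -
    have "(k, True) \<notin> set xs" if "xs \<in> bounded_overpartitions m n" for xs
      using that mk(1) by (force simp: bounded_overpartitions_def)
    moreover have "(k, True) \<notin> set xs" if "xs \<in> W False n" for xs
      using that by (auto simp: W_def U_def split: if_splits)
    moreover have "(k, True) \<in> set xs" if "xs \<in> W True n" for xs
      using that by (auto simp: W_def U_def split: if_splits)
    ultimately show ?thesis unfolding U_def O by blast
  qed
  have finW [simp]: "finite (W b n)" for b n by (auto simp: W_def)
  have cardU: "card (U n) = bounded_count m n + (if k \<le> n then card (U (n - k)) else 0)" for n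
    unfolding U[of n] bounded_count_def cardW[of False, symmetric]
    by (rule card_Un_disjoint) (use W_out in auto)
  have "card (bounded_overpartitions k n) = card (bounded_overpartitions m n) + card (W True n \<union> W False n)" for n
    unfolding O[of n] by (rule card_Un_disjoint) (use W_out in auto)
  moreover have "card (W True n \<union> W False n) = card (W True n) + card (W False n)" for n
    by (rule card_Un_disjoint) (auto simp: W_def)
  ultimately have cardO: "bounded_count k n = bounded_count m n + (if k \<le> n then 2 * card (U (n - k)) else 0)" for n
    by (simp add: bounded_count_def cardW)
  \<comment> \<open>Eliminates \<open>card (U (n - k))\<close>, which occurs once in
    \<open>cardU\<close> and twice in \<open>cardO\<close>, so that \<open>U\<close> disappears from
    the recursion.\<close>
  have "2 * card (U n) = bounded_count k n + bounded_count m n" for n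
    using cardU[of n] cardO[of n] by auto
  thus ?thesis using cardO[of n] by simp
qed

text \<open>Its reciprocal is the generating function of \<open>bounded_count m\<close>, and its
  limit is Gauss' product for theta_4. The type stays general because Gauss' identity is proved on
  the reals while the generating function is also needed on the complex disc.\<close>

definition gauss_prod :: "'a::{real_normed_field,banach} \<Rightarrow> nat \<Rightarrow> 'a" where
  "gauss_prod q m = (\<Prod>i=1..m. (1 - q ^ i) / (1 + q ^ i))"

lemma gauss_prod_0 [simp]: "gauss_prod q 0 = 1"
  by (simp add: gauss_prod_def)

lemma gauss_prod_Suc: "gauss_prod q (Suc m) = gauss_prod q m * ((1 - q ^ Suc m) / (1 + q ^ Suc m))"
  by (simp add: gauss_prod_def)

lemma one_plus_minus_power_nz:
  fixes q :: "'a::{real_normed_field,banach}"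
  assumes "norm q < 1" "0 < i"
  shows "1 - q ^ i \<noteq> 0" "1 + q ^ i \<noteq> 0"
proof -
  have "norm (q ^ i) < 1"
    using assms by (simp add: norm_power power_less_one_iff)
  hence "q ^ i \<noteq> 1" "q ^ i \<noteq> - 1" by (metis norm_one less_irrefl, metis norm_minus_cancel norm_one less_irrefl)
  thus "1 - q ^ i \<noteq> 0" "1 + q ^ i \<noteq> 0"
    by (auto simp: add_eq_0_iff minus_equation_iff)
qed

lemma sums_shift_power:
  fixes q :: "'a::{real_normed_field,banach}"
  assumes "(\<lambda>n. f n * q ^ n) sums s"
  shows "(\<lambda>n. (if m \<le> n then f (n - m) else 0) * q ^ n) sums (q ^ m * s)"
proof -
  have "(\<lambda>n. q ^ m * (f n * q ^ n)) sums (q ^ m * s)"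
    using assms by (rule sums_mult)
  hence "(\<lambda>n. (if m \<le> n + m then f (n + m - m) else 0) * q ^ (n + m)) sums (q ^ m * s)"
    by (simp add: power_add mult_ac)
  thus ?thesis by (subst (asm) sums_zero_iff_shift) auto
qed

text \<open>The functional equation of the series can be solved only once convergence is known.
  Partial sums satisfy it as an inequality, since shifting by \<open>k\<close> inside
  \<open>{..<K}\<close> loses only nonnegative terms; this bounds them because
  \<open>r ^ k < 1\<close>.\<close>

lemma bounded_count_summable:
  assumes "0 \<le> r" "r < (1::real)"
  shows "summable (\<lambda>n. real (bounded_count m n) * r ^ n)"
proof (induction m)
  case 0
  have "(\<lambda>n. real (bounded_count 0 n) * r ^ n) = (\<lambda>n. if n = 0 then 1 else 0)"
    by (auto simp: bounded_count_0)
  thus ?case by (simp add: summable_If_finite[of "\<lambda>n. n = 0"])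
next
  case (Suc m)
  define k where "k = Suc m"
  define A where "A = (\<lambda>n. real (bounded_count m n) * r ^ n)"
  define B where "B = (\<lambda>n. real (bounded_count k n) * r ^ n)"
  have rk: "0 \<le> r ^ k" "r ^ k < 1"
    using assms by (auto simp: k_def power_less_one_iff simp del: power_Suc)
  have nn: "A n \<ge> 0" "B n \<ge> 0" for n using assms by (auto simp: A_def B_def)
  have split: "(\<Sum>n<K. if k \<le> n then r ^ k * h (n - k) else 0) \<le> r ^ k * sum h {..<K}"
    if h: "\<And>n. h n \<ge> 0" for h :: "nat \<Rightarrow> real" and K
  proof -
    have "(\<Sum>n<K. if k \<le> n then r ^ k * h (n - k) else 0) = (\<Sum>n\<in>{k..<K}. r ^ k * h (n - k))"
      by (intro sum.mono_neutral_cong_right) auto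
    also have "\<dots> = (\<Sum>n\<in>{..<K - k}. r ^ k * h n)"
      by (rule sum.reindex_bij_witness[of _ "\<lambda>n. n + k" "\<lambda>n. n - k"]) auto
    also have "\<dots> \<le> (\<Sum>n\<in>{..<K}. r ^ k * h n)"
      using h rk by (intro sum_mono2) auto
    finally show ?thesis by (simp add: sum_distrib_left)
  qed
  have BA: "B n = A n + (if k \<le> n then r ^ k * (B (n - k) + A (n - k)) else 0)" for n
  proof -
    have e: "r ^ n = r ^ k * r ^ (n - k)" if "k \<le> n"
      using that by (simp add: power_add[symmetric])
    show ?thesis using bounded_count_Suc[of m n]
      unfolding A_def B_def k_def[symmetric] by (auto simp: e algebra_simps)
  qed
  have "sum B {..<K} \<le> (1 + r ^ k) * suminf A / (1 - r ^ k)" for K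
  proof -
    have "sum B {..<K} = sum A {..<K} + (\<Sum>n<K. if k \<le> n then r ^ k * (B (n - k) + A (n - k)) else 0)"
      unfolding sum.distrib[symmetric] by (intro sum.cong refl BA)
    also have "\<dots> \<le> sum A {..<K} + r ^ k * (\<Sum>n<K. B n + A n)"
      using nn by (intro add_left_mono split) (simp add: add_nonneg_nonneg)
    finally have "(1 - r ^ k) * sum B {..<K} \<le> (1 + r ^ k) * sum A {..<K}"
      by (simp add: sum.distrib algebra_simps)
    also have "\<dots> \<le> (1 + r ^ k) * suminf A"
      using Suc nn rk by (intro mult_left_mono sum_le_suminf) (auto simp: A_def)
    finally show ?thesis using rk by (simp add: pos_le_divide_eq mult.commute)
  qed
  hence "summable B" using nn by (intro summableI_nonneg_bounded) auto
  thus ?case by (simp add: B_def k_def)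
qed

text \<open>In terms of the series A and B for the bounds \<open>m\<close> and
  \<open>k = Suc m\<close>, \<open>bounded_count_Suc\<close> reads B = A + q^k (B + A), which
  contributes one more factor (1 + q^k) / (1 - q^k).\<close>

lemma bounded_count_sums:
  fixes q :: "'a::{real_normed_field,banach}"
  assumes q: "norm q < 1"
  shows "(\<lambda>n. of_nat (bounded_count m n) * q ^ n) sums (1 / gauss_prod q m)"
proof (induction m)
  case 0
  have "(\<lambda>n. of_nat (bounded_count 0 n) * q ^ n) = (\<lambda>n. if n = 0 then 1 else 0)"
    by (auto simp: bounded_count_0)
  thus ?case using sums_single[of 0 "\<lambda>_. 1::'a"] by (simp add: eq_commute)
next
  case (Suc m)
  define k where "k = Suc m"
  define A where "A = (\<lambda>n. of_nat (bounded_count m n) * q ^ n)"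
  define B where "B = (\<lambda>n. of_nat (bounded_count k n) * q ^ n)"
  have "summable (\<lambda>n. norm (B n))"
    using bounded_count_summable[of "norm q" k] q by (simp add: B_def norm_mult norm_power)
  hence sB: "B sums suminf B" by (simp add: summable_norm_cancel summable_sums)
  have sA: "A sums (1 / gauss_prod q m)" using Suc by (simp add: A_def)
  have sAB: "(\<lambda>n. (if k \<le> n then of_nat (bounded_count k (n - k)) + of_nat (bounded_count m (n - k)) else 0) * q ^ n)
          sums (q ^ k * (suminf B + 1 / gauss_prod q m))"
    using sums_shift_power[where m = k, OF sums_add[OF sB[unfolded B_def] sA[unfolded A_def], folded distrib_right]]
    unfolding B_def by simp
  have "(\<lambda>n. A n + (if k \<le> n then of_nat (bounded_count k (n - k)) + of_nat (bounded_count m (n - k)) else 0) * q ^ n)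
          sums (1 / gauss_prod q m + q ^ k * (suminf B + 1 / gauss_prod q m))"
    by (rule sums_add[OF sA sAB])
  also have "(\<lambda>n. A n + (if k \<le> n then of_nat (bounded_count k (n - k)) + of_nat (bounded_count m (n - k)) else 0) * q ^ n) = B"
    using bounded_count_Suc[of m] unfolding A_def B_def k_def[symmetric] by (auto simp: distrib_right)
  finally have "suminf B = 1 / gauss_prod q m + q ^ k * (suminf B + 1 / gauss_prod q m)"
    using sB sums_unique2 by blast
  from arg_cong[OF this, of "\<lambda>z. z - q ^ k * suminf B"]
  have "(1 - q ^ k) * suminf B = (1 + q ^ k) * (1 / gauss_prod q m)"
    by (simp add: algebra_simps add_divide_distrib)
  hence "suminf B = (1 + q ^ k) * (1 / gauss_prod q m) / (1 - q ^ k)"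
    using one_plus_minus_power_nz[OF q, of k] by (metis k_def nonzero_mult_div_cancel_left zero_less_Suc)
  hence "suminf B = 1 / gauss_prod q k"
    unfolding k_def gauss_prod_Suc by (simp add: mult.commute)
  thus ?case using sB by (simp add: B_def k_def)
qed

section \<open>Gauss' identity\<close>

text \<open>At \<open>s = 0\<close> the formula returns \<open>gauss_prod q n\<close>, the product
  in the finite identity; for \<open>s \<ge> 1\<close> the factor \<open>q ^ (s * Suc n)\<close>
  makes the term vanish as \<open>n\<close> grows.\<close>

definition gauss_term :: "real \<Rightarrow> nat \<Rightarrow> nat \<Rightarrow> real" where
  "gauss_term q n s = (-1) ^ s * q ^ (s * Suc n) * (gauss_prod q n / gauss_prod q s) * (2 / (1 + q ^ s))"

lemma gauss_prod_pos:
  assumes "0 < q" "q < (1::real)"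
  shows "gauss_prod q n > 0"
  using assms unfolding gauss_prod_def
  by (intro prod_pos) (auto simp: power_less_one_iff add_pos_pos)

lemma gauss_prod_antimono:
  assumes "0 < q" "q < (1::real)" "s \<le> n"
  shows "gauss_prod q n \<le> gauss_prod q s"
  using assms(3)
proof (induction n rule: dec_induct)
  case (step n)
  have "gauss_prod q n * ((1 - q ^ Suc n) / (1 + q ^ Suc n)) \<le> gauss_prod q n * 1"
    using assms gauss_prod_pos[of q n]
    by (intro mult_left_mono) (auto simp: field_simps add_pos_pos simp del: power_Suc)
  thus ?case using step by (simp add: gauss_prod_Suc)
qed auto

text \<open>
  Shanks' finite form of Gauss' identity: passing from \<open>n\<close> to \<open>n + 1\<close>, the differences of the
  correction terms telescope.
\<close>

lemma gauss_term_diff: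
  fixes q :: real and n :: nat
  assumes "0 < q" "q < 1"
  defines "c \<equiv> \<lambda>s. (-1) ^ s * q ^ (s * Suc n) / gauss_prod q (s - 1)"
  shows "gauss_term q (Suc n) (Suc s) - gauss_term q n (Suc s) =
     - 2 * gauss_prod q n / (1 + q ^ Suc n) * (c (Suc s) - c (Suc (Suc s)))"
proof -
  define P where "P = gauss_prod q s"
  define G where "G = gauss_prod q n"
  define x where "x = q ^ Suc s"
  define y where "y = q ^ Suc n"
  define w where "w = q ^ (Suc s * Suc n)"
  have P: "P \<noteq> 0" using gauss_prod_pos[of q s] assms by (simp add: P_def)
  have xy: "0 < x" "x < 1" "0 < y" "y < 1" using assms(1,2)
    by (auto simp: x_def y_def power_less_one_iff simp del: power_Suc)
  have GS: "gauss_prod q (Suc s) = P * ((1 - x) / (1 + x))" "gauss_prod q (Suc n) = G * ((1 - y) / (1 + y))"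
    by (auto simp: gauss_prod_Suc P_def G_def x_def y_def)
  have w: "q ^ (Suc s * Suc n) = w" "q ^ (Suc s * Suc (Suc n)) = w * x" "q ^ (Suc (Suc s) * Suc n) = w * y"
    unfolding w_def x_def y_def by (simp_all add: power_add[symmetric] del: power_Suc) (simp_all add: algebra_simps)
  have "(-1) ^ Suc s * (w * x) * (G * ((1 - y) / (1 + y)) / (P * ((1 - x) / (1 + x)))) * (2 / (1 + x))
      - (-1) ^ Suc s * w * (G / (P * ((1 - x) / (1 + x)))) * (2 / (1 + x)) =
     - 2 * G / (1 + y) * ((-1) ^ Suc s * w / P - (-1) ^ Suc (Suc s) * (w * y) / (P * ((1 - x) / (1 + x))))"
  proof -
    have "1 - x \<noteq> 0" "1 + x \<noteq> 0" "1 + y \<noteq> 0" using xy by auto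
    define e :: real where "e = (-1) ^ s"
    show ?thesis
      unfolding power_Suc e_def[symmetric]
      using P \<open>1 - x \<noteq> 0\<close> \<open>1 + x \<noteq> 0\<close> \<open>1 + y \<noteq> 0\<close> by (simp add: divide_simps) algebra
  qed
  thus ?thesis
    unfolding gauss_term_def c_def w GS diff_Suc_1 x_def[symmetric] y_def[symmetric] P_def[symmetric] G_def[symmetric]
    by simp
qed

text \<open>Of the two boundary terms left by the telescoping, \<open>c 1\<close> compensates the
  change from \<open>gauss_prod q n\<close> to \<open>gauss_prod q (Suc n)\<close>, while
  \<open>c (Suc n)\<close> together with the additional last summand produces the new square
  term.\<close>

lemma finite_gauss_identity:
  assumes "0 < q" "q < (1::real)"
  shows "1 + 2 * (\<Sum>s=1..n. (-1) ^ s * q ^ s\<^sup>2) = gauss_prod q n + (\<Sum>s=1..n. gauss_term q n s)"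
proof (induction n)
  case (Suc n)
  define c where "c = (\<lambda>s. (-1) ^ s * q ^ (s * Suc n) / gauss_prod q (s - 1))"
  define G where "G = gauss_prod q n"
  define y where "y = q ^ Suc n"
  have G: "G \<noteq> 0" using gauss_prod_pos[of q n] assms by (simp add: G_def)
  have y: "0 < y" using assms by (simp add: y_def)
  have "(\<Sum>s=1..n. gauss_term q (Suc n) s) - (\<Sum>s=1..n. gauss_term q n s)
      = (\<Sum>s<n. gauss_term q (Suc n) (Suc s) - gauss_term q n (Suc s))"
    by (simp add: sum.atLeast1_atMost_eq sum_subtractf)
  also have "\<dots> = - 2 * G / (1 + y) * (\<Sum>s<n. c (Suc s) - c (Suc (Suc s)))"
    using assms by (simp only: gauss_term_diff sum_distrib_left c_def G_def y_def)
  also have "(\<Sum>s<n. c (Suc s) - c (Suc (Suc s))) = c 1 - c (Suc n)"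
    using sum_lessThan_telescope'[of "\<lambda>s. c (Suc s)" n] by simp
  finally have d: "(\<Sum>s=1..n. gauss_term q (Suc n) s) = (\<Sum>s=1..n. gauss_term q n s)
       - 2 * G / (1 + y) * (c 1 - c (Suc n))" by simp
  have c1: "c 1 = - y" by (simp add: c_def y_def)
  have cn: "c (Suc n) = (-1) ^ Suc n * q ^ (Suc n)\<^sup>2 / G"
    by (simp add: c_def G_def power2_eq_square)
  have last: "gauss_term q (Suc n) (Suc n) = (-1) ^ Suc n * (q ^ (Suc n)\<^sup>2 * y) * (2 / (1 + y))"
    using gauss_prod_pos[OF assms, of "Suc n"]
    by (simp add: gauss_term_def y_def power2_eq_square power_add[symmetric] del: power_Suc) (simp add: algebra_simps)
  have GS: "gauss_prod q (Suc n) = G * ((1 - y) / (1 + y))" by (simp add: gauss_prod_Suc G_def y_def)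
  define e where "e = (-1) ^ Suc n * q ^ (Suc n)\<^sup>2"
  have cn': "c (Suc n) = e / G" and last': "gauss_term q (Suc n) (Suc n) = e * y * (2 / (1 + y))"
    by (simp_all add: cn last e_def)
  have "1 + 2 * (\<Sum>s=1..Suc n. (-1) ^ s * q ^ s\<^sup>2) = G + (\<Sum>s=1..n. gauss_term q n s) + 2 * e"
    using Suc by (simp add: e_def G_def)
  also have "\<dots> = G * ((1 - y) / (1 + y)) + ((\<Sum>s=1..n. gauss_term q n s) - 2 * G / (1 + y) * (- y - e / G) + e * y * (2 / (1 + y)))"
    using G y by (simp add: divide_simps) algebra
  also have "\<dots> = gauss_prod q (Suc n) + (\<Sum>s=1..Suc n. gauss_term q (Suc n) s)"
    using d unfolding c1 cn' by (simp add: GS last')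
  finally show ?case .
qed auto

text \<open>Jacobi's theta_4 is the sum of (-1)^k q^(k^2) over all integers k. The terms of k and -k
  are merged, and the index is shifted so that 0 stands for the square 1.\<close>

definition theta4_series :: "'a::{real_normed_field,banach} \<Rightarrow> nat \<Rightarrow> 'a" where
  "theta4_series q k = (-1) ^ Suc k * q ^ (Suc k)\<^sup>2"

definition theta4 :: "'a::{real_normed_field,banach} \<Rightarrow> 'a" where
  "theta4 q = 1 + 2 * (\<Sum>k. theta4_series q k)"

lemma summable_theta4_series:
  fixes q :: "'a::{real_normed_field,banach}"
  assumes "norm q < 1"
  shows "summable (\<lambda>k. norm (theta4_series q k))"
proof (rule summable_comparison_test')
  show "summable (\<lambda>k. norm q ^ k)" using assms by simp
  show "norm (norm (theta4_series q k)) \<le> norm q ^ k" for k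
    using assms unfolding theta4_series_def norm_mult norm_power
    by (simp add: power2_eq_square del: power_Suc) (intro power_decreasing; simp)
qed

text \<open>For \<open>s \<le> n\<close> the quotient of products in \<open>gauss_term\<close> is at
  most 1, so the corrections are dominated by a geometric series starting at
  \<open>q ^ Suc n\<close>. Real \<open>q\<close> suffices here, since analytic continuation enters
  later.\<close>

lemma gauss_prod_tendsto_theta4:
  assumes "0 < q" "q < (1::real)"
  shows "(\<lambda>n. gauss_prod q n) \<longlonglongrightarrow> theta4 q"
proof -
  have S: "(\<lambda>n. 1 + 2 * (\<Sum>s=1..n. (-1) ^ s * q ^ s\<^sup>2)) \<longlonglongrightarrow> theta4 q"
    using summable_norm_cancel[OF summable_theta4_series[of q]] assms
    unfolding theta4_def One_nat_def sum.atLeast1_atMost_eq theta4_series_def[symmetric]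
    by (intro tendsto_intros summable_LIMSEQ) simp
  have bound: "norm (\<Sum>s=1..n. gauss_term q n s) \<le> q ^ Suc n * (2 / (1 - q))" for n
  proof -
    have "norm (\<Sum>s=1..n. gauss_term q n s) \<le> (\<Sum>s=1..n. 2 * q ^ (s * Suc n))"
    proof (rule sum_norm_le)
      fix s assume "s \<in> {1..n}"
      have "gauss_prod q n / gauss_prod q s \<le> 1"
        using gauss_prod_antimono[OF assms, of s n] gauss_prod_pos[OF assms, of s] \<open>s \<in> _\<close> by simp
      moreover have "2 / (1 + q ^ s) \<le> 2" using assms by (simp add: field_simps add_pos_pos)
      ultimately have "q ^ (s * Suc n) * (gauss_prod q n / gauss_prod q s) * (2 / (1 + q ^ s)) \<le> q ^ (s * Suc n) * 1 * 2"
        using assms gauss_prod_pos[OF assms, of s] gauss_prod_pos[OF assms, of n]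
        by (intro mult_mono mult_left_mono) (auto simp: add_pos_pos less_imp_le)
      thus "norm (gauss_term q n s) \<le> 2 * q ^ (s * Suc n)"
        using assms gauss_prod_pos[OF assms, of s] gauss_prod_pos[OF assms, of n]
        by (simp add: gauss_term_def abs_mult power_abs add_pos_pos del: mult_Suc_right)
    qed
    also have "\<dots> = (\<Sum>s<n. 2 * q ^ (Suc s * Suc n))"
      by (simp add: sum.atLeast1_atMost_eq)
    also have "\<dots> \<le> (\<Sum>s<n. 2 * q ^ Suc n * q ^ s)"
    proof (rule sum_mono)
      fix s
      have "q ^ (Suc s * Suc n) \<le> q ^ (Suc n + s)"
        using assms by (intro power_decreasing) auto
      thus "2 * q ^ (Suc s * Suc n) \<le> 2 * q ^ Suc n * q ^ s" by (simp add: power_add)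
    qed
    also have "\<dots> = 2 * q ^ Suc n * (\<Sum>s<n. q ^ s)" by (simp add: sum_distrib_left)
    also have "\<dots> \<le> 2 * q ^ Suc n * (\<Sum>s. q ^ s)"
      using assms by (intro mult_left_mono sum_le_suminf) auto
    also have "(\<Sum>s. q ^ s) = 1 / (1 - q)" using assms by (intro suminf_geometric) auto
    finally show ?thesis by (simp add: mult_ac)
  qed
  have "(\<lambda>n. q ^ Suc n) \<longlonglongrightarrow> 0"
    using assms by (intro LIMSEQ_Suc LIMSEQ_power_zero) auto
  hence lim: "(\<lambda>n. q ^ Suc n * (2 / (1 - q))) \<longlonglongrightarrow> 0"
    by (rule tendsto_mult_left_zero)
  have "(\<lambda>n. \<Sum>s=1..n. gauss_term q n s) \<longlonglongrightarrow> 0"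
    using bound by (intro Lim_null_comparison[OF always_eventually lim]) blast
  from tendsto_diff[OF S this] show ?thesis
    unfolding finite_gauss_identity[OF assms] by simp
qed

section \<open>The generating function\<close>

definition overpartition_gf :: "'a::{real_normed_field,banach} \<Rightarrow> 'a" where
  "overpartition_gf q = (\<Sum>n. of_nat (overpartition_count n) * q ^ n)"

text \<open>The point is uniformity in \<open>m\<close>. Each factor is (1 + x) / (1 - x) = 1 + 2 x
  / (1 - x), at most exp (2 x / (1 - x)), and the exponents for x = q^i are dominated by a geometric
  series.\<close>

lemma inverse_gauss_prod_le:
  assumes q: "0 < q" "q < (1::real)"
  shows "1 / gauss_prod q m \<le> exp (2 * q / (1 - q)\<^sup>2)"
proof -
  have "1 / gauss_prod q m = (\<Prod>i=1..m. (1 + q ^ i) / (1 - q ^ i))"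
    by (simp add: gauss_prod_def prod_dividef)
  also have "\<dots> \<le> (\<Prod>i=1..m. exp (2 * q ^ i / (1 - q)))"
  proof (rule prod_mono)
    fix i assume i: "i \<in> {1..m}"
    have "q ^ i \<le> q ^ 1" using i q by (intro power_decreasing) auto
    hence qi: "0 < q ^ i" "q ^ i \<le> q" "q ^ i < 1" using q by auto
    have "(1 + q ^ i) / (1 - q ^ i) = 1 + 2 * q ^ i / (1 - q ^ i)"
      using qi by (simp add: field_simps)
    also have "\<dots> \<le> exp (2 * q ^ i / (1 - q ^ i))" by (rule exp_ge_add_one_self)
    also have "\<dots> \<le> exp (2 * q ^ i / (1 - q))"
      using qi q by (auto intro!: divide_left_mono)
    finally show "0 \<le> (1 + q ^ i) / (1 - q ^ i) \<and> (1 + q ^ i) / (1 - q ^ i) \<le> exp (2 * q ^ i / (1 - q))"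
      using qi by simp
  qed
  also have "\<dots> = exp (\<Sum>i=1..m. 2 * q ^ i / (1 - q))" by (simp add: exp_sum)
  also have "(\<Sum>i=1..m. 2 * q ^ i / (1 - q)) = 2 * q / (1 - q) * (\<Sum>i<m. q ^ i)"
    by (simp add: sum.atLeast1_atMost_eq sum_distrib_left mult.assoc)
  also have "\<dots> \<le> 2 * q / (1 - q) * (1 / (1 - q))"
    using q sum_le_suminf[of "\<lambda>i. q ^ i" "{..<m}"] suminf_geometric[of q] 
    by (intro mult_left_mono) (auto simp: summable_geometric)
  also have "\<dots> = 2 * q / (1 - q)\<^sup>2" by (simp add: power2_eq_square)
  finally show ?thesis by simp
qed

text \<open>For indices below \<open>m\<close> the bounded and unbounded counts agree, so each
  partial sum is at most a finite product, and those are bounded uniformly.\<close>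

lemma summable_overpartition:
  assumes r: "0 \<le> r" "r < (1::real)"
  shows "summable (\<lambda>n. real (overpartition_count n) * r ^ n)"
proof (cases "r = 0")
  case True
  have "(\<lambda>n. real (overpartition_count n) * r ^ n) = (\<lambda>n. if n = 0 then real (overpartition_count n) else 0)"
    using True by (auto simp: power_0_left)
  thus ?thesis by (simp add: summable_If_finite[of "\<lambda>n. n = 0"])
next
  case False
  hence r': "0 < r" using r by simp
  show ?thesis
  proof (rule summableI_nonneg_bounded)
    fix m
    have "(\<Sum>n<m. real (overpartition_count n) * r ^ n) = (\<Sum>n<m. real (bounded_count m n) * r ^ n)"
      by (intro sum.cong) (auto simp: bounded_count_eq)
    also have "\<dots> \<le> (\<Sum>n. real (bounded_count m n) * r ^ n)"
      using r by (intro sum_le_suminf bounded_count_summable) auto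
    also have "\<dots> = 1 / gauss_prod r m"
      using bounded_count_sums[of r m] r by (simp add: sums_iff)
    also have "\<dots> \<le> exp (2 * r / (1 - r)\<^sup>2)" by (rule inverse_gauss_prod_le[OF r' r(2)])
    finally show "(\<Sum>n<m. real (overpartition_count n) * r ^ n) \<le> exp (2 * r / (1 - r)\<^sup>2)" .
  qed (use r in auto)
qed

lemma overpartition_gf_sums:
  fixes q :: "'a::{real_normed_field,banach}"
  assumes "norm q < 1"
  shows "(\<lambda>n. of_nat (overpartition_count n) * q ^ n) sums overpartition_gf q"
proof -
  have "summable (\<lambda>n. norm (of_nat (overpartition_count n) * q ^ n))"
    using summable_overpartition[of "norm q"] assms by (simp add: norm_mult norm_power)
  thus ?thesis unfolding overpartition_gf_def by (rule summable_sums[OF summable_norm_cancel])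
qed

text \<open>The products are squeezed between the partial sums and the full sum: below
  \<open>m\<close> the bounded counts are exact, and they never exceed the full counts.\<close>

lemma inverse_gauss_prod_tendsto_real:
  assumes r: "0 \<le> r" "r < (1::real)"
  shows "(\<lambda>m. 1 / gauss_prod r m) \<longlonglongrightarrow> overpartition_gf r"
proof (rule tendsto_sandwich)
  note bs = bounded_count_sums[of r]
  note sb = bounded_count_summable[OF r]
  note ps = overpartition_gf_sums[of r]
  show "eventually (\<lambda>m. (\<Sum>n<m. real (overpartition_count n) * r ^ n) \<le> 1 / gauss_prod r m) sequentially"
  proof (rule always_eventually, rule allI)
    fix m
    have "(\<Sum>n<m. real (overpartition_count n) * r ^ n) = (\<Sum>n<m. real (bounded_count m n) * r ^ n)"
      by (intro sum.cong) (auto simp: bounded_count_eq)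
    also have "\<dots> \<le> (\<Sum>n. real (bounded_count m n) * r ^ n)"
      using r by (intro sum_le_suminf sb) auto
    also have "\<dots> = 1 / gauss_prod r m"
      using bs[of m] r by (simp add: sums_iff)
    finally show "(\<Sum>n<m. real (overpartition_count n) * r ^ n) \<le> 1 / gauss_prod r m" .
  qed
  show "eventually (\<lambda>m. 1 / gauss_prod r m \<le> overpartition_gf r) sequentially"
  proof (rule always_eventually, rule allI)
    fix m show "1 / gauss_prod r m \<le> overpartition_gf r"
      by (rule sums_le[OF _ bs ps]) (use r bounded_count_le in \<open>auto intro!: mult_right_mono\<close>)
  qed
  show "(\<lambda>m. \<Sum>n<m. real (overpartition_count n) * r ^ n) \<longlonglongrightarrow> overpartition_gf r"
    using ps r by (simp add: sums_def)
qed simp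

text \<open>Full minus bounded counts are nonnegative coefficients, so the error at \<open>q\<close>
  is dominated by the error at \<open>norm q\<close>, which tends to 0 by the real case.\<close>

lemma inverse_gauss_prod_tendsto:
  fixes q :: "'a::{real_normed_field,banach}"
  assumes q: "norm q < 1"
  shows "(\<lambda>m. 1 / gauss_prod q m) \<longlonglongrightarrow> overpartition_gf q"
proof -
  define r where "r = norm q"
  have r: "0 \<le> r" "r < 1" using q by (auto simp: r_def)
  have bound: "norm (overpartition_gf q - 1 / gauss_prod q m) \<le> overpartition_gf r - 1 / gauss_prod r m" for m
  proof -
    have s1: "(\<lambda>n. of_nat (overpartition_count n) * q ^ n - of_nat (bounded_count m n) * q ^ n) sums
            (overpartition_gf q - 1 / gauss_prod q m)"
      by (intro sums_diff overpartition_gf_sums bounded_count_sums q)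
    have s2: "(\<lambda>n. real (overpartition_count n) * r ^ n - real (bounded_count m n) * r ^ n) sums
            (overpartition_gf r - 1 / gauss_prod r m)"
      using r by (intro sums_diff overpartition_gf_sums bounded_count_sums) auto
    have "norm (of_nat (overpartition_count n) * q ^ n - of_nat (bounded_count m n) * q ^ n) \<le>
          real (overpartition_count n) * r ^ n - real (bounded_count m n) * r ^ n" for n
    proof -
      have "of_nat (overpartition_count n) * q ^ n - of_nat (bounded_count m n) * q ^ n
         = of_nat (overpartition_count n - bounded_count m n) * q ^ n"
        by (simp add: of_nat_diff bounded_count_le left_diff_distrib)
      hence "norm (of_nat (overpartition_count n) * q ^ n - of_nat (bounded_count m n) * q ^ n)
         = real (overpartition_count n - bounded_count m n) * r ^ n"
        by (simp only: norm_mult norm_power r_def norm_of_nat)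
      thus ?thesis by (simp add: of_nat_diff bounded_count_le left_diff_distrib)
    qed
    from norm_suminf_le[OF this sums_summable[OF s2]] show ?thesis
      unfolding sums_unique[OF s1, symmetric] sums_unique[OF s2, symmetric] .
  qed
  have "(\<lambda>m. overpartition_gf r - 1 / gauss_prod r m) \<longlonglongrightarrow> overpartition_gf r - overpartition_gf r"
    by (intro tendsto_intros inverse_gauss_prod_tendsto_real r)
  hence lim: "(\<lambda>m. overpartition_gf r - 1 / gauss_prod r m) \<longlonglongrightarrow> 0" by simp
  have "(\<lambda>m. overpartition_gf q - 1 / gauss_prod q m) \<longlonglongrightarrow> 0"
    using bound by (intro Lim_null_comparison[OF always_eventually lim]) blast
  from tendsto_diff[OF tendsto_const[of "overpartition_gf q"] this] show ?thesis by simp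
qed

lemma overpartition_gf_theta4_real:
  assumes q: "0 < q" "q < (1::real)"
  shows "overpartition_gf q * theta4 q = 1"
proof -
  have "(\<lambda>m. 1 / gauss_prod q m * gauss_prod q m) \<longlonglongrightarrow> overpartition_gf q * theta4 q"
    using q by (intro tendsto_mult inverse_gauss_prod_tendsto gauss_prod_tendsto_theta4) auto
  moreover have "1 / gauss_prod q m * gauss_prod q m = 1" for m
    using gauss_prod_pos[OF q, of m] by simp
  ultimately have "(\<lambda>m. 1) \<longlonglongrightarrow> overpartition_gf q * theta4 q" by simp
  thus ?thesis by (simp add: LIMSEQ_const_iff)
qed

text \<open>The logarithm of (1 + w) / (1 - w) is the sum of 2 w^k / k over odd k; \<open>c\<close>
  lists these nonnegative coefficients. The linear term is kept exactly, and in the others,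
  collected by \<open>d\<close>, Re (w^k) is replaced by |w|^k.\<close>

lemma norm_cayley_le:
  fixes w :: complex
  assumes w: "norm w < 1"
  shows "norm ((1 + w) / (1 - w)) \<le> (1 + norm w) / (1 - norm w) * exp (2 * Re w - 2 * norm w)"
proof -
  define c :: "nat \<Rightarrow> real" where "c = (\<lambda>k. ((-1) ^ Suc k + 1) / real k)"
  have c: "c k \<ge> 0" for k
    by (cases "even k") (simp_all add: c_def)
  have c1: "c 1 = 2" by (simp add: c_def)
  have S: "(\<lambda>k. of_real (c k) * z ^ k) sums (Ln (1 + z) - Ln (1 - z))" if "norm z < 1" for z :: complex
  proof -
    have "(\<lambda>n. (-1) ^ Suc n / of_nat n * z ^ n - (-1) ^ Suc n / of_nat n * (- z) ^ n) sums
           (Ln (1 + z) - Ln (1 + (- z)))"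
      using that by (intro sums_diff Ln_series) auto
    also have "(\<lambda>n. (-1) ^ Suc n / of_nat n * z ^ n - (-1) ^ Suc n / of_nat n * (- z) ^ n) = (\<lambda>k. of_real (c k) * z ^ k)"
    proof
      fix n show "(-1) ^ Suc n / of_nat n * z ^ n - (-1) ^ Suc n / of_nat n * (- z) ^ n = of_real (c n) * z ^ n"
        by (cases "even n") (auto simp: c_def)
    qed
    finally show ?thesis by simp
  qed
  have ex: "norm ((1 + z) / (1 - z)) = exp (Re (Ln (1 + z) - Ln (1 - z)))" if "norm z < 1" for z :: complex
  proof -
    have "1 + z \<noteq> 0" "1 - z \<noteq> 0" using that
      by (auto simp: add_eq_0_iff) 
    hence "exp (Ln (1 + z) - Ln (1 - z)) = (1 + z) / (1 - z)" by (simp add: exp_diff)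
    thus ?thesis by (metis norm_exp_eq_Re)
  qed
  define d where "d = (\<lambda>k. if k = 1 then 0 else c k)"
  have T: "(\<lambda>k. d k * Re (z ^ k)) sums (Re (Ln (1 + z) - Ln (1 - z)) - 2 * Re z)" if "norm z < 1" for z :: complex
  proof -
    have "(\<lambda>k. Re (of_real (c k) * z ^ k) - (if k = 1 then 2 * Re z else 0)) sums (Re (Ln (1 + z) - Ln (1 - z)) - 2 * Re z)"
      by (rule sums_diff[OF sums_Re[OF S[OF that]] sums_single[of 1 "\<lambda>_. 2 * Re z"]])
    also have "(\<lambda>k. Re (of_real (c k) * z ^ k) - (if k = 1 then 2 * Re z else 0)) = (\<lambda>k. d k * Re (z ^ k))"
      using c1 by (auto simp: d_def)
    finally show ?thesis .
  qed
  let ?r = "complex_of_real (norm w)"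
  have r: "norm ?r < 1" using w by simp
  have "Re (Ln (1 + w) - Ln (1 - w)) - 2 * Re w \<le> Re (Ln (1 + ?r) - Ln (1 - ?r)) - 2 * Re ?r"
  proof (rule sums_le[OF _ T[OF w] T[OF r]])
    fix k
    have "Re (w ^ k) \<le> norm (w ^ k)" by (rule complex_Re_le_cmod)
    also have "\<dots> = Re (?r ^ k)" by (simp add: norm_power flip: of_real_power)
    finally show "d k * Re (w ^ k) \<le> d k * Re (?r ^ k)"
      using c by (intro mult_left_mono) (auto simp: d_def)
  qed
  hence "exp (Re (Ln (1 + w) - Ln (1 - w))) \<le> exp (Re (Ln (1 + ?r) - Ln (1 - ?r)) + (2 * Re w - 2 * norm w))"
    by simp
  also have "\<dots> = norm ((1 + ?r) / (1 - ?r)) * exp (2 * Re w - 2 * norm w)"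
    by (simp only: ex[OF r] exp_add)
  also have "(1 + ?r) / (1 - ?r) = of_real ((1 + norm w) / (1 - norm w))"
    by simp
  also have "norm \<dots> = (1 + norm w) / (1 - norm w)"
    unfolding norm_of_real using w by simp
  finally show ?thesis using ex[OF w] by simp
qed

text \<open>\<open>norm_cayley_le\<close> is applied to every factor with w = q^i; the retained
  linear terms then sum to the geometric series q / (1 - q), whose real part drops sharply once q
  leaves the positive axis.\<close>

lemma norm_overpartition_gf_le:
  fixes q :: complex
  assumes q: "norm q < 1"
  defines "r \<equiv> norm q"
  shows "norm (overpartition_gf q) \<le> overpartition_gf r * exp (2 * Re (q / (1 - q)) - 2 * (r / (1 - r)))"
proof (rule LIMSEQ_le)
  have r: "0 \<le> r" "r < 1" using q by (auto simp: r_def)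
  have geo: "(\<lambda>m. \<Sum>i=1..m. z ^ i) \<longlonglongrightarrow> z / (1 - z)" if "norm z < 1" for z :: "'b::{real_normed_field,banach}"
  proof -
    have "(\<lambda>i. z * z ^ i) sums (z * (1 / (1 - z)))"
      using that by (intro sums_mult geometric_sums)
    thus ?thesis by (simp add: sums_def sum.atLeast1_atMost_eq)
  qed
  show "(\<lambda>m. norm (1 / gauss_prod q m)) \<longlonglongrightarrow> norm (overpartition_gf q)"
    by (intro tendsto_norm inverse_gauss_prod_tendsto q)
  show "(\<lambda>m. 1 / gauss_prod r m * exp (2 * Re (\<Sum>i=1..m. q ^ i) - 2 * (\<Sum>i=1..m. r ^ i)))
      \<longlonglongrightarrow> overpartition_gf r * exp (2 * Re (q / (1 - q)) - 2 * (r / (1 - r)))"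
    using r q by (intro tendsto_intros inverse_gauss_prod_tendsto_real geo) auto
  have "norm (1 / gauss_prod q m) \<le> 1 / gauss_prod r m * exp (2 * Re (\<Sum>i=1..m. q ^ i) - 2 * (\<Sum>i=1..m. r ^ i))" for m
  proof -
    have "norm (1 / gauss_prod q m) = (\<Prod>i=1..m. norm ((1 + q ^ i) / (1 - q ^ i)))"
      by (simp add: gauss_prod_def prod_dividef prod_norm norm_divide)
    also have "\<dots> \<le> (\<Prod>i=1..m. (1 + r ^ i) / (1 - r ^ i) * exp (2 * Re (q ^ i) - 2 * r ^ i))"
    proof (rule prod_mono)
      fix i assume "i \<in> {1..m}"
      hence "norm (q ^ i) < 1" using q by (simp add: norm_power power_less_one_iff)
      from norm_cayley_le[OF this]
      show "0 \<le> norm ((1 + q ^ i) / (1 - q ^ i)) \<and> norm ((1 + q ^ i) / (1 - q ^ i)) \<le>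
          (1 + r ^ i) / (1 - r ^ i) * exp (2 * Re (q ^ i) - 2 * r ^ i)"
        by (simp add: norm_power r_def)
    qed
    also have "\<dots> = 1 / gauss_prod r m * exp (\<Sum>i=1..m. 2 * Re (q ^ i) - 2 * r ^ i)"
      by (simp add: prod.distrib exp_sum gauss_prod_def prod_dividef)
    also have "(\<Sum>i=1..m. 2 * Re (q ^ i) - 2 * r ^ i) = 2 * Re (\<Sum>i=1..m. q ^ i) - 2 * (\<Sum>i=1..m. r ^ i)"
      by (simp add: sum_subtractf sum_distrib_left)
    finally show ?thesis .
  qed
  thus "\<exists>N. \<forall>m\<ge>N. norm (1 / gauss_prod q m) \<le> 1 / gauss_prod r m * exp (2 * Re (\<Sum>i=1..m. q ^ i) - 2 * (\<Sum>i=1..m. r ^ i))"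
    by blast
qed

section \<open>The transformation of the theta function\<close>

lemma cos_even_power_expansion:
  "(2 * cos x) ^ (2 * M) = (\<Sum>i\<le>2 * M. real (2 * M choose i) * cos ((2 * real i - 2 * real M) * x))"
proof -
  have "complex_of_real (2 * cos x) = cis x + cis (- x)"
    by (simp add: complex_eq_iff)
  hence "complex_of_real ((2 * cos x) ^ (2 * M)) = (cis x + cis (- x)) ^ (2 * M)"
    by (metis of_real_power)
  also have "\<dots> = (\<Sum>i\<le>2 * M. of_nat (2 * M choose i) * cis x ^ i * cis (- x) ^ (2 * M - i))"
    by (rule binomial_ring)
  also have "\<dots> = (\<Sum>i\<le>2 * M. of_nat (2 * M choose i) * cis ((2 * real i - 2 * real M) * x))"
  proof (rule sum.cong[OF refl])
    fix i assume "i \<in> {..2 * M}"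
    hence "cis x ^ i * cis (- x) ^ (2 * M - i) = cis ((2 * real i - 2 * real M) * x)"
      by (simp add: Complex.DeMoivre cis_mult of_nat_diff algebra_simps)
    thus "of_nat (2 * M choose i) * cis x ^ i * cis (- x) ^ (2 * M - i) =
          of_nat (2 * M choose i) * cis ((2 * real i - 2 * real M) * x)"
      by (simp add: mult.assoc)
  qed
  finally have "Re (complex_of_real ((2 * cos x) ^ (2 * M))) =
     Re (\<Sum>i\<le>2 * M. of_nat (2 * M choose i) * cis ((2 * real i - 2 * real M) * x))" by simp
  thus ?thesis by simp
qed

text \<open>Discrete orthogonality, by telescoping after multiplication with 2 sin a. Because the
  nodes are shifted by one half, the surviving frequencies carry the alternating sign that later
  becomes the sign in theta_4.\<close>

lemma sum_cos_odd_multiples: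
  fixes L r :: nat
  assumes L: "L > 0"
  shows "(\<Sum>j<2 * L. cos (2 * real r * (pi * (real j + 1 / 2) / (2 * real L)))) =
     (if 2 * L dvd r then 2 * real L * (-1) ^ (r div (2 * L)) else 0)"
proof -
  define a where "a = pi * real r / (2 * real L)"
  have eq: "2 * real r * (pi * (real j + 1 / 2) / (2 * real L)) = (2 * real j + 1) * a" for j
    using L by (simp add: a_def divide_simps)
  show ?thesis
  proof (cases "2 * L dvd r")
    case True
    then obtain k where k: "r = 2 * L * k" by auto
    have ak: "a = pi * real k" using L by (simp add: a_def k)
    have "cos ((2 * real j + 1) * a) = (-1) ^ k" for j
    proof -
      have "(2 * real j + 1) * a = real ((2 * j + 1) * k) * pi"
        using ak by (simp add: algebra_simps)
      hence "cos ((2 * real j + 1) * a) = (-1) ^ ((2 * j + 1) * k)"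
        by (metis cos_npi mult.commute)
      also have "\<dots> = (-1) ^ k" by (simp add: power_add power_mult)
      finally show ?thesis .
    qed
    thus ?thesis using True L by (simp only: eq) (simp add: k)
  next
    case False
    have "sin a \<noteq> 0"
    proof
      assume "sin a = 0"
      then obtain i :: int where "a = of_int i * pi" by (auto simp: sin_zero_iff_int2)
      hence "real r = of_int i * (2 * real L)" using L by (simp add: a_def field_simps)
      hence "int r = i * int (2 * L)"
        by (metis (mono_tags, opaque_lifting) of_int_eq_iff of_int_mult of_int_of_nat_eq of_nat_mult of_nat_numeral)
      hence "int (2 * L) dvd int r" by simp
      thus False using False by (simp only: int_dvd_int_iff)
    qed
    have "2 * sin a * (\<Sum>j<K. cos ((2 * real j + 1) * a)) = sin (2 * real K * a)" for K
    proof (induction K)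
      case (Suc K)
      have "2 * sin a * cos ((2 * real K + 1) * a) = sin (2 * real (Suc K) * a) - sin (2 * real K * a)"
        using sin_diff_sin[of "2 * real (Suc K) * a" "2 * real K * a"]
        by (simp add: algebra_simps add_divide_distrib)
      thus ?case using Suc by (simp add: distrib_left)
    qed auto
    from this[of "2 * L"] have "2 * sin a * (\<Sum>j<2 * L. cos ((2 * real j + 1) * a)) = sin (real (2 * r) * pi)"
      using L by (simp add: a_def mult_ac)
    also have "\<dots> = 0" by (rule sin_npi)
    finally show ?thesis using \<open>sin a \<noteq> 0\<close> False by (simp only: eq) simp
  qed
qed

lemma sum_symmetric_split:
  fixes f :: "nat \<Rightarrow> real"
  assumes "\<And>i. i \<le> M \<Longrightarrow> f (M - i) = f (M + i)"
  shows "(\<Sum>i\<le>2 * M. f i) = f M + 2 * (\<Sum>r=1..M. f (M + r))"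
proof -
  have "{..2 * M} = {..<M} \<union> {M} \<union> {M + 1..2 * M}" by auto
  hence "(\<Sum>i\<le>2 * M. f i) = (\<Sum>i<M. f i) + f M + (\<Sum>i=M + 1..2 * M. f i)"
    by (simp only:) (subst sum.union_disjoint; force)+
  also have "(\<Sum>i<M. f i) = (\<Sum>r=1..M. f (M + r))"
  proof (rule sum.reindex_bij_witness[of _ "\<lambda>r. M - r" "\<lambda>i. M - i"])
    fix i assume "i \<in> {..<M}"
    thus "f (M + (M - i)) = f i" using assms[of "M - i"] by simp
  qed auto
  also have "(\<Sum>i=M + 1..2 * M. f i) = (\<Sum>r=1..M. f (M + r))"
    by (rule sum.reindex_bij_witness[of _ "\<lambda>r. M + r" "\<lambda>i. i - M"]) auto
  finally show ?thesis by simp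
qed

text \<open>
  Polya's discrete form of Poisson summation: with \<open>4 L\<^sup>2 / M = t\<close> fixed and \<open>L \<rightarrow> \<infinity>\<close>, both sides
  converge termwise to the two theta series.
\<close>

lemma finite_theta_transformation:
  assumes L: "L > 0"
  shows "4 ^ M * (\<Sum>j<L. cos (pi * (real j + 1 / 2) / (2 * real L)) ^ (2 * M)) =
     real L * (real (2 * M choose M) + 2 * (\<Sum>k=1..M. (-1) ^ k * real (2 * M choose (M + 2 * L * k))))"
proof -
  define \<theta> where "\<theta> j = pi * (real j + 1 / 2) / (2 * real L)" for j
  define e where "e r = (if 2 * L dvd r then (-1) ^ (r div (2 * L)) else 0 :: real)" for r
  let ?s = "\<lambda>i. \<Sum>j<2 * L. cos ((2 * real i - 2 * real M) * \<theta> j)"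
  \<comment> \<open>The sum is extended from \<open>L\<close> to \<open>2 * L\<close> nodes so that
    orthogonality applies; the reflection of theta to pi - theta leaves even powers of the cosine
    unchanged and shows at the end that this doubles the sum.\<close>
  have "(\<Sum>j<2 * L. (2 * cos (\<theta> j)) ^ (2 * M)) =
     (\<Sum>i\<le>2 * M. real (2 * M choose i) * ?s i)"
    unfolding cos_even_power_expansion by (subst sum.swap) (simp add: sum_distrib_left)
  also have "\<dots> = real (2 * M choose M) * ?s M +
      2 * (\<Sum>r=1..M. real (2 * M choose (M + r)) * ?s (M + r))"
  proof (rule sum_symmetric_split)
    fix i assume i: "i \<le> M"
    have "2 * M choose (M - i) = 2 * M choose (M + i)"
      using binomial_symmetric[of "M - i" "2 * M"] i by (simp add: mult_2)
    moreover have "cos ((2 * real (M - i) - 2 * real M) * x) = cos ((2 * real (M + i) - 2 * real M) * x)" for x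
    proof -
      have "(2 * real (M - i) - 2 * real M) * x = - ((2 * real (M + i) - 2 * real M) * x)"
        using i by (simp add: of_nat_diff algebra_simps)
      thus ?thesis by (metis cos_minus)
    qed
    ultimately show "real (2 * M choose (M - i)) * ?s (M - i) =
      real (2 * M choose (M + i)) * ?s (M + i)" by simp
  qed
  also have "\<dots> = 2 * real L * (real (2 * M choose M) + 2 * (\<Sum>r=1..M. real (2 * M choose (M + r)) * e r))"
  proof -
    have "?s (M + r) = 2 * real L * e r" for r
      using sum_cos_odd_multiples[OF L, of r] by (simp add: \<theta>_def e_def)
    thus ?thesis by (simp add: algebra_simps sum_distrib_left)
  qed
  also have "(\<Sum>r=1..M. real (2 * M choose (M + r)) * e r) = (\<Sum>k=1..M. (-1) ^ k * real (2 * M choose (M + 2 * L * k)))"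
  proof -
    have "(\<Sum>r=1..M. real (2 * M choose (M + r)) * e r) = (\<Sum>r\<in>{r\<in>{1..M}. 2 * L dvd r}. real (2 * M choose (M + r)) * e r)"
      by (intro sum.mono_neutral_right) (auto simp: e_def)
    also have "\<dots> = (\<Sum>k\<in>{k\<in>{1..M}. 2 * L * k \<le> M}. (-1) ^ k * real (2 * M choose (M + 2 * L * k)))"
    proof (rule sum.reindex_bij_witness[of _ "\<lambda>k. 2 * L * k" "\<lambda>r. r div (2 * L)"])
      fix r assume "r \<in> {r \<in> {1..M}. 2 * L dvd r}"
      then obtain k where "r = 2 * L * k" "1 \<le> r" "r \<le> M" by auto
      moreover have "k \<le> 2 * L * k" using L by (simp add: Suc_le_eq)
      moreover from calculation have "k \<le> M" by linarith
      ultimately show "r div (2 * L) \<in> {k \<in> {1..M}. 2 * L * k \<le> M}" "2 * L * (r div (2 * L)) = r"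
        "(-1) ^ (r div (2 * L)) * real (2 * M choose (M + 2 * L * (r div (2 * L)))) = real (2 * M choose (M + r)) * e r"
        using L by (auto simp: e_def)
    qed (use L in auto)
    also have "\<dots> = (\<Sum>k=1..M. (-1) ^ k * real (2 * M choose (M + 2 * L * k)))"
      by (intro sum.mono_neutral_left) (auto simp: binomial_eq_0)
    finally show ?thesis .
  qed
  also have "(\<Sum>j<2 * L. (2 * cos (\<theta> j)) ^ (2 * M)) = 2 * (\<Sum>j<L. (2 * cos (\<theta> j)) ^ (2 * M))"
  proof -
    have "{..<2 * L} = {..<L} \<union> {L..<2 * L}" by auto
    hence "(\<Sum>j<2 * L. (2 * cos (\<theta> j)) ^ (2 * M)) = (\<Sum>j<L. (2 * cos (\<theta> j)) ^ (2 * M)) + (\<Sum>j=L..<2 * L. (2 * cos (\<theta> j)) ^ (2 * M))"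
      by (simp only:) (subst sum.union_disjoint; force)
    also have "(\<Sum>j=L..<2 * L. (2 * cos (\<theta> j)) ^ (2 * M)) = (\<Sum>j<L. (2 * cos (\<theta> j)) ^ (2 * M))"
    proof (rule sum.reindex_bij_witness[of _ "\<lambda>j. 2 * L - 1 - j" "\<lambda>j. 2 * L - 1 - j"])
      fix j assume j: "j \<in> {L..<2 * L}"
      hence "\<theta> (2 * L - 1 - j) = pi - \<theta> j"
        using L by (simp add: \<theta>_def of_nat_diff field_simps)
      thus "(2 * cos (\<theta> (2 * L - 1 - j))) ^ (2 * M) = (2 * cos (\<theta> j)) ^ (2 * M)"
        by (simp add: power_mult cos_diff)
    qed (use L in auto)
    finally show ?thesis by simp
  qed
  also have "(\<Sum>j<L. (2 * cos (\<theta> j)) ^ (2 * M)) = 4 ^ M * (\<Sum>j<L. cos (\<theta> j) ^ (2 * M))"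
    by (simp add: power_mult_distrib power_mult sum_distrib_left)
  finally show ?thesis by (simp add: \<theta>_def)
qed

text \<open>Wallis' product in disguise: its \<open>M\<close>-th partial product is 1 / (c^2 (2 M +
  1)) with c the normalised central binomial coefficient.\<close>

lemma central_binomial_tendsto:
  "(\<lambda>M. real (2 * M choose M) / 4 ^ M * sqrt (real M)) \<longlonglongrightarrow> 1 / sqrt pi"
proof -
  define c where "c M = real (2 * M choose M) / 4 ^ M" for M
  have c: "c M > 0" for M by (simp add: c_def)
  have cSuc: "c (Suc M) = c M * ((2 * real M + 1) / (2 * real M + 2))" for M
  proof -
    have "(Suc M) * (2 * Suc M choose Suc M) = 2 * Suc M * (Suc (2 * M) choose M)"
      using Suc_times_binomial_eq[of "Suc (2 * M)" M] by simp
    hence 1: "(2 * Suc M choose Suc M) = 2 * (Suc (2 * M) choose M)"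
      by (metis mult.assoc mult.left_commute mult_left_cancel Zero_not_Suc)
    have "Suc M * (Suc (2 * M) choose M) = Suc (2 * M) * (2 * M choose M)"
      using binomial_absorb_comp[of "Suc (2 * M)" M] by (simp add: Suc_diff_le)
    hence "real (Suc M) * real (Suc (2 * M) choose M) = real (Suc (2 * M)) * real (2 * M choose M)"
      by (metis of_nat_mult)
    hence "real (Suc (2 * M) choose M) = real (Suc (2 * M)) * real (2 * M choose M) / real (Suc M)"
      by (simp add: field_simps)
    thus ?thesis unfolding c_def 1 by (simp add: divide_simps) (simp add: algebra_simps)
  qed
  have W: "(\<Prod>k=1..M. (4 * real k ^ 2) / (4 * real k ^ 2 - 1)) = 1 / (c M ^ 2 * (2 * real M + 1))" for M
  proof (induction M)
    case 0 thus ?case by (simp add: c_def)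
  next
    case (Suc M)
    have fac: "(4 * real (Suc M) ^ 2) / (4 * real (Suc M) ^ 2 - 1) = (2 * real M + 2)\<^sup>2 / ((2 * real M + 1) * (2 * real M + 3))"
      by (simp add: power2_eq_square algebra_simps)
    have "(\<Prod>k=1..Suc M. (4 * real k ^ 2) / (4 * real k ^ 2 - 1)) =
        1 / (c M ^ 2 * (2 * real M + 1)) * ((2 * real M + 2)\<^sup>2 / ((2 * real M + 1) * (2 * real M + 3)))"
      using Suc fac by (simp add: mult.commute del: of_nat_Suc)
    also have "\<dots> = 1 / (c (Suc M) ^ 2 * (2 * real (Suc M) + 1))"
      unfolding cSuc using c[of M] by (simp add: power2_eq_square)
    finally show ?case .
  qed
  have "(\<lambda>M. sqrt (1 / (\<Prod>k=1..M. (4 * real k ^ 2) / (4 * real k ^ 2 - 1)) * (real M / (2 * real M + 1))))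
      \<longlonglongrightarrow> sqrt (1 / (pi / 2) * (1 / 2))"
  proof -
    have "(\<lambda>M. real M / (2 * real M + 1)) \<longlonglongrightarrow> 1 / 2" by real_asymp
    from tendsto_mult[OF tendsto_divide[OF tendsto_const[of 1] wallis] this]
    show ?thesis by (intro tendsto_real_sqrt) simp
  qed
  also have "(\<lambda>M. sqrt (1 / (\<Prod>k=1..M. (4 * real k ^ 2) / (4 * real k ^ 2 - 1)) * (real M / (2 * real M + 1))))
     = (\<lambda>M. c M * sqrt (real M))"
  proof
    fix M
    have "1 / (\<Prod>k=1..M. (4 * real k ^ 2) / (4 * real k ^ 2 - 1)) * (real M / (2 * real M + 1)) = (c M)\<^sup>2 * real M"
      unfolding W by (simp add: divide_simps)
    thus "sqrt (1 / (\<Prod>k=1..M. (4 * real k ^ 2) / (4 * real k ^ 2 - 1)) * (real M / (2 * real M + 1))) = c M * sqrt (real M)"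
      using c[of M] by (simp only: real_sqrt_mult real_sqrt_abs abs_of_pos)
  qed
  finally show ?thesis by (simp add: c_def real_sqrt_divide)
qed

section \<open>Binomial coefficients near the centre, compared with a Gaussian\<close>

lemma binomial_ratio_eq:
  "r \<le> M \<Longrightarrow> real (2 * M choose (M + r)) =
     real (2 * M choose M) * (\<Prod>j<r. (real M - real j) / (real M + real j + 1))"
proof (induction r)
  case (Suc r)
  have "Suc (M + r) * (2 * M choose Suc (M + r)) = (2 * M - (M + r)) * (2 * M choose (M + r))"
    by (metis binomial_absorb_comp binomial_absorption mult.commute)
  hence "real (Suc (M + r)) * real (2 * M choose Suc (M + r)) = (real M - real r) * real (2 * M choose (M + r))"
    using Suc.prems by (metis (no_types, lifting) Suc_leD add_diff_cancel_left diff_diff_left mult_2 of_nat_diff of_nat_mult)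
  thus ?case using Suc by (simp add: field_simps)
qed auto

lemma sum_odd_real: "(\<Sum>j<r. 2 * real j + 1) = (real r)\<^sup>2"
  by (induction r) (auto simp: power2_eq_square algebra_simps)

text \<open>Each factor is 1 - (2 j + 1) / (M + j + 1), bounded by 1 + x \<le> e^x with the largest
  denominator; the odd numbers add up to r^2.\<close>

lemma binomial_ratio_le:
  assumes "r \<le> M" "0 < M"
  shows "(\<Prod>j<r. (real M - real j) / (real M + real j + 1)) \<le> exp (- ((real r)\<^sup>2 / (real M + real r)))"
proof -
  have "(\<Prod>j<r. (real M - real j) / (real M + real j + 1)) \<le> (\<Prod>j<r. exp (- (2 * real j + 1) / (real M + real r)))"
  proof (rule prod_mono)
    fix j assume j: "j \<in> {..<r}"
    have "(real M - real j) / (real M + real j + 1) = 1 + - (2 * real j + 1) / (real M + real j + 1)"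
      by (simp add: field_simps)
    also have "\<dots> \<le> exp (- (2 * real j + 1) / (real M + real j + 1))" by (rule exp_ge_add_one_self)
    also have "\<dots> \<le> exp (- (2 * real j + 1) / (real M + real r))"
      using j by (simp only: exp_le_cancel_iff minus_divide_left[symmetric] neg_le_iff_le)
        (intro divide_left_mono mult_pos_pos; auto)
    finally show "0 \<le> (real M - real j) / (real M + real j + 1) \<and> (real M - real j) / (real M + real j + 1)
        \<le> exp (- (2 * real j + 1) / (real M + real r))"
      using j assms by auto
  qed
  also have "\<dots> = exp (- ((\<Sum>j<r. 2 * real j + 1) / (real M + real r)))"
    by (simp only: exp_sum[symmetric] finite_lessThan sum_divide_distrib sum_negf[symmetric] minus_divide_left)
  finally show ?thesis by (simp only: sum_odd_real)
qed

text \<open>The same estimate for the inverted factors 1 + (2 j + 1) / (M - j), now with the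
  smallest denominator.\<close>

lemma binomial_ratio_ge:
  assumes "r < M"
  shows "exp (- ((real r)\<^sup>2 / (real M - real r))) \<le> (\<Prod>j<r. (real M - real j) / (real M + real j + 1))"
proof -
  have "exp (- ((real r)\<^sup>2 / (real M - real r))) = exp (- ((\<Sum>j<r. 2 * real j + 1) / (real M - real r)))"
    by (simp only: sum_odd_real)
  also have "\<dots> = (\<Prod>j<r. exp (- (2 * real j + 1) / (real M - real r)))"
    by (simp only: exp_sum[symmetric] finite_lessThan sum_divide_distrib sum_negf[symmetric] minus_divide_left)
  also have "\<dots> \<le> (\<Prod>j<r. (real M - real j) / (real M + real j + 1))"
  proof (rule prod_mono)
    fix j assume j: "j \<in> {..<r}"
    have "(real M + real j + 1) / (real M - real j) = 1 + (2 * real j + 1) / (real M - real j)"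
      using j assms by (simp add: field_simps)
    also have "\<dots> \<le> exp ((2 * real j + 1) / (real M - real j))" by (rule exp_ge_add_one_self)
    also have "\<dots> \<le> exp ((2 * real j + 1) / (real M - real r))"
      using j assms by (simp only: exp_le_cancel_iff) (intro divide_left_mono mult_pos_pos; auto)
    finally have "inverse (exp ((2 * real j + 1) / (real M - real r))) \<le> inverse ((real M + real j + 1) / (real M - real j))"
      using j assms by (intro le_imp_inverse_le) auto
    thus "0 \<le> exp (- (2 * real j + 1) / (real M - real r)) \<and> exp (- (2 * real j + 1) / (real M - real r)) \<le>
       (real M - real j) / (real M + real j + 1)"
      by (simp add: exp_minus minus_divide_left[symmetric] del: minus_add_distrib minus_divide_left)
  qed
  finally show ?thesis .
qed

lemma binomial_ratio_tendsto:
  fixes r M :: "nat \<Rightarrow> nat"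
  assumes rM: "\<And>N. r N < M N"
    and lim1: "(\<lambda>N. (real (r N))\<^sup>2 / (real (M N) + real (r N))) \<longlonglongrightarrow> c"
    and lim2: "(\<lambda>N. (real (r N))\<^sup>2 / (real (M N) - real (r N))) \<longlonglongrightarrow> c"
  shows "(\<lambda>N. real (2 * M N choose (M N + r N)) / real (2 * M N choose M N)) \<longlonglongrightarrow> exp (- c)"
proof -
  have eq: "real (2 * M N choose (M N + r N)) / real (2 * M N choose M N) =
      (\<Prod>j<r N. (real (M N) - real j) / (real (M N) + real j + 1))" for N
    using binomial_ratio_eq[of "r N" "M N"] rM[of N] by simp
  show ?thesis
    unfolding eq
  proof (rule tendsto_sandwich)
    show "(\<lambda>N. exp (- ((real (r N))\<^sup>2 / (real (M N) - real (r N))))) \<longlonglongrightarrow> exp (- c)"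
      by (intro tendsto_intros lim2)
    show "(\<lambda>N. exp (- ((real (r N))\<^sup>2 / (real (M N) + real (r N))))) \<longlonglongrightarrow> exp (- c)"
      by (intro tendsto_intros lim1)
    show "eventually (\<lambda>N. exp (- ((real (r N))\<^sup>2 / (real (M N) - real (r N)))) \<le>
        (\<Prod>j<r N. (real (M N) - real j) / (real (M N) + real j + 1))) sequentially"
      using rM binomial_ratio_ge by simp
    show "eventually (\<lambda>N. (\<Prod>j<r N. (real (M N) - real j) / (real (M N) + real j + 1)) \<le>
        exp (- ((real (r N))\<^sup>2 / (real (M N) + real (r N))))) sequentially"
    proof (intro always_eventually allI)
      fix N show "(\<Prod>j<r N. (real (M N) - real j) / (real (M N) + real j + 1)) \<le>
        exp (- ((real (r N))\<^sup>2 / (real (M N) + real (r N))))"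
        using rM[of N] by (intro binomial_ratio_le) auto
    qed
  qed
qed

text \<open>A Gaussian bound without any restriction on \<open>r\<close>; it serves as the
  dominating term when limit and summation are interchanged.\<close>

lemma binomial_ratio_le':
  assumes "0 < M"
  shows "real (2 * M choose (M + r)) / real (2 * M choose M) \<le> exp (- ((real r)\<^sup>2 / (2 * real M)))"
proof (cases "r \<le> M")
  case True
  have "real (2 * M choose (M + r)) / real (2 * M choose M) = (\<Prod>j<r. (real M - real j) / (real M + real j + 1))"
    using binomial_ratio_eq[OF True] by simp
  also have "\<dots> \<le> exp (- ((real r)\<^sup>2 / (real M + real r)))"
    by (rule binomial_ratio_le[OF True assms])
  also have "\<dots> \<le> exp (- ((real r)\<^sup>2 / (2 * real M)))"
    using True assms by (simp only: exp_le_cancel_iff neg_le_iff_le) (intro divide_left_mono; simp)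
  finally show ?thesis .
qed (simp add: binomial_eq_0)

text \<open>The derivative of cos y exp (y^2 / 2) has the sign of y cos y - sin y. The bound
  supplies the dominating series on the cosine side of the theta transformation and again an upper
  bound for the cosine on the minor arcs.\<close>

lemma cos_le_exp:
  assumes "0 \<le> x" "x < pi / 2"
  shows "cos x \<le> exp (- x\<^sup>2 / 2)"
proof -
  define f where "f y = cos y * exp (y\<^sup>2 / 2)" for y :: real
  have "f x \<le> f 0"
  proof (rule DERIV_nonpos_imp_nonincreasing[OF assms(1)])
    fix y assume y: "0 \<le> y" "y \<le> x"
    have "(f has_real_derivative (exp (y\<^sup>2 / 2) * (y * cos y - sin y))) (at y)"
      unfolding f_def by (auto intro!: derivative_eq_intros simp: algebra_simps)
    moreover have "y * cos y \<le> sin y"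
    proof -
      have "sin 0 - 0 * cos 0 \<le> sin y - y * cos y"
      proof (rule DERIV_nonneg_imp_nondecreasing[OF y(1)])
        fix z assume z: "0 \<le> z" "z \<le> y"
        have "((\<lambda>z. sin z - z * cos z) has_real_derivative z * sin z) (at z)"
          by (auto intro!: derivative_eq_intros)
        moreover have "z * sin z \<ge> 0"
          using z y assms by (intro mult_nonneg_nonneg sin_ge_zero) auto
        ultimately show "\<exists>D. ((\<lambda>z. sin z - z * cos z) has_real_derivative D) (at z) \<and> 0 \<le> D"
          by blast
      qed
      thus ?thesis by simp
    qed
    ultimately show "\<exists>D. (f has_real_derivative D) (at y) \<and> D \<le> 0"
      by (intro exI[of _ "exp (y\<^sup>2 / 2) * (y * cos y - sin y)"]) (auto simp: mult_nonneg_nonpos)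
  qed
  thus ?thesis by (simp add: f_def exp_minus field_simps)
qed

lemma cos_ge_quadratic: "1 - x\<^sup>2 / 2 \<le> cos (x::real)"
proof -
  have "(sin (x / 2))\<^sup>2 \<le> (x / 2)\<^sup>2"
    using abs_sin_x_le_abs_x[of "x / 2"] by (simp only: abs_le_square_iff)
  thus ?thesis using cos_double_sin[of "x / 2"] by (simp add: power2_eq_square)
qed

text \<open>Rationality of \<open>t\<close> allows integers \<open>L N\<close> and
  \<open>M N\<close> with 4 L^2 / M equal to \<open>t\<close> exactly for every \<open>N\<close>.
  Both sides of the finite identity then converge by Tannery's theorem, and the central binomial
  coefficient contributes the factor sqrt (pi / t).\<close>

lemma theta4_transformation_rat:
  fixes a b :: nat
  assumes ab: "a > 0" "b > 0"
  defines "t \<equiv> real a / real b"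
  shows "theta4 (exp (- t)) = 2 * sqrt (pi / t) * (\<Sum>j. exp (- (pi\<^sup>2 * (real j + 1 / 2)\<^sup>2 / t)))"
proof -
  define L where "L N = a * (N + 1)" for N
  define M where "M N = 4 * a * b * (N + 1)\<^sup>2" for N
  let ?S = "\<lambda>N. \<Sum>k=1..M N. (-1) ^ k * (real (2 * M N choose (M N + 2 * L N * k)) / real (2 * M N choose M N))"
  let ?c = "\<lambda>N. real (2 * M N choose M N) / 4 ^ M N * sqrt (real (M N)) * (sqrt t / 2)"
  have pos: "L N > 0" "M N > 0" for N using ab by (auto simp: L_def M_def)
  have t: "t > 0" using ab by (simp add: t_def)
  have M_ge: "N \<le> M N" for N
  proof -
    have "1 * (N + 1)\<^sup>2 \<le> 4 * a * b * (N + 1)\<^sup>2"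
      using ab by (intro mult_right_mono) (auto simp: Suc_le_eq)
    moreover have "N \<le> 1 * (N + 1)\<^sup>2" by (simp add: power2_eq_square)
    ultimately show ?thesis unfolding M_def by linarith
  qed
  have M_top': "filterlim M at_top sequentially"
    by (rule filterlim_at_top_mono[OF filterlim_ident]) (simp add: M_ge)
  have M_top: "filterlim (\<lambda>N. 2 * M N) at_top sequentially"
    by (rule filterlim_at_top_mono[OF M_top']) simp
  define c where "c j = pi\<^sup>2 * (real j + 1 / 2)\<^sup>2 / t" for j
  define \<theta> where "\<theta> j N = pi * (real j + 1 / 2) / (2 * real (L N))" for j N
  have c0: "c j \<ge> 0" for j using t by (simp add: c_def)
  \<comment> \<open>By the choice of \<open>M\<close> and \<open>L\<close> this product does not
    depend on \<open>N\<close>, so cos^(2 M) has a Gaussian limit and a bound uniform in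
    \<open>N\<close>.\<close>
  have \<theta>c: "real (M N) * (\<theta> j N)\<^sup>2 = c j" for j N
  proof -
    have "4 * A * B * u\<^sup>2 * (pi * h / (2 * (A * u)))\<^sup>2 = pi\<^sup>2 * h\<^sup>2 / (A / B)"
      if "A > 0" "B > 0" "u > 0" for A B u h :: real
      using that by (simp add: power2_eq_square divide_simps)
    from this[of "real a" "real b" "real (N + 1)" "real j + 1 / 2"] show ?thesis
      using ab by (simp only: M_def \<theta>_def L_def c_def t_def of_nat_mult of_nat_power of_nat_numeral of_nat_0_less_iff zero_less_Suc add_gr_0) simp
  qed
  have \<theta>0: "0 \<le> \<theta> j N" for j N by (simp add: \<theta>_def)
  have \<theta>1: "\<theta> j N < pi / 2" if "j < L N" for j N
  proof -
    have "pi * (real j + 1 / 2) < pi * real (L N)" using that by (intro mult_strict_left_mono) auto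
    thus ?thesis using pos(1)[of N] by (simp add: \<theta>_def pos_divide_less_eq)
  qed
  have up: "cos (\<theta> j N) ^ (2 * M N) \<le> exp (- c j)" if "j < L N" for j N
  proof -
    have "cos (\<theta> j N) ^ (2 * M N) \<le> exp (- (\<theta> j N)\<^sup>2 / 2) ^ (2 * M N)"
      using \<theta>0[of j N] \<theta>1[OF that] pi_ge_zero
      by (intro power_mono cos_le_exp cos_ge_zero) linarith+
    also have "\<dots> = exp (- c j)"
      unfolding \<theta>c[of N, symmetric] exp_of_nat_mult[symmetric] by simp
    finally show ?thesis .
  qed
  define A where "A j N = (if j < L N then cos (\<theta> j N) ^ (2 * M N) else 0)" for j N
  have ev: "eventually (\<lambda>N. j < L N) sequentially" for j
  proof (rule eventually_sequentiallyI[of j])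
    fix N assume "j \<le> N" thus "j < L N" using ab by (cases a) (auto simp: L_def)
  qed
  \<comment> \<open>Squeezed between (1 - c / (2 M))^(2 M), from cos x \<ge> 1 - x^2 / 2, and its
    limit exp (- c), which is the upper bound \<open>up\<close>.\<close>
  have limA: "(\<lambda>N. A j N) \<longlonglongrightarrow> exp (- c j)" for j
  proof (rule tendsto_sandwich)
    show "eventually (\<lambda>N. A j N \<le> exp (- c j)) sequentially"
      by (intro always_eventually allI) (use up in \<open>auto simp: A_def\<close>)
    show "(\<lambda>N. (1 + - c j / real (2 * M N)) ^ (2 * M N)) \<longlonglongrightarrow> exp (- c j)"
      by (rule filterlim_compose[OF tendsto_exp_limit_sequentially M_top])
    have "eventually (\<lambda>n. c j \<le> real n) sequentially"
      using eventually_ge_at_top[of "nat \<lceil>c j\<rceil>"] by eventually_elim linarith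
    hence "eventually (\<lambda>N. c j \<le> real (2 * M N)) sequentially"
      using M_top by (rule eventually_compose_filterlim)
    thus "eventually (\<lambda>N. (1 + - c j / real (2 * M N)) ^ (2 * M N) \<le> A j N) sequentially"
      using ev[of j]
    proof eventually_elim
      case (elim N)
      have "c j / real (2 * M N) = (\<theta> j N)\<^sup>2 / 2"
        using pos(2)[of N] \<theta>c[of N j] by (simp add: field_simps)
      hence "1 + - c j / real (2 * M N) \<le> cos (\<theta> j N)"
        using cos_ge_quadratic[of "\<theta> j N"] by simp
      moreover have "0 \<le> 1 + - c j / real (2 * M N)"
        using elim pos(2)[of N] by (simp add: field_simps)
      ultimately show ?case unfolding A_def if_P[OF elim(2)] by (rule power_mono)
    qed
  qed (rule tendsto_const)
  have sumc: "summable (\<lambda>j. exp (- c j))"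
  proof (rule summable_comparison_test')
    show "summable (\<lambda>j. exp (- (pi\<^sup>2 / t)) ^ j * exp (- (pi\<^sup>2 / (4 * t))))"
      using t by (intro summable_mult2 summable_geometric) auto
    fix j :: nat
    have "real j \<le> (real j)\<^sup>2" by (cases j) (auto simp: power2_eq_square)
    hence "real j + 1 / 4 \<le> (real j + 1 / 2)\<^sup>2" by (simp add: power2_eq_square algebra_simps)
    hence "pi\<^sup>2 / t * (real j + 1 / 4) \<le> pi\<^sup>2 / t * (real j + 1 / 2)\<^sup>2"
      using t by (intro mult_left_mono) auto
    hence "- c j \<le> real j * (- (pi\<^sup>2 / t)) + - (pi\<^sup>2 / (4 * t))"
      by (simp add: c_def algebra_simps)
    hence "exp (- c j) \<le> exp (real j * (- (pi\<^sup>2 / t)) + - (pi\<^sup>2 / (4 * t)))" by simp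
    thus "norm (exp (- c j)) \<le> exp (- (pi\<^sup>2 / t)) ^ j * exp (- (pi\<^sup>2 / (4 * t)))"
      unfolding exp_add exp_of_nat_mult by simp
  qed
  have "(\<lambda>N. suminf (\<lambda>j. A j N)) \<longlonglongrightarrow> (\<Sum>j. exp (- c j))"
  proof (rule conjunct2[OF conjunct2[OF tannerys_theorem[OF limA _ sumc]]])
    show "\<forall>\<^sub>F (j, N) in sequentially \<times>\<^sub>F sequentially. norm (A j N) \<le> exp (- c j)"
      by (intro always_eventually) (use up in \<open>auto simp: A_def power_mult\<close>)
  qed simp
  moreover have "suminf (\<lambda>j. A j N) = (\<Sum>j<L N. cos (\<theta> j N) ^ (2 * M N))" for N
    by (subst suminf_finite[of "{..<L N}"]) (auto simp: A_def)
  ultimately have lim1: "(\<lambda>N. \<Sum>j<L N. cos (\<theta> j N) ^ (2 * M N)) \<longlonglongrightarrow> (\<Sum>j. exp (- c j))"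
    by simp

  define B where "B k N = (-1) ^ Suc k * (real (2 * M N choose (M N + 2 * L N * Suc k)) / real (2 * M N choose M N))" for k N
  have Bb: "norm (B k N) \<le> exp (- (t / 2)) ^ k" for k N
  proof -
    have "real (2 * M N choose (M N + 2 * L N * Suc k)) / real (2 * M N choose M N) \<le>
       exp (- ((real (2 * L N * Suc k))\<^sup>2 / (2 * real (M N))))"
      by (rule binomial_ratio_le'[OF pos(2)])
    also have "(real (2 * L N * Suc k))\<^sup>2 / (2 * real (M N)) = t / 2 * (real (Suc k))\<^sup>2"
    proof -
      have "(2 * (A * u) * z)\<^sup>2 / (2 * (4 * A * B * u\<^sup>2)) = A / B / 2 * z\<^sup>2"
        if "A > 0" "B > 0" "u > 0" for A B u z :: real
        using that by (simp add: power2_eq_square divide_simps)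
      from this[of "real a" "real b" "real (N + 1)" "real (Suc k)"] show ?thesis
        using ab by (simp only: M_def L_def t_def of_nat_mult of_nat_power of_nat_numeral of_nat_0_less_iff zero_less_Suc add_gr_0) simp
    qed
    also have "exp (- (t / 2 * (real (Suc k))\<^sup>2)) \<le> exp (real k * (- (t / 2)))"
    proof -
      have "real k \<le> (real (Suc k))\<^sup>2" by (simp add: power2_eq_square algebra_simps)
      thus ?thesis using t by (simp add: mult.commute)
    qed
    also have "\<dots> = exp (- (t / 2)) ^ k" by (rule exp_of_nat_mult)
    finally show ?thesis by (simp add: B_def abs_mult)
  qed
  have limB: "(\<lambda>N. B k N) \<longlonglongrightarrow> theta4_series (exp (- t)) k" for k
  proof -
    \<comment> \<open>Shifting the index by \<open>k\<close> makes \<open>r N < M N\<close> hold for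
      every \<open>N\<close>, as \<open>binomial_ratio_tendsto\<close> demands;
      \<open>LIMSEQ_offset\<close> removes the shift.\<close>
    have "(\<lambda>N. real (2 * M (N + k) choose (M (N + k) + 2 * L (N + k) * Suc k)) / real (2 * M (N + k) choose M (N + k)))
       \<longlonglongrightarrow> exp (- (t * (real (Suc k))\<^sup>2))"
    proof (rule binomial_ratio_tendsto)
      fix N
      have "Suc k \<le> b * (N + k + 1)" using ab(2) by (cases b) auto
      hence "2 * a * (N + k + 1) * Suc k \<le> 2 * a * (N + k + 1) * (b * (N + k + 1))" by (rule mult_left_mono) simp
      also have "\<dots> < 4 * a * b * (N + k + 1)\<^sup>2"
      proof -
        have "4 * a * b * u\<^sup>2 = 2 * a * u * (b * u) + 2 * a * b * u\<^sup>2" for u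
          by (simp add: power2_eq_square)
        moreover have "0 < 2 * a * b * (N + k + 1)\<^sup>2" using ab by simp
        ultimately show ?thesis by (simp only: less_add_same_cancel1)
      qed
      finally show "2 * L (N + k) * Suc k < M (N + k)" by (simp only: L_def M_def mult.assoc)
    next
      have *: "(\<lambda>N. (2 * x * (real (N + k) + 1) * z)\<^sup>2 / (4 * x * y * (real (N + k) + 1)\<^sup>2 + s * (2 * x * (real (N + k) + 1) * z)))
             \<longlonglongrightarrow> x / y * z\<^sup>2" if "x > 0" "y > 0" "z > 0" for x y z s :: real
      proof -
        have e: "x / y * z\<^sup>2 = (2 * x * z)\<^sup>2 * (inverse x * inverse y) / 4"
          using that by (simp add: power2_eq_square field_simps)
        show ?thesis unfolding e using that by real_asymp
      qed
      have r: "real (2 * L (N + k) * Suc k) = 2 * real a * (real (N + k) + 1) * real (Suc k)"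
         "real (M (N + k)) = 4 * real a * real b * (real (N + k) + 1)\<^sup>2" for N
        by (simp_all add: L_def M_def algebra_simps)
      show "(\<lambda>N. (real (2 * L (N + k) * Suc k))\<^sup>2 / (real (M (N + k)) + real (2 * L (N + k) * Suc k))) \<longlonglongrightarrow> t * (real (Suc k))\<^sup>2"
        using *[of "real a" "real b" "real (Suc k)" 1] ab unfolding r t_def by simp
      show "(\<lambda>N. (real (2 * L (N + k) * Suc k))\<^sup>2 / (real (M (N + k)) - real (2 * L (N + k) * Suc k))) \<longlonglongrightarrow> t * (real (Suc k))\<^sup>2"
        using *[of "real a" "real b" "real (Suc k)" "-1"] ab unfolding r t_def by simp
    qed
    hence "(\<lambda>N. B k (N + k)) \<longlonglongrightarrow> (-1) ^ Suc k * exp (- (t * (real (Suc k))\<^sup>2))"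
      unfolding B_def by (rule tendsto_mult[OF tendsto_const])
    also have "exp (- (t * (real (Suc k))\<^sup>2)) = exp (- t) ^ (Suc k)\<^sup>2"
      unfolding exp_of_nat_mult[symmetric] by (simp add: mult.commute)
    finally show ?thesis unfolding theta4_series_def by (rule LIMSEQ_offset)
  qed
  have "(\<lambda>N. suminf (\<lambda>k. B k N)) \<longlonglongrightarrow> (\<Sum>k. theta4_series (exp (- t)) k)"
  proof (rule conjunct2[OF conjunct2[OF tannerys_theorem[OF limB]]])
    show "\<forall>\<^sub>F (k, N) in sequentially \<times>\<^sub>F sequentially. norm (B k N) \<le> exp (- (t / 2)) ^ k"
      by (intro always_eventually) (use Bb in auto)
    show "summable (\<lambda>k. exp (- (t / 2)) ^ k)" using t by simp
  qed simp
  moreover have "suminf (\<lambda>k. B k N) = ?S N" for N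
  proof (subst suminf_finite[of "{..<M N}"])
    fix k assume k: "k \<notin> {..<M N}"
    have "k < 2 * L N * Suc k" using pos(1)[of N] by (cases "L N") auto
    hence "2 * M N < M N + 2 * L N * Suc k" using k by simp
    thus "B k N = 0" by (simp add: B_def binomial_eq_0 del: mult_Suc_right)
  qed (auto simp: B_def sum.atLeast1_atMost_eq)
  ultimately have lim2: "(\<lambda>N. 1 + 2 * ?S N)
     \<longlonglongrightarrow> theta4 (exp (- t))"
    unfolding theta4_def by (intro tendsto_intros) simp
  from filterlim_compose[OF central_binomial_tendsto M_top']
  have "(\<lambda>N. ?c N * (1 + 2 * ?S N))
     \<longlonglongrightarrow> 1 / sqrt pi * (sqrt t / 2) * theta4 (exp (- t))"
    by (intro tendsto_mult tendsto_const lim2)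
  also have "(\<lambda>N. ?c N * (1 + 2 * ?S N))
     = (\<lambda>N. \<Sum>j<L N. cos (\<theta> j N) ^ (2 * M N))"
  proof
    fix N
    define S where "S = (\<Sum>k=1..M N. (-1) ^ k * real (2 * M N choose (M N + 2 * L N * k)))"
    have 1: "?S N = S / real (2 * M N choose M N)"
      by (simp add: S_def sum_divide_distrib)
    have 2: "4 ^ M N * (\<Sum>j<L N. cos (\<theta> j N) ^ (2 * M N)) = real (L N) * (real (2 * M N choose M N) + 2 * S)"
      using finite_theta_transformation[OF pos(1), of "M N" N] by (simp only: \<theta>_def S_def)
    \<comment> \<open>Since M t = (2 L)^2 exactly, the prefactor collapses to \<open>L\<close>, the
      factor on the right of the finite identity.\<close>
    have "sqrt (real (M N)) * (sqrt t / 2) = sqrt (real (M N) * t) / 2" by (simp add: real_sqrt_mult)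
    also have "real (M N) * t = (2 * real (L N))\<^sup>2"
    proof -
      have "4 * A * B * u\<^sup>2 * (A / B) = (2 * (A * u))\<^sup>2" if "B > 0" for A B u :: real
        using that by (simp add: power2_eq_square)
      from this[of "real b" "real a" "real (N + 1)"] show ?thesis
        using ab by (simp only: M_def L_def t_def of_nat_mult of_nat_power of_nat_numeral of_nat_0_less_iff)
    qed
    also have "sqrt ((2 * real (L N))\<^sup>2) / 2 = real (L N)" by (subst real_sqrt_abs) simp
    finally have 3: "sqrt (real (M N)) * (sqrt t / 2) = real (L N)" .
    have C: "real (2 * M N choose M N) > 0" by simp
    have "real (2 * M N choose M N) / 4 ^ M N * sqrt (real (M N)) * (sqrt t / 2) * (1 + 2 * (S / real (2 * M N choose M N)))
       = real (2 * M N choose M N) / 4 ^ M N * (sqrt (real (M N)) * (sqrt t / 2)) * (1 + 2 * (S / real (2 * M N choose M N)))"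
      by simp
    also have "\<dots> = real (L N) * (real (2 * M N choose M N) + 2 * S) / 4 ^ M N"
      unfolding 3 using C by (simp add: field_simps)
    also have "\<dots> = (\<Sum>j<L N. cos (\<theta> j N) ^ (2 * M N))"
      unfolding 2[symmetric] by simp
    finally show "?c N * (1 + 2 * ?S N)
      = (\<Sum>j<L N. cos (\<theta> j N) ^ (2 * M N))" unfolding 1 .
  qed
  finally have "1 / sqrt pi * (sqrt t / 2) * theta4 (exp (- t)) = (\<Sum>j. exp (- c j))"
    using lim1 LIMSEQ_unique by blast
  thus ?thesis using t by (simp add: c_def real_sqrt_divide field_simps)
qed

section \<open>The transformation of the generating function\<close>

text \<open>Jacobi's theta_2 without its factor 2 w^(1/4): since (m + 1/2)^2 = m (m + 1) + 1/4, the
  exponents become integers and the leading term becomes 1.\<close>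

definition theta2_series :: "'a::{real_normed_field,banach} \<Rightarrow> 'a" where
  "theta2_series w = (\<Sum>m. w ^ (m * (m + 1)))"

lemma theta2_series_sums:
  fixes w :: "'a::{real_normed_field,banach}"
  assumes "norm w < 1"
  shows "(\<lambda>m. w ^ (m * (m + 1))) sums theta2_series w"
proof -
  have "summable (\<lambda>m. w ^ (m * (m + 1)))"
  proof (rule summable_comparison_test')
    show "summable (\<lambda>m. norm w ^ m)" using assms by simp
    show "norm (w ^ (m * (m + 1))) \<le> norm w ^ m" for m
      using assms unfolding norm_power by (intro power_decreasing) auto
  qed
  thus ?thesis unfolding theta2_series_def by (rule summable_sums)
qed

text \<open>The tail starts at w^2 and is dominated by |w|^2 / (1 - |w|), which is at most |w| for
  |w| \<le> 1/2.\<close>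

lemma norm_theta2_series_minus_1:
  fixes w :: "'a::{real_normed_field,banach}"
  assumes w: "norm w \<le> 1 / 2"
  shows "norm (theta2_series w - 1) \<le> norm w"
proof -
  have w1: "norm w < 1" using w by simp
  have s: "(\<lambda>m. w ^ (Suc m * (Suc m + 1))) sums (theta2_series w - 1)"
    using sums_split_initial_segment[OF theta2_series_sums[OF w1], of 1] by simp
  have g: "(\<lambda>m. (norm w)\<^sup>2 * norm w ^ m) sums ((norm w)\<^sup>2 * (1 / (1 - norm w)))"
    using w1 by (intro sums_mult geometric_sums) simp
  have "norm (w ^ (Suc m * (Suc m + 1))) \<le> (norm w)\<^sup>2 * norm w ^ m" for m
    using w1 unfolding norm_power power_add[symmetric] by (intro power_decreasing) auto
  from norm_suminf_le[OF this sums_summable[OF g]]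
  have "norm (theta2_series w - 1) \<le> (norm w)\<^sup>2 * (1 / (1 - norm w))"
    unfolding sums_unique[OF s, symmetric] sums_unique[OF g, symmetric] .
  also have "\<dots> = norm w * (norm w / (1 - norm w))" by (simp add: power2_eq_square)
  also have "\<dots> \<le> norm w * 1"
    using w by (intro mult_left_mono) (auto simp: field_simps)
  finally show ?thesis by simp
qed

lemma holomorphic_overpartition_gf: "overpartition_gf holomorphic_on ball (0::complex) 1"
  by (rule power_series_holomorphic[where a = "\<lambda>n. of_nat (overpartition_count n)"])
    (simp add: overpartition_gf_sums)

lemma holomorphic_theta2_series: "theta2_series holomorphic_on ball (0::complex) 1"
proof (rule power_series_holomorphic)
  fix w :: complex assume w: "w \<in> ball 0 1"
  define g where "g m = m * (m + 1)" for m :: nat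
  define a :: "nat \<Rightarrow> complex" where "a n = (if n \<in> range g then 1 else 0)" for n
  have "strict_mono g" unfolding strict_mono_Suc_iff g_def by simp
  hence "(\<lambda>m. a (g m) * w ^ g m) sums theta2_series w \<longleftrightarrow> (\<lambda>n. a n * w ^ n) sums theta2_series w"
    by (rule sums_mono_reindex) (auto simp: a_def)
  moreover have "(\<lambda>m. a (g m) * w ^ g m) sums theta2_series w"
    using theta2_series_sums[of w] w by (simp add: a_def) (simp add: g_def)
  ultimately show "(\<lambda>n. (if n \<in> range (\<lambda>m. m * (m + 1)) then 1 else 0) * (w - 0) ^ n) sums theta2_series w"
    by (simp add: a_def g_def[abs_def])
qed

lemma overpartition_gf_of_real:
  assumes "\<bar>r\<bar> < 1"
  shows "overpartition_gf (complex_of_real r) = of_real (overpartition_gf r)"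
proof -
  have "(\<lambda>n. complex_of_real (of_nat (overpartition_count n) * r ^ n)) sums of_real (overpartition_gf r)"
    by (intro sums_of_real overpartition_gf_sums) (use assms in auto)
  hence "(\<lambda>n. of_nat (overpartition_count n) * complex_of_real r ^ n) sums of_real (overpartition_gf r)"
    by simp
  moreover have "(\<lambda>n. of_nat (overpartition_count n) * complex_of_real r ^ n) sums overpartition_gf (complex_of_real r)"
    using assms by (intro overpartition_gf_sums) simp
  ultimately show ?thesis using sums_unique2 by blast
qed

lemma theta2_series_of_real:
  assumes "\<bar>r\<bar> < 1"
  shows "theta2_series (complex_of_real r) = of_real (theta2_series r)"
proof -
  have "(\<lambda>m. complex_of_real (r ^ (m * (m + 1)))) sums of_real (theta2_series r)"
    by (intro sums_of_real theta2_series_sums) (use assms in auto)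
  hence "(\<lambda>m. complex_of_real r ^ (m * (m + 1))) sums of_real (theta2_series r)"
    by simp
  moreover have "(\<lambda>m. complex_of_real r ^ (m * (m + 1))) sums theta2_series (complex_of_real r)"
    using assms by (intro theta2_series_sums) simp
  ultimately show ?thesis using sums_unique2 by blast
qed

text \<open>What the generating function at e^(-t) would be if \<open>theta2_series\<close> were
  replaced by 1. The principal root is holomorphic here, since Re t > 0 keeps t / pi off the branch
  cut.\<close>

definition singular_part :: "complex \<Rightarrow> complex" where
  "singular_part t = csqrt (t / of_real pi) / 2 * exp (of_real (pi\<^sup>2) / (4 * t))"

lemma singular_part_of_real:
  assumes "0 \<le> x"
  shows "singular_part (of_real x) = of_real (sqrt (x / pi) / 2 * exp (pi\<^sup>2 / (4 * x)))"
proof -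
  have "csqrt (of_real x / of_real pi) = of_real (sqrt (x / pi))"
    using assms by (simp flip: of_real_divide add: csqrt_of_real_nonneg)
  moreover have "of_real (pi\<^sup>2) / (4 * complex_of_real x) = of_real (pi\<^sup>2 / (4 * x))" by simp
  ultimately show ?thesis unfolding singular_part_def by (simp only: exp_of_real) simp
qed

lemma overpartition_gf_transformation_rat:
  fixes a b :: nat
  assumes ab: "a > 0" "b > 0"
  defines "t \<equiv> real a / real b"
  shows "overpartition_gf (exp (- t)) * theta2_series (exp (- (pi\<^sup>2 / t))) = sqrt (t / pi) / 2 * exp (pi\<^sup>2 / (4 * t))"
proof -
  have t: "t > 0" using ab by (simp add: t_def)
  define w where "w = exp (- (pi\<^sup>2 / t))"
  have w: "norm w < 1" using t by (simp add: w_def)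
  have "(\<lambda>j. exp (- (pi\<^sup>2 / (4 * t))) * w ^ (j * (j + 1))) sums (exp (- (pi\<^sup>2 / (4 * t))) * theta2_series w)"
    by (intro sums_mult theta2_series_sums w)
  also have "(\<lambda>j. exp (- (pi\<^sup>2 / (4 * t))) * w ^ (j * (j + 1))) = (\<lambda>j. exp (- (pi\<^sup>2 * (real j + 1 / 2)\<^sup>2 / t)))"
  proof
    fix j
    have "- (pi\<^sup>2 * (real j + 1 / 2)\<^sup>2 / t) = - (pi\<^sup>2 / (4 * t)) + real (j * (j + 1)) * (- (pi\<^sup>2 / t))"
      using t by (simp add: power2_eq_square field_simps)
    thus "exp (- (pi\<^sup>2 / (4 * t))) * w ^ (j * (j + 1)) = exp (- (pi\<^sup>2 * (real j + 1 / 2)\<^sup>2 / t))"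
      unfolding w_def exp_of_nat_mult[symmetric] by (simp only: exp_add)
  qed
  finally have th: "theta4 (exp (- t)) = 2 * sqrt (pi / t) * (exp (- (pi\<^sup>2 / (4 * t))) * theta2_series w)"
    using theta4_transformation_rat[OF ab] by (simp add: sums_iff t_def)
  have "overpartition_gf (exp (- t)) * theta4 (exp (- t)) = 1"
    using t by (intro overpartition_gf_theta4_real) auto
  thus ?thesis
    unfolding th w_def[symmetric] using t
    by (simp add: exp_minus real_sqrt_divide field_simps)
qed

lemma norm_exp_minus_inverse_less_1: "0 < Re t \<Longrightarrow> norm (exp (- (of_real (pi\<^sup>2) / t))) < 1"
proof -
  assume "0 < Re t"
  moreover from this have "t \<noteq> 0" by auto
  ultimately have "0 < Re (of_real (pi\<^sup>2) / t)"
    by (simp add: Re_divide add_pos_nonneg)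
  thus ?thesis by simp
qed

lemma holomorphic_singular_part: "singular_part holomorphic_on {t. 0 < Re t}"
proof -
  have "t / of_real pi \<notin> \<real>\<^sub>\<le>\<^sub>0" if "0 < Re t" for t
  proof -
    have "0 < Re (t / of_real pi)" using that by (simp add: Re_divide_of_real)
    thus ?thesis by (metis complex_nonpos_Reals_iff not_le)
  qed
  thus ?thesis unfolding singular_part_def by (intro holomorphic_intros) auto
qed

lemma holomorphic_overpartition_gf_exp: "(\<lambda>t. overpartition_gf (exp (- t))) holomorphic_on {t. 0 < Re t}"
proof -
  have "(overpartition_gf \<circ> (\<lambda>t. exp (- t))) holomorphic_on {t. 0 < Re t}"
    by (rule holomorphic_on_compose_gen[OF _ holomorphic_overpartition_gf])
      (auto intro!: holomorphic_intros)
  thus ?thesis by (simp add: o_def)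
qed

text \<open>Both sides are holomorphic in the right half plane and agree at the positive rationals,
  which accumulate at 1. In this product form the argument needs no nonvanishing of
  \<open>theta2_series\<close>.\<close>

lemma overpartition_gf_transformation:
  assumes t: "0 < Re t"
  shows "overpartition_gf (exp (- t)) * theta2_series (exp (- (of_real (pi\<^sup>2) / t))) = singular_part t"
proof -
  define S where "S = {t. 0 < Re t}"
  define F where "F t = overpartition_gf (exp (- t)) * theta2_series (exp (- (of_real (pi\<^sup>2) / t))) - singular_part t" for t
  define U where "U = {complex_of_real (real a / real b) | a b. a > 0 \<and> b > 0}"
  have "F t = 0"
  proof (rule analytic_continuation[where f = F and S = S and U = U and \<xi> = 1])
    have "(theta2_series \<circ> (\<lambda>t. exp (- (of_real (pi\<^sup>2) / t)))) holomorphic_on S"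
    proof (rule holomorphic_on_compose_gen[OF _ holomorphic_theta2_series])
      show "(\<lambda>t. exp (- (of_real (pi\<^sup>2) / t))) holomorphic_on S"
        by (intro holomorphic_intros) (auto simp: S_def)
      show "(\<lambda>t. exp (- (of_real (pi\<^sup>2) / t))) ` S \<subseteq> ball 0 1"
        using norm_exp_minus_inverse_less_1 by (auto simp: S_def)
    qed
    hence "(\<lambda>t. theta2_series (exp (- (of_real (pi\<^sup>2) / t)))) holomorphic_on S" by (simp add: o_def)
    thus "F holomorphic_on S"
      unfolding F_def S_def
      by (intro holomorphic_intros holomorphic_overpartition_gf_exp holomorphic_singular_part)
    show "open S" unfolding S_def by (rule open_halfspace_Re_gt)
    show "connected S" unfolding S_def by (rule convex_connected[OF convex_halfspace_Re_gt])
    show "U \<subseteq> S" by (auto simp: U_def S_def)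
    show "1 \<in> S" by (simp add: S_def)
    show "1 islimpt U"
      unfolding islimpt_approachable
    proof (intro allI impI)
      fix e :: real assume "e > 0"
      then obtain n where n: "inverse (real (Suc n)) < e" using reals_Archimedean by blast
      have "real (n + 2) / real (n + 1) - 1 = inverse (real (Suc n))"
        by (simp add: field_simps)
      hence "complex_of_real (real (n + 2) / real (n + 1)) - 1 = of_real (inverse (real (Suc n)))"
        by (metis of_real_1 of_real_diff)
      hence "dist (complex_of_real (real (n + 2) / real (n + 1))) 1 < e"
        using n by (simp only: dist_norm norm_of_real) simp
      moreover have "complex_of_real (real (n + 2) / real (n + 1)) \<noteq> 1"
        by (simp only: of_real_eq_1_iff) simp
      moreover have "complex_of_real (real (n + 2) / real (n + 1)) \<in> U"
        unfolding U_def by (intro CollectI exI[of _ "n + 2"] exI[of _ "n + 1"] conjI refl) auto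
      ultimately show "\<exists>x'\<in>U. x' \<noteq> 1 \<and> dist x' 1 < e" by blast
    qed
    show "t \<in> S" using t by (simp add: S_def)
    fix z assume "z \<in> U"
    then obtain a b :: nat where ab: "a > 0" "b > 0" "z = complex_of_real (real a / real b)" by (auto simp: U_def)
    define x where "x = real a / real b"
    have x: "x > 0" using ab by (simp add: x_def)
    have R: "overpartition_gf (exp (- x)) * theta2_series (exp (- (pi\<^sup>2 / x))) = sqrt (x / pi) / 2 * exp (pi\<^sup>2 / (4 * x))"
      unfolding x_def by (rule overpartition_gf_transformation_rat[OF ab(1,2)])
    have e1: "exp (- z) = complex_of_real (exp (- x))" "exp (- (of_real (pi\<^sup>2) / z)) = complex_of_real (exp (- (pi\<^sup>2 / x)))"
      unfolding ab(3) x_def[symmetric] by (simp_all flip: exp_of_real)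
    have sp: "singular_part z = of_real (sqrt (x / pi) / 2 * exp (pi\<^sup>2 / (4 * x)))"
      unfolding ab(3) x_def[symmetric] using x by (intro singular_part_of_real) simp
    show "F z = 0"
      unfolding F_def e1 sp R[symmetric] using x
      by (simp add: overpartition_gf_of_real theta2_series_of_real)
  qed
  thus ?thesis by (simp add: F_def)
qed

section \<open>Cauchy's formula\<close>

definition overpartition_integrand :: "nat \<Rightarrow> complex \<Rightarrow> complex" where
  "overpartition_integrand n t = overpartition_gf (exp (- t)) * exp (of_nat n * t)"

lemma has_integral_exp_vertical:
  fixes y :: real and m :: int
  shows "((\<lambda>x. exp (of_int m * Complex y x)) has_integral (if m = 0 then of_real (2 * pi) else 0)) {-pi..pi}"
proof (cases "m = 0")
  case True
  have "((\<lambda>x. 1::complex) has_integral (measure lborel {-pi..pi} *\<^sub>R 1)) {-pi..pi}"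
    by (rule has_integral_const_real)
  thus ?thesis using True by (simp add: scaleR_conv_of_real)
next
  case False
  define F where "F z = exp (of_int m * (of_real y + \<i> * z)) / (of_int m * \<i>)" for z :: complex
  have "((\<lambda>x. exp (of_int m * (of_real y + \<i> * of_real x))) has_integral
          (F (of_real pi) - F (of_real (-pi)))) {-pi..pi}"
  proof (rule fundamental_theorem_of_calculus)
    fix x assume "x \<in> {-pi..pi}"
    have "(F has_field_derivative exp (of_int m * (of_real y + \<i> * of_real x))) (at (of_real x))"
      unfolding F_def using False by (auto intro!: derivative_eq_intros simp: field_simps)
    thus "((\<lambda>x. F (of_real x)) has_vector_derivative exp (of_int m * (of_real y + \<i> * of_real x))) (at x within {-pi..pi})"
      by (rule has_vector_derivative_real_field)
  qed simp
  moreover have "F (of_real pi) = F (of_real (-pi))"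
  proof -
    have "of_int m * (of_real y + \<i> * of_real pi) =
        of_int m * (of_real y + \<i> * of_real (-pi)) + (2 * of_int m * of_real pi) * \<i>"
      by (simp add: algebra_simps)
    hence "exp (of_int m * (of_real y + \<i> * of_real pi)) = exp (of_int m * (of_real y + \<i> * of_real (-pi)))"
      using exp_integer_2pi[of "of_int m"] by (simp only: exp_add Ints_of_int) simp
    thus ?thesis by (simp add: F_def)
  qed
  moreover have "of_real y + \<i> * of_real x = Complex y x" for x by (simp add: complex_eq_iff)
  ultimately show ?thesis using False by simp
qed

text \<open>Under q = e^(-t) the segment is one turn of the circle of radius e^(-y). Uniform
  convergence permits termwise integration, and only the term \<open>k = n\<close> survives.\<close>

lemma overpartition_count_integral:
  assumes y: "y > 0"
  shows "((\<lambda>x. overpartition_integrand n (Complex y x)) has_integral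
           of_real (2 * pi) * of_nat (overpartition_count n)) {-pi..pi}"
proof -
  define f where "f k x = of_nat (overpartition_count k) * exp (of_int (int n - int k) * Complex y x)" for k x
  define M where "M k = real (overpartition_count k) * exp (- y) ^ k * exp (real n * y)" for k
  have eq: "f k x = of_nat (overpartition_count k) * exp (- Complex y x) ^ k * exp (of_nat n * Complex y x)" for k x
  proof -
    have "exp (of_int (int n - int k) * Complex y x) = exp (of_nat k * (- Complex y x) + of_nat n * Complex y x)"
      by (simp add: algebra_simps)
    thus ?thesis unfolding f_def by (simp only: exp_add exp_of_nat_mult mult.assoc)
  qed
  have sums: "(\<lambda>k. f k x) sums overpartition_integrand n (Complex y x)" for x
    unfolding eq overpartition_integrand_def using y
    by (intro sums_mult2 overpartition_gf_sums) simp
  have "uniform_limit {-pi..pi} (\<lambda>N x. \<Sum>k<N. f k x) (\<lambda>x. suminf (\<lambda>k. f k x)) sequentially"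
  proof (rule Weierstrass_m_test)
    show "norm (f k x) \<le> M k" for k x
      unfolding eq M_def norm_mult norm_power by simp
    show "summable M"
      unfolding M_def using y by (intro summable_mult2 summable_overpartition) auto
  qed
  hence ul: "uniform_limit {-pi..pi} (\<lambda>N x. \<Sum>k<N. f k x) (\<lambda>x. overpartition_integrand n (Complex y x)) sequentially"
    using sums by (simp add: sums_iff)
  have cont: "continuous_on {-pi..pi} (\<lambda>x. \<Sum>k<N. f k x)" for N
    unfolding f_def Complex_eq by (intro continuous_intros)
  obtain I J where I: "\<And>N. ((\<lambda>x. \<Sum>k<N. f k x) has_integral I N) {-pi..pi}"
    and J: "((\<lambda>x. overpartition_integrand n (Complex y x)) has_integral J) {-pi..pi}" and IJ: "I \<longlonglongrightarrow> J"
    using uniform_limit_integral[OF ul cont sequentially_bot] by metis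
  have "I N = of_real (2 * pi) * of_nat (overpartition_count n)" if "N > n" for N
  proof -
    have "((\<lambda>x. \<Sum>k<N. f k x) has_integral (\<Sum>k<N. of_nat (overpartition_count k) *
        (if int n - int k = 0 then of_real (2 * pi) else 0))) {-pi..pi}"
      unfolding f_def by (intro has_integral_sum has_integral_mult_right has_integral_exp_vertical) auto
    also have "(\<Sum>k<N. of_nat (overpartition_count k) * (if int n - int k = 0 then of_real (2 * pi) else 0))
      = (\<Sum>k<N. if k = n then of_real (2 * pi) * of_nat (overpartition_count n) else (0::complex))"
      by (intro sum.cong) auto
    also have "\<dots> = of_real (2 * pi) * of_nat (overpartition_count n)" using that by simp
    finally show ?thesis using I has_integral_unique by blast
  qed
  hence "eventually (\<lambda>N. I N = of_real (2 * pi) * of_nat (overpartition_count n)) sequentially"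
    by (intro eventually_sequentiallyI[of "Suc n"]) auto
  hence "J = of_real (2 * pi) * of_nat (overpartition_count n)"
    using IJ by (metis LIMSEQ_unique tendsto_eventually)
  thus ?thesis using J by simp
qed

lemma holomorphic_overpartition_integrand:
  "overpartition_integrand n holomorphic_on {t. 0 < Re t}"
  unfolding overpartition_integrand_def
  by (intro holomorphic_intros holomorphic_overpartition_gf_exp)

text \<open>Cauchy's theorem in the convex half plane. A common factor i cancels: dt is i dx on the
  chord and i t du on the arc, which explains the extra factor \<rho> cis u.\<close>

lemma chord_integral_eq_arc_integral:
  fixes f :: "complex \<Rightarrow> complex"
  assumes f: "f holomorphic_on {t. 0 < Re t}" and rho: "\<rho> > 0" and th: "0 < \<theta>" "\<theta> < pi / 2"
  shows "((\<lambda>x. f (Complex (\<rho> * cos \<theta>) x)) has_integral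
            integral {-\<theta>..\<theta>} (\<lambda>u. f (\<rho> * cis u) * (\<rho> * cis u))) {-\<rho> * sin \<theta>..\<rho> * sin \<theta>}"
proof -
  define S where "S = {t. 0 < Re t}"
  define A where "A = \<rho> * cis (-\<theta>)"
  define B where "B = \<rho> * cis \<theta>"
  have cos: "cos u > 0" if "u \<in> {-\<theta>..\<theta>}" for u
    using that th by (intro cos_gt_zero_pi) auto
  have AB: "Re A = \<rho> * cos \<theta>" "Re B = \<rho> * cos \<theta>" "Im A = - \<rho> * sin \<theta>" "Im B = \<rho> * sin \<theta>"
    by (simp_all add: A_def B_def)
  have sin: "sin \<theta> > 0" using th by (intro sin_gt_zero) auto
  have convS: "convex S" unfolding S_def by (rule convex_halfspace_Re_gt)
  have ABS: "A \<in> S" "B \<in> S" using AB cos[of \<theta>] th rho by (auto simp: S_def)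
  have lp: "path_image (linepath A B) \<subseteq> S"
    using closed_segment_subset[OF ABS convS] by simp
  define arc where "arc = part_circlepath 0 \<rho> (-\<theta>) \<theta>"
  have ap: "path_image arc \<subseteq> S"
    using cos rho th unfolding arc_def
    by (auto simp: path_image_part_circlepath' closed_segment_eq_real_ivl S_def)
  have va: "valid_path arc" by (simp add: arc_def)
  have ends: "pathstart arc = A" "pathfinish arc = B"
    by (auto simp: arc_def A_def B_def cis_conv_exp mult.commute)
  have openS: "open S" unfolding S_def by (rule open_halfspace_Re_gt)
  note fS = f[folded S_def]
  have f1: "f contour_integrable_on linepath A B"
    by (rule contour_integrable_holomorphic_simple[OF fS openS valid_path_linepath lp])
  have f2: "f contour_integrable_on arc"
    by (rule contour_integrable_holomorphic_simple[OF fS openS va ap])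
  have "(f has_contour_integral 0) (linepath A B +++ reversepath arc)"
  proof (rule Cauchy_theorem_convex_simple[OF fS convS])
    show "valid_path (linepath A B +++ reversepath arc)"
      using va ends by (intro valid_path_join) auto
    show "path_image (linepath A B +++ reversepath arc) \<subseteq> S"
      using lp ap ends by (subst path_image_join) auto
  qed (use ends in auto)
  moreover have "(f has_contour_integral (contour_integral (linepath A B) f + - contour_integral arc f))
      (linepath A B +++ reversepath arc)"
    using f1 f2 va by (intro has_contour_integral_join has_contour_integral_reversepath has_contour_integral_integral) auto
  ultimately have "contour_integral (linepath A B) f = contour_integral arc f"
    using has_contour_integral_unique by force
  also have "\<dots> = contour_integral (part_circlepath 0 \<rho> (-\<theta>) \<theta>) f" by (simp only: arc_def)
  also have "\<dots> = integral {-\<theta>..\<theta>} (\<lambda>u. f (0 + \<rho> * cis u) * \<rho> * \<i> * cis u)"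
    using th by (intro contour_integral_part_circlepath_eq) auto
  also have "\<dots> = integral {-\<theta>..\<theta>} (\<lambda>u. \<i> * (f (\<rho> * cis u) * (\<rho> * cis u)))"
    by (simp add: mult_ac)
  also have "\<dots> = \<i> * integral {-\<theta>..\<theta>} (\<lambda>u. f (\<rho> * cis u) * (\<rho> * cis u))"
    by (rule integral_mult_right)
  finally have "(f has_contour_integral (\<i> * integral {-\<theta>..\<theta>} (\<lambda>u. f (\<rho> * cis u) * (\<rho> * cis u)))) (linepath A B)"
    using f1 has_contour_integral_integral by metis
  thus ?thesis
    using sin rho AB
    by (subst (asm) has_contour_integral_linepath_same_Re_iff[where c = "\<rho> * cos \<theta>" and a = "-\<rho> * sin \<theta>" and b = "\<rho> * sin \<theta>"]) auto
qed

text \<open>The chord is exchanged for the arc; the two remaining pieces of the line have total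
  length at most 2 pi.\<close>

lemma overpartition_count_arc_estimate:
  fixes \<rho> \<theta> C :: real
  assumes rho: "\<rho> > 0" and th: "0 < \<theta>" "\<theta> < pi / 2" and le_pi: "\<rho> * sin \<theta> \<le> pi"
    and C: "\<And>x. \<rho> * sin \<theta> \<le> \<bar>x\<bar> \<Longrightarrow> \<bar>x\<bar> \<le> pi \<Longrightarrow> norm (overpartition_integrand n (Complex (\<rho> * cos \<theta>) x)) \<le> C"
  shows "norm (of_real (2 * pi) * of_nat (overpartition_count n) -
     integral {-\<theta>..\<theta>} (\<lambda>u. overpartition_integrand n (\<rho> * cis u) * (\<rho> * cis u))) \<le> 2 * pi * C"
proof -
  define g where "g x = overpartition_integrand n (Complex (\<rho> * cos \<theta>) x)" for x
  define s where "s = \<rho> * sin \<theta>"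
  have c: "cos \<theta> > 0" using th by (intro cos_gt_zero_pi) auto
  have sin: "sin \<theta> > 0" using th by (intro sin_gt_zero) auto
  have s: "0 < s" "s \<le> pi" using le_pi rho sin by (auto simp: s_def)
  have C0: "0 \<le> C"
    using C[of pi] le_pi by (auto intro: order_trans[OF norm_ge_zero])
  have tot: "(g has_integral of_real (2 * pi) * of_nat (overpartition_count n)) {-pi..pi}"
    unfolding g_def using rho c by (intro overpartition_count_integral) auto
  have int: "g integrable_on {a..b}" if "-pi \<le> a" "b \<le> pi" for a b
    using tot that by (meson atLeastatMost_subset_iff has_integral_integrable integrable_on_subinterval)
  have mid: "(g has_integral integral {-\<theta>..\<theta>} (\<lambda>u. overpartition_integrand n (\<rho> * cis u) * (\<rho> * cis u))) {-s..s}"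
    using chord_integral_eq_arc_integral[OF holomorphic_overpartition_integrand rho th, of n]
    unfolding g_def s_def by simp
  have "integral {-pi..pi} g = integral {-pi..s} g + integral {s..pi} g"
    using s by (intro Henstock_Kurzweil_Integration.integral_combine[symmetric] int) auto
  also have "integral {-pi..s} g = integral {-pi..-s} g + integral {-s..s} g"
    using s by (intro Henstock_Kurzweil_Integration.integral_combine[symmetric] int) auto
  finally have "of_real (2 * pi) * of_nat (overpartition_count n) -
     integral {-\<theta>..\<theta>} (\<lambda>u. overpartition_integrand n (\<rho> * cis u) * (\<rho> * cis u)) = integral {-pi..-s} g + integral {s..pi} g"
    using tot mid by (simp add: integral_unique)
  also have "norm \<dots> \<le> norm (integral {-pi..-s} g) + norm (integral {s..pi} g)"
    by (rule norm_triangle_ineq)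
  also have "norm (integral {-pi..-s} g) \<le> C * (-s - -pi)"
    using has_integral_bound_real[of C "{}" g _ "-pi" "-s"] s C C0 integrable_integral[OF int[of "-pi" "-s"]]
    by (auto simp: g_def s_def)
  also have "norm (integral {s..pi} g) \<le> C * (pi - s)"
    using has_integral_bound_real[of C "{}" g _ s pi] s C C0 integrable_integral[OF int[of s pi]]
    by (auto simp: g_def s_def)
  also have "C * (-s - -pi) + C * (pi - s) \<le> 2 * pi * C"
    using s C0 by (simp add: algebra_simps)
  finally show ?thesis by simp
qed

section \<open>Minor arcs\<close>

text \<open>The right-hand side is coth (y / 2); it turns the saving on the minor arcs into a
  multiple of 1 / y, comparable with pi^2 / (4 y).\<close>

lemma coth_half_ge:
  assumes y: "0 < (y::real)"
  shows "2 / y \<le> (1 + exp (- y)) / (1 - exp (- y))"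
proof -
  define f where "f z = z * (1 + exp (- z)) - 2 * (1 - exp (- z))" for z :: real
  have "f 0 \<le> f y"
  proof (rule DERIV_nonneg_imp_nondecreasing[where f = f])
    fix z :: real assume z: "0 \<le> z" "z \<le> y"
    have "(f has_real_derivative (1 - (1 + z) * exp (- z))) (at z)"
      unfolding f_def by (auto intro!: derivative_eq_intros simp: algebra_simps)
    moreover have "(1 + z) * exp (- z) \<le> exp z * exp (- z)"
      by (intro mult_right_mono exp_ge_add_one_self) auto
    hence "0 \<le> 1 - (1 + z) * exp (- z)" by (simp flip: exp_add)
    ultimately show "\<exists>D. (f has_real_derivative D) (at z) \<and> 0 \<le> D" by blast
  qed (use y in auto)
  thus ?thesis using y by (simp add: f_def divide_simps mult.commute)
qed

text \<open>The denominator is |1 - q|^2. This form separates coth (y / 2), for r = e^(-y), from the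
  ratio (1 - r)^2 / |1 - q|^2, which is 1 on the positive axis and small away from it.\<close>

lemma Re_div_one_minus:
  fixes q :: complex
  assumes "norm q < 1"
  defines "r \<equiv> norm q"
  shows "2 * Re (q / (1 - q)) - 2 * (r / (1 - r)) = - ((1 + r) / (1 - r)) * (1 - (1 - r)\<^sup>2 / (1 - 2 * Re q + r\<^sup>2))"
proof -
  define a where "a = Re q"
  define b where "b = Im q"
  have r2: "r\<^sup>2 = a\<^sup>2 + b\<^sup>2" by (simp add: r_def a_def b_def cmod_power2)
  have r: "r < 1" using assms by simp
  have "a \<le> r" unfolding a_def r_def by (rule complex_Re_le_cmod)
  have "0 < (1 - r)\<^sup>2" using r by simp
  also have "(1 - r)\<^sup>2 \<le> 1 - 2 * a + r\<^sup>2" using \<open>a \<le> r\<close> by (simp add: power2_eq_square algebra_simps)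
  finally have D: "0 < 1 - 2 * a + r\<^sup>2" .
  have "Re (q / (1 - q)) = (a * (1 - a) - b\<^sup>2) / ((1 - a)\<^sup>2 + b\<^sup>2)"
    by (simp add: Re_divide a_def b_def power2_eq_square)
  also have "(1 - a)\<^sup>2 + b\<^sup>2 = 1 - 2 * a + r\<^sup>2" unfolding r2 by (simp add: power2_eq_square algebra_simps)
  also have "a * (1 - a) - b\<^sup>2 = a - r\<^sup>2" unfolding r2 by (simp add: power2_eq_square algebra_simps)
  finally have R: "Re (q / (1 - q)) = (a - r\<^sup>2) / (1 - 2 * a + r\<^sup>2)" .
  define d where "d = 1 - 2 * a + r\<^sup>2"
  have a: "2 * a = 1 + r\<^sup>2 - d" by (simp add: d_def)
  have "2 * ((a - r\<^sup>2) / d) - 2 * (r / (1 - r)) = (2 * a - 2 * r\<^sup>2) / d - 2 * r / (1 - r)"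
    by (simp add: diff_divide_distrib)
  also have "\<dots> = - ((1 + r) / (1 - r)) * (1 - (1 - r)\<^sup>2 / d)"
    unfolding a using r D unfolding d_def[symmetric]
    by (simp add: divide_simps) (simp add: power2_eq_square algebra_simps)
  finally show ?thesis unfolding R a_def[symmetric] d_def[symmetric] .
qed

text \<open>On the positive axis \<open>theta2_series\<close> is at least its first term 1, so
  dropping it from the transformation formula gives an upper bound.\<close>

lemma overpartition_gf_real_le:
  assumes y: "0 < y"
  shows "overpartition_gf (exp (- y)) \<le> sqrt (y / pi) / 2 * exp (pi\<^sup>2 / (4 * y))"
proof -
  define w where "w = exp (- (pi\<^sup>2 / y))"
  have w: "0 < w" "w < 1" using y by (auto simp: w_def)
  have "overpartition_gf (exp (- complex_of_real y)) * theta2_series (exp (- (of_real (pi\<^sup>2) / complex_of_real y))) = singular_part (of_real y)"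
    using y by (intro overpartition_gf_transformation) auto
  moreover have "exp (- complex_of_real y) = of_real (exp (- y))" by (simp flip: exp_of_real)
  moreover have "exp (- (of_real (pi\<^sup>2) / complex_of_real y)) = of_real w"
    unfolding w_def by (simp flip: exp_of_real)
  moreover have "singular_part (of_real y) = of_real (sqrt (y / pi) / 2 * exp (pi\<^sup>2 / (4 * y)))"
    using y by (intro singular_part_of_real) simp
  ultimately have "complex_of_real (overpartition_gf (exp (- y)) * theta2_series w) = of_real (sqrt (y / pi) / 2 * exp (pi\<^sup>2 / (4 * y)))"
    using y w by (simp only: overpartition_gf_of_real theta2_series_of_real abs_exp_cancel exp_less_one_iff neg_less_0_iff_less abs_of_pos of_real_mult)
  hence eq: "overpartition_gf (exp (- y)) * theta2_series w = sqrt (y / pi) / 2 * exp (pi\<^sup>2 / (4 * y))"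
    by (simp only: of_real_eq_iff)
  have "1 \<le> theta2_series w"
  proof -
    have "(\<Sum>m<1. w ^ (m * (m + 1))) \<le> (\<Sum>m. w ^ (m * (m + 1)))"
      using w theta2_series_sums[of w] by (intro sum_le_suminf) (auto simp: sums_iff)
    thus ?thesis by (simp add: theta2_series_def)
  qed
  moreover have "0 \<le> overpartition_gf (exp (- y))"
    unfolding overpartition_gf_def using overpartition_gf_sums[of "exp (- y)"] y
    by (intro suminf_nonneg) (auto simp: sums_iff)
  ultimately have "overpartition_gf (exp (- y)) * 1 \<le> overpartition_gf (exp (- y)) * theta2_series w"
    by (intro mult_left_mono)
  thus ?thesis using eq by simp
qed

text \<open>24 / 7 is the tangent of the angle arccos (7 / 25) at which the arc ends, so the
  hypothesis describes the line outside the chord. There |1 - q|^2 is at least about (1 + (24 /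
  7)^2) y^2, roughly 12.75 y^2; only the factor 12 is used. This leaves 11 / 12 of the coth term,
  hence 11 / (6 y). The bound on \<open>y\<close> is what X \<ge> 34 will provide.\<close>

lemma overpartition_gf_minor_arc:
  assumes y: "0 < y" "y \<le> 41 / 1000" and x: "24 / 7 * y \<le> \<bar>x\<bar>" "\<bar>x\<bar> \<le> pi"
  shows "norm (overpartition_gf (exp (- Complex y x))) \<le> sqrt (y / pi) / 2 * exp (pi\<^sup>2 / (4 * y) - 11 / (6 * y))"
proof -
  define q where "q = exp (- Complex y x)"
  define r where "r = norm q"
  define x0 where "x0 = 24 / 7 * y"
  have r: "r = exp (- y)" by (simp add: r_def q_def)
  have r1: "0 < r" "r < 1" using y by (auto simp: r)
  have req: "Re q = r * cos x" by (simp add: q_def r Re_exp)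
  have ry: "1 - r \<le> y" using exp_ge_add_one_self[of "-y"] by (simp add: r)
  have x0: "0 < x0" "x0 \<le> 141 / 1000" "x0 < pi / 2" using y pi_gt3 by (auto simp: x0_def)
  have "cos x = cos \<bar>x\<bar>" by simp
  also have "\<dots> \<le> cos x0" using x x0 by (intro cos_monotone_0_pi_le) (auto simp: x0_def)
  also have "\<dots> \<le> exp (- x0\<^sup>2 / 2)" using x0 by (intro cos_le_exp) auto
  also have "\<dots> = inverse (exp (x0\<^sup>2 / 2))" by (simp flip: exp_minus)
  also have "\<dots> \<le> inverse (1 + x0\<^sup>2 / 2)"
    using x0 by (intro le_imp_inverse_le exp_ge_add_one_self) (simp add: add_pos_nonneg)
  finally have cosx: "cos x \<le> inverse (1 + x0\<^sup>2 / 2)" .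
  have x0sq: "x0\<^sup>2 / 2 \<le> 1 / 100"
  proof -
    have "x0\<^sup>2 \<le> (141 / 1000)\<^sup>2" using x0 by (intro power_mono) auto
    thus ?thesis by (simp add: power2_eq_square)
  qed
  have "100 / 101 * (x0\<^sup>2 / 2) \<le> (x0\<^sup>2 / 2) / (1 + x0\<^sup>2 / 2)"
  proof -
    have "z * 100 / 101 \<le> z / (1 + z)" if "0 \<le> z" "z \<le> 1 / 100" for z :: real
    proof -
      have "z * (1 + z) * 100 \<le> z * (101 / 100) * 100" using that by (intro mult_mono mult_left_mono) auto
      thus ?thesis using that by (simp add: field_simps)
    qed
    from this[of "x0\<^sup>2 / 2"] show ?thesis using x0sq by simp
  qed
  also have "\<dots> = 1 - inverse (1 + x0\<^sup>2 / 2)"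
  proof -
    have "z / (1 + z) = 1 - inverse (1 + z)" if "0 \<le> z" for z :: real
      using that by (simp add: field_simps)
    from this[OF divide_nonneg_nonneg[OF zero_le_power2 zero_le_numeral]] show ?thesis .
  qed
  also have "\<dots> \<le> 1 - cos x" using cosx by simp
  finally have c: "100 / 101 * (x0\<^sup>2 / 2) \<le> 1 - cos x" .
  \<comment> \<open>959 / 1000 is the lower bound 1 - y for \<open>r\<close>; the slack between 11
    and (24 / 7)^2, about 11.75, absorbs it together with 100 / 101.\<close>
  have "11 * (1 - r)\<^sup>2 \<le> 11 * y\<^sup>2" using ry r1 by (intro mult_left_mono power_mono) auto
  also have "\<dots> \<le> 2 * (959 / 1000) * (100 / 101 * (x0\<^sup>2 / 2))"
    by (simp add: x0_def power2_eq_square)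
  also have "\<dots> \<le> 2 * r * (1 - cos x)"
    using c ry y r1 by (intro mult_mono) auto
  finally have main: "11 * (1 - r)\<^sup>2 \<le> 2 * r * (1 - cos x)" .
  have D: "12 * (1 - r)\<^sup>2 \<le> 1 - 2 * Re q + r\<^sup>2"
    using main unfolding req by (simp add: power2_eq_square algebra_simps)
  have Dpos: "0 < 1 - 2 * Re q + r\<^sup>2" using D r1 by (smt (verit) zero_less_power)
  have ratio: "(1 - r)\<^sup>2 / (1 - 2 * Re q + r\<^sup>2) \<le> 1 / 12"
    using D Dpos by (simp add: field_simps)
  have "2 * Re (q / (1 - q)) - 2 * (r / (1 - r)) = - ((1 + r) / (1 - r) * (1 - (1 - r)\<^sup>2 / (1 - 2 * Re q + r\<^sup>2)))"
    using Re_div_one_minus[of q] r1 unfolding r_def by simp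
  also have "\<dots> \<le> - (2 / y * (11 / 12))"
    unfolding neg_le_iff_le using coth_half_ge[OF y(1)] ratio y r1
    by (intro mult_mono) (auto simp: r)
  finally have e: "2 * Re (q / (1 - q)) - 2 * (r / (1 - r)) \<le> - (11 / (6 * y))" by simp
  have "norm (overpartition_gf q) \<le> overpartition_gf r * exp (2 * Re (q / (1 - q)) - 2 * (r / (1 - r)))"
    using norm_overpartition_gf_le[of q] r1 by (simp add: r_def)
  also have "\<dots> \<le> (sqrt (y / pi) / 2 * exp (pi\<^sup>2 / (4 * y))) * exp (- (11 / (6 * y)))"
    using overpartition_gf_real_le[OF y(1)] e y by (intro mult_mono) (auto simp: r)
  also have "\<dots> = sqrt (y / pi) / 2 * exp (pi\<^sup>2 / (4 * y) - 11 / (6 * y))"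
    by (simp add: exp_diff exp_minus field_simps)
  finally show ?thesis by (simp add: q_def)
qed

section \<open>The major arc\<close>

text \<open>The tail beyond \<open>K\<close> is at most the integral of (x / K) exp (- x^2), which
  is elementary; letting the upper limit tend to infinity brings in sqrt pi / 2.\<close>

lemma gaussian_integral_bounds:
  fixes K :: real
  assumes K: "0 < K"
  shows "integral {0..K} (\<lambda>x. exp (- x\<^sup>2)) \<le> sqrt pi / 2"
    and "sqrt pi / 2 \<le> integral {0..K} (\<lambda>x. exp (- x\<^sup>2)) + exp (- K\<^sup>2) / (2 * K)"
proof -
  define \<Phi> where "\<Phi> z = integral {0..z} (\<lambda>x::real. exp (- x\<^sup>2))" for z
  have cont: "continuous_on S (\<lambda>x::real. exp (- x\<^sup>2))" for S by (intro continuous_intros)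
  have int: "(\<lambda>x::real. exp (- x\<^sup>2)) integrable_on {a..b}" for a b
    by (intro integrable_continuous_interval cont)
  have gi: "integrable lborel (\<lambda>x::real. indicator {0..} x *\<^sub>R exp (- x\<^sup>2))"
    and gv: "(LINT x|lborel. indicator {0..} x *\<^sub>R exp (- x\<^sup>2)) = sqrt pi / 2"
    using gaussian_moment_0 by (auto simp: has_bochner_integral_iff)
  have "((\<lambda>z. LINT x|lborel. indicator {..z} x *\<^sub>R (indicator {0..} x *\<^sub>R exp (- x\<^sup>2))) \<longlongrightarrow> sqrt pi / 2) at_top"
    unfolding gv[symmetric] by (rule tendsto_integral_at_top[OF sets_lborel gi])
  moreover have "(LINT x|lborel. indicator {..z} x *\<^sub>R (indicator {0..} x *\<^sub>R exp (- x\<^sup>2))) = \<Phi> z" for z :: real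
  proof -
    have "(LINT x|lborel. indicator {..z} x *\<^sub>R (indicator {0..} x *\<^sub>R exp (- x\<^sup>2))) = (LINT x:{0..z}|lborel. exp (- x\<^sup>2))"
      unfolding set_lebesgue_integral_def by (intro Bochner_Integration.integral_cong) (auto simp: indicator_def)
    also have "\<dots> = \<Phi> z"
      unfolding \<Phi>_def by (intro set_borel_integral_eq_integral borel_integrable_atLeastAtMost') (rule cont)
    finally show ?thesis .
  qed
  ultimately have lim: "(\<Phi> \<longlongrightarrow> sqrt pi / 2) at_top" by simp
  have step: "\<Phi> K \<le> \<Phi> z \<and> \<Phi> z \<le> \<Phi> K + exp (- K\<^sup>2) / (2 * K)" if z: "K \<le> z" for z
  proof -
    have split: "\<Phi> z = \<Phi> K + integral {K..z} (\<lambda>x. exp (- x\<^sup>2))"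
      unfolding \<Phi>_def using z K by (intro Henstock_Kurzweil_Integration.integral_combine[symmetric] int) auto
    have "((\<lambda>x. x * exp (- x\<^sup>2)) has_integral (- exp (- z\<^sup>2) / 2 - - exp (- K\<^sup>2) / 2)) {K..z}"
    proof (rule fundamental_theorem_of_calculus[OF z])
      fix x
      show "((\<lambda>x. - exp (- x\<^sup>2) / 2) has_vector_derivative x * exp (- x\<^sup>2)) (at x within {K..z})"
        unfolding has_real_derivative_iff_has_vector_derivative[symmetric]
        by (auto intro!: derivative_eq_intros)
    qed
    hence B: "((\<lambda>x. (1 / K) * (x * exp (- x\<^sup>2))) has_integral ((1 / K) * (- exp (- z\<^sup>2) / 2 - - exp (- K\<^sup>2) / 2))) {K..z}"
      by (rule has_integral_mult_right)
    have "integral {K..z} (\<lambda>x. exp (- x\<^sup>2)) \<le> (1 / K) * (- exp (- z\<^sup>2) / 2 - - exp (- K\<^sup>2) / 2)"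
    proof (rule has_integral_le[OF integrable_integral[OF int] B])
      fix x assume "x \<in> {K..z}"
      hence "1 \<le> x / K" using K by simp
      hence "1 * exp (- x\<^sup>2) \<le> x / K * exp (- x\<^sup>2)" by (intro mult_right_mono) auto
      thus "exp (- x\<^sup>2) \<le> 1 / K * (x * exp (- x\<^sup>2))" by simp
    qed
    also have "\<dots> \<le> exp (- K\<^sup>2) / (2 * K)" using K by (simp add: field_simps)
    finally have "integral {K..z} (\<lambda>x. exp (- x\<^sup>2)) \<le> exp (- K\<^sup>2) / (2 * K)" .
    moreover have "0 \<le> integral {K..z} (\<lambda>x. exp (- x\<^sup>2))"
      by (intro Henstock_Kurzweil_Integration.integral_nonneg int) auto
    ultimately show ?thesis using split by simp
  qed
  have ev: "eventually (\<lambda>z. K \<le> z) at_top" by (rule eventually_ge_at_top)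
  show "integral {0..K} (\<lambda>x. exp (- x\<^sup>2)) \<le> sqrt pi / 2"
    unfolding \<Phi>_def[symmetric]
    by (rule tendsto_lowerbound[OF lim eventually_mono[OF ev]]) (use step in auto)
  show "sqrt pi / 2 \<le> integral {0..K} (\<lambda>x. exp (- x\<^sup>2)) + exp (- K\<^sup>2) / (2 * K)"
    unfolding \<Phi>_def[symmetric]
    by (rule tendsto_upperbound[OF lim eventually_mono[OF ev]]) (use step in auto)
qed

lemma cos_three_halves: "cos (3 / 2 * u) = (1 - 4 * (sin (u / 2))\<^sup>2) * cos (u / 2 :: real)"
proof -
  have "cos (3 / 2 * u) = cos (3 * (u / 2))" by simp
  also have "\<dots> = 4 * cos (u / 2) ^ 3 - 3 * cos (u / 2)" by (rule cos_treble_cos)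
  also have "\<dots> = (4 * (cos (u / 2))\<^sup>2 - 3) * cos (u / 2)" by (simp add: power2_eq_square power3_eq_cube algebra_simps)
  also have "(cos (u / 2))\<^sup>2 = 1 - (sin (u / 2))\<^sup>2" by (simp add: cos_squared_eq)
  finally show ?thesis by simp
qed

text \<open>
  With \<open>v = sin (u / 2)\<close> we have \<open>cos u = 1 - 2 v\<^sup>2\<close> and \<open>cos (3 u / 2) du = 2 (1 - 4 v\<^sup>2) dv\<close>,
  so the integral over the arc is a truncated Gaussian integral.
\<close>

lemma arc_integral_real:
  fixes X \<theta> s :: real
  assumes X: "0 < X" and th: "0 < \<theta>" "\<theta> < pi"
  defines "K \<equiv> sqrt (2 * X) * sin (\<theta> / 2)"
  shows "((\<lambda>u. exp (X * cos u) * cos (3 / 2 * u)) has_integral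
     2 * exp X * ((1 - 1 / X) * (2 * integral {0..K} (\<lambda>x. exp (- x\<^sup>2)) / sqrt (2 * X)) + 2 * sin (\<theta> / 2) / X * exp (- K\<^sup>2))) {-\<theta>..\<theta>}"
proof -
  define b where "b = sqrt (2 * X)"
  have b: "b > 0" "b\<^sup>2 = 2 * X" using X by (auto simp: b_def)
  have K: "K = b * sin (\<theta> / 2)" by (simp add: K_def b_def)
  have cont: "continuous_on S (\<lambda>x::real. exp (- x\<^sup>2))" for S by (intro continuous_intros)
  have int: "(\<lambda>x::real. exp (- x\<^sup>2)) integrable_on {a..b}" for a b
    by (intro integrable_continuous_interval cont)
  have sinb: "\<bar>sin (u / 2)\<bar> \<le> sin (\<theta> / 2)" if "u \<in> {-\<theta>..\<theta>}" for u
  proof -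
    have "sin (- (\<theta> / 2)) \<le> sin (u / 2)" "sin (u / 2) \<le> sin (\<theta> / 2)"
      using that th by (intro sin_monotone_2pi_le; auto)+
    thus ?thesis by auto
  qed
  have K0: "0 < K" using th b by (auto simp: K intro!: mult_pos_pos sin_gt_zero)
  define F where "F z = integral {-K..z} (\<lambda>x. exp (- x\<^sup>2))" for z
  have F: "(F has_real_derivative exp (- z\<^sup>2)) (at z within {-K..K})" if "z \<in> {-K..K}" for z
    unfolding F_def has_real_derivative_iff_has_vector_derivative
    by (rule integral_has_vector_derivative[OF cont that])
  \<comment> \<open>In terms of v the integrand is (1 - 4 v^2) exp (X - 2 X v^2) up to a factor 2.
    Integrating v^2 times the Gaussian by parts yields a boundary term and subtracts 1 / X of the
    Gaussian integral; this is the origin of the factor 1 - 1 / X.\<close>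
  define H where "H u = 2 * exp X * ((1 - 1 / X) * (F (b * sin (u / 2)) / b) + 1 / X * (sin (u / 2) * exp (- (b * sin (u / 2))\<^sup>2)))" for u
  have "((\<lambda>u. exp (X * cos u) * cos (3 / 2 * u)) has_integral (H \<theta> - H (-\<theta>))) {-\<theta>..\<theta>}"
  proof (rule fundamental_theorem_of_calculus)
    fix u assume u: "u \<in> {-\<theta>..\<theta>}"
    define v where "v = sin (u / 2)"
    define c where "c = cos (u / 2)"
    have in_K: "b * sin (u / 2) \<in> {-K..K}" if "u \<in> {-\<theta>..\<theta>}" for u
    proof -
      have "\<bar>b * sin (u / 2)\<bar> \<le> b * sin (\<theta> / 2)"
        using sinb[OF that] b by (simp add: abs_mult)
      thus ?thesis by (auto simp: K)
    qed
    have dv: "((\<lambda>u. b * sin (u / 2)) has_real_derivative b * (c / 2)) (at u within {-\<theta>..\<theta>})"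
      unfolding c_def by (auto intro!: derivative_eq_intros)
    have "(F has_real_derivative exp (- (b * sin (u / 2))\<^sup>2)) (at (b * sin (u / 2)) within (\<lambda>u. b * sin (u / 2)) ` {-\<theta>..\<theta>})"
      using F[OF in_K[OF u]] by (rule DERIV_subset) (use in_K in auto)
    from DERIV_image_chain[OF this dv]
    have dF: "((\<lambda>u. F (b * sin (u / 2))) has_real_derivative exp (- (b * v)\<^sup>2) * (b * (c / 2))) (at u within {-\<theta>..\<theta>})"
      by (simp add: o_def v_def)
    have dG: "((\<lambda>u. sin (u / 2) * exp (- (b * sin (u / 2))\<^sup>2)) has_real_derivative
        (c / 2 * exp (- (b * v)\<^sup>2) + v * (exp (- (b * v)\<^sup>2) * (- (2 * (b * v) * (b * (c / 2))))))) (at u within {-\<theta>..\<theta>})"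
      unfolding c_def v_def by (auto intro!: derivative_eq_intros simp: power2_eq_square)
    have "(H has_real_derivative 2 * exp X * ((1 - 1 / X) * (exp (- (b * v)\<^sup>2) * (b * (c / 2)) / b)
        + 1 / X * (c / 2 * exp (- (b * v)\<^sup>2) + v * (exp (- (b * v)\<^sup>2) * (- (2 * (b * v) * (b * (c / 2)))))))) (at u within {-\<theta>..\<theta>})"
      unfolding H_def by (intro DERIV_cmult DERIV_add DERIV_cdivide dF dG)
    also have "2 * exp X * ((1 - 1 / X) * (exp (- (b * v)\<^sup>2) * (b * (c / 2)) / b)
        + 1 / X * (c / 2 * exp (- (b * v)\<^sup>2) + v * (exp (- (b * v)\<^sup>2) * (- (2 * (b * v) * (b * (c / 2)))))))
       = exp X * exp (- (b * v)\<^sup>2) * ((1 - 4 * v\<^sup>2) * c)"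
    proof -
      define E where "E = exp (- (b * v)\<^sup>2)"
      have "v * (E * (- (2 * (b * v) * (b * (c / 2))))) = - (b\<^sup>2 * v\<^sup>2 * c * E)"
        by (simp add: power2_eq_square)
      hence 1: "v * (E * (- (2 * (b * v) * (b * (c / 2))))) = - (2 * X * v\<^sup>2 * c * E)" by (simp add: b)
      have 2: "E * (b * (c / 2)) / b = E * c / 2" using b by simp
      show ?thesis unfolding E_def[symmetric] 1 2 using X
        by (simp add: field_simps)
    qed
    also have "exp X * exp (- (b * v)\<^sup>2) = exp (X * cos u)"
    proof -
      have c: "cos u = 1 - 2 * v\<^sup>2" using cos_double_sin[of "u / 2"] by (simp add: v_def)
      have "X * cos u = X + - (b * v)\<^sup>2"
        unfolding c power_mult_distrib b by (simp add: algebra_simps)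
      thus ?thesis by (simp only: exp_add)
    qed
    also have "(1 - 4 * v\<^sup>2) * c = cos (3 / 2 * u)" by (simp only: cos_three_halves v_def c_def)
    finally show "(H has_vector_derivative exp (X * cos u) * cos (3 / 2 * u)) (at u within {-\<theta>..\<theta>})"
      by (simp only: has_real_derivative_iff_has_vector_derivative)
  qed (use th in auto)
  moreover have "H \<theta> - H (-\<theta>) = 2 * exp X * ((1 - 1 / X) * ((F K - F (-K)) / b) + 2 * sin (\<theta> / 2) / X * exp (- K\<^sup>2))"
    unfolding H_def K by (simp add: algebra_simps diff_divide_distrib)
  moreover have "F K - F (-K) = 2 * integral {0..K} (\<lambda>x. exp (- x\<^sup>2))"
  proof -
    have "F K = integral {-K..0} (\<lambda>x. exp (- x\<^sup>2)) + integral {0..K} (\<lambda>x. exp (- x\<^sup>2))"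
      unfolding F_def using K0 by (intro Henstock_Kurzweil_Integration.integral_combine[symmetric] int) auto
    also have "integral {-K..0} (\<lambda>x. exp (- x\<^sup>2)) = integral {0..K} (\<lambda>x. exp (- x\<^sup>2))"
      using Henstock_Kurzweil_Integration.integral_reflect_real[of K 0 "\<lambda>x. exp (- x\<^sup>2)"] by simp
    finally show ?thesis by (simp add: F_def)
  qed
  ultimately show ?thesis by (simp add: b_def)
qed

text \<open>
  On the arc \<open>\<bar>t\<bar> = \<rho>\<close> the exponent \<open>n t + \<pi>\<^sup>2 / (4 t)\<close> is real, and the relative error
  \<open>e\<^bsup>-2 X cos u\<^esup>\<close> of the singular part is more than compensated by its size \<open>e\<^bsup>X cos u\<^esup>\<close>.
\<close>

lemma arc_integrand_estimate:
  fixes X \<rho> u :: real and n :: nat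
  assumes X: "X > 0" "\<rho> * n = X / 2" "pi\<^sup>2 / \<rho> = 2 * X" and rho: "\<rho> > 0"
    and u: "\<bar>u\<bar> < pi / 2" and small: "exp (- 2 * X * cos u) \<le> 1 / 2"
  shows "norm (overpartition_integrand n (\<rho> * cis u) * (\<rho> * cis u) - of_real (\<rho> * sqrt (\<rho> / pi) / 2 * exp (X * cos u)) * cis (3 / 2 * u)) \<le> \<rho> * sqrt (\<rho> / pi)"
proof -
  define t where "t = \<rho> * cis u"
  define w where "w = exp (- (of_real (pi\<^sup>2) / t))"
  define B where "B = \<rho> * sqrt (\<rho> / pi) / 2"
  define V where "V = singular_part t * exp (of_nat n * t) * t"
  have B: "B > 0" using rho by (simp add: B_def)
  have c: "cos u > 0" using u by (intro cos_gt_zero_pi) auto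
  have t0: "t \<noteq> 0" "0 < Re t" using rho c by (auto simp: t_def)
  have inv: "of_real a / t = of_real (a / \<rho>) * cis (- u)" for a
  proof -
    have "of_real a / t = of_real (a / \<rho>) * inverse (cis u)" by (simp add: t_def divide_inverse)
    thus ?thesis by (simp only: cis_inverse)
  qed
  have "norm w = exp (- Re (of_real (pi\<^sup>2) / t))" by (simp add: w_def)
  also have "Re (of_real (pi\<^sup>2) / t) = 2 * X * cos u" unfolding inv X(3) by simp
  finally have nw: "norm w = exp (- (2 * X * cos u))" .
  have w_half: "norm w \<le> 1 / 2" using small unfolding nw by simp
  define \<psi> where "\<psi> = theta2_series w"
  have psi: "norm (\<psi> - 1) \<le> norm w"
    unfolding \<psi>_def by (rule norm_theta2_series_minus_1[OF w_half])
  have psi2: "1 / 2 \<le> norm \<psi>"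
    using psi w_half norm_triangle_ineq2[of 1 "1 - \<psi>"] by (simp add: norm_minus_commute)
  hence psi0: "\<psi> \<noteq> 0" by auto
  have tr: "overpartition_gf (exp (- t)) * \<psi> = singular_part t"
    unfolding \<psi>_def w_def by (rule overpartition_gf_transformation[OF t0(2)])
  hence I: "overpartition_integrand n t * t = V / \<psi>"
    using psi0 by (simp add: overpartition_integrand_def V_def field_simps)
  \<comment> \<open>The terms n t and pi^2 / (4 t) are (X / 2) cis u and (X / 2) cis (-u), with sum
    X cos u; the phases u / 2 of the root and u of the factor t combine to 3 u / 2.\<close>
  have V: "V = of_real (B * exp (X * cos u)) * cis (3 / 2 * u)"
  proof -
    have "csqrt (t / of_real pi) = of_real (sqrt (\<rho> / pi)) * cis (u / 2)"
    proof (rule csqrt_unique)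
      have "(cis (u / 2))\<^sup>2 = cis u" by (simp add: power2_eq_square cis_mult)
      thus "(of_real (sqrt (\<rho> / pi)) * cis (u / 2))\<^sup>2 = t / of_real pi"
        using rho by (simp add: power_mult_distrib t_def flip: of_real_power)
      have "0 < cos (u / 2)" using u by (intro cos_gt_zero_pi) auto
      thus "0 < Re (of_real (sqrt (\<rho> / pi)) * cis (u / 2)) \<or>
          Re (of_real (sqrt (\<rho> / pi)) * cis (u / 2)) = 0 \<and> 0 \<le> Im (of_real (sqrt (\<rho> / pi)) * cis (u / 2))"
        using rho by simp
    qed
    hence V1: "V = of_real (sqrt (\<rho> / pi)) * cis (u / 2) / 2 * (exp (of_real (pi\<^sup>2) / (4 * t)) * exp (of_nat n * t)) * t"
      by (simp add: V_def singular_part_def)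
    have "of_real (pi\<^sup>2) / (4 * t) = of_real (pi\<^sup>2 / 4) / t" by simp
    also have "\<dots> = of_real (X / 2) * cis (- u)"
    proof -
      have "pi\<^sup>2 / 4 / \<rho> = X / 2" using X(3) by simp
      thus ?thesis unfolding inv by (simp only:)
    qed
    finally have e: "of_real (pi\<^sup>2) / (4 * t) = of_real (X / 2) * cis (- u)" .
    have nt: "of_nat n * t = of_real (X / 2) * cis u"
      unfolding t_def X(2)[symmetric] by simp
    have sum: "of_real (X / 2) * cis (- u) + of_real (X / 2) * cis u = of_real (X * cos u)"
      by (simp add: complex_eq_iff)
    have "exp (of_real (pi\<^sup>2) / (4 * t)) * exp (of_nat n * t) = of_real (exp (X * cos u))"
      unfolding e nt exp_add[symmetric] sum by (rule exp_of_real)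
    hence "V = of_real (sqrt (\<rho> / pi)) * cis (u / 2) / 2 * of_real (exp (X * cos u)) * (of_real \<rho> * cis u)"
      unfolding V1 by (simp only: t_def)
    also have "\<dots> = of_real (B * exp (X * cos u)) * (cis (u / 2) * cis u)"
      by (simp add: B_def)
    also have "cis (u / 2) * cis u = cis (3 / 2 * u)" by (simp add: cis_mult)
    finally show ?thesis .
  qed
  have "V / \<psi> - V = - (V * (\<psi> - 1) / \<psi>)" using psi0 by (simp add: field_simps)
  hence "norm (V / \<psi> - V) = norm V * norm (\<psi> - 1) / norm \<psi>" by (simp add: norm_mult norm_divide)
  also have "\<dots> \<le> norm V * norm w / (1 / 2)"
    using psi psi2 by (intro frac_le mult_left_mono) auto
  also have "norm V = B * exp (X * cos u)" using B unfolding V by (simp add: norm_mult)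
  also have "B * exp (X * cos u) * norm w / (1 / 2) = 2 * B * (exp (X * cos u) * exp (- (2 * X * cos u)))"
    by (simp add: nw)
  also have "exp (X * cos u) * exp (- (2 * X * cos u)) = exp (- (X * cos u))" by (simp flip: exp_add)
  also have "2 * B * exp (- (X * cos u)) \<le> 2 * B * 1" using B X c by (intro mult_left_mono) auto
  finally show ?thesis unfolding I[unfolded t_def] V B_def by simp
qed

text \<open>The cosine is smallest at the end points of the arc, so smallness of the relative error
  is assumed only there. The pointwise error is then integrated over a length 2 \<theta> below
  pi.\<close>

lemma arc_integral_estimate:
  fixes X \<rho> \<theta> :: real and n :: nat
  assumes X: "X > 0" "\<rho> * n = X / 2" "pi\<^sup>2 / \<rho> = 2 * X" and rho: "\<rho> > 0"
    and th: "0 < \<theta>" "\<theta> < pi / 2" and small: "exp (- 2 * X * cos \<theta>) \<le> 1 / 2"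
    and J: "((\<lambda>u. exp (X * cos u) * cos (3 / 2 * u)) has_integral J) {-\<theta>..\<theta>}"
  shows "\<bar>Re (integral {-\<theta>..\<theta>} (\<lambda>u. overpartition_integrand n (\<rho> * cis u) * (\<rho> * cis u))) - \<rho> * sqrt (\<rho> / pi) / 2 * J\<bar> \<le> \<rho> * sqrt (\<rho> / pi) * pi"
proof -
  define B where "B = \<rho> * sqrt (\<rho> / pi)"
  define f where "f u = overpartition_integrand n (\<rho> * cis u) * (\<rho> * cis u)" for u
  have B: "B \<ge> 0" using rho by (simp add: B_def)
  have "continuous_on {-\<theta>..\<theta>} f"
  proof -
    have "continuous_on {-\<theta>..\<theta>} (\<lambda>u. overpartition_integrand n (\<rho> * cis u))"
    proof (rule continuous_on_compose2[OF holomorphic_on_imp_continuous_on[OF holomorphic_overpartition_integrand]])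
      show "continuous_on {-\<theta>..\<theta>} (\<lambda>u. complex_of_real \<rho> * cis u)"
        by (intro continuous_intros)
      show "(\<lambda>u. complex_of_real \<rho> * cis u) ` {-\<theta>..\<theta>} \<subseteq> {t. 0 < Re t}"
        using rho th by (auto intro!: mult_pos_pos cos_gt_zero_pi)
    qed
    thus ?thesis unfolding f_def by (intro continuous_intros)
  qed
  hence "(f has_integral integral {-\<theta>..\<theta>} f) {-\<theta>..\<theta>}"
    by (intro integrable_integral integrable_continuous_interval)
  from has_integral_linear[OF this bounded_linear_Re]
  have "((\<lambda>u. Re (f u)) has_integral Re (integral {-\<theta>..\<theta>} f)) {-\<theta>..\<theta>}" by (simp add: o_def)
  moreover have "((\<lambda>u. B / 2 * (exp (X * cos u) * cos (3 / 2 * u))) has_integral (B / 2 * J)) {-\<theta>..\<theta>}"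
    by (rule has_integral_mult_right[OF J])
  ultimately have "((\<lambda>u. Re (f u) - B / 2 * (exp (X * cos u) * cos (3 / 2 * u))) has_integral (Re (integral {-\<theta>..\<theta>} f) - B / 2 * J)) {-\<theta>..\<theta>}"
    by (rule has_integral_diff)
  hence "norm (Re (integral {-\<theta>..\<theta>} f) - B / 2 * J) \<le> B * measure lborel {-\<theta>..\<theta>}"
  proof (rule has_integral_bound_real[OF B finite.emptyI])
    fix u assume "u \<in> {-\<theta>..\<theta>} - {}"
    hence u: "\<bar>u\<bar> \<le> \<theta>" by auto
    have "cos \<theta> \<le> cos \<bar>u\<bar>" using u th by (intro cos_monotone_0_pi_le) auto
    hence "exp (- 2 * X * cos u) \<le> exp (- 2 * X * cos \<theta>)" using X by simp
    hence sm: "exp (- 2 * X * cos u) \<le> 1 / 2" using small by linarith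
    have "norm (f u - of_real (\<rho> * sqrt (\<rho> / pi) / 2 * exp (X * cos u)) * cis (3 / 2 * u)) \<le> B"
      unfolding f_def B_def using u th by (intro arc_integrand_estimate[OF X rho _ sm]) auto
    hence "\<bar>Re (f u - of_real (\<rho> * sqrt (\<rho> / pi) / 2 * exp (X * cos u)) * cis (3 / 2 * u))\<bar> \<le> B"
      using abs_Re_le_cmod order_trans by blast
    thus "norm (Re (f u) - B / 2 * (exp (X * cos u) * cos (3 / 2 * u))) \<le> B"
      by (simp add: B_def)
  qed
  also have "B * measure lborel {-\<theta>..\<theta>} = B * (2 * \<theta>)" using th by simp
  also have "\<dots> \<le> B * pi" using B th by (intro mult_left_mono) auto
  finally show ?thesis by (simp add: B_def f_def[abs_def])
qed

section \<open>An effective asymptotic formula\<close>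

lemma arctan_bounds:
  assumes x: "0 \<le> (x::real)"
  shows "x - x ^ 3 / 3 \<le> arctan x" "arctan x \<le> x - x ^ 3 / 3 + x ^ 5 / 5"
proof -
  define f where "f z = arctan z - (z - z ^ 3 / 3)" for z :: real
  define g where "g z = z - z ^ 3 / 3 + z ^ 5 / 5 - arctan z" for z :: real
  have pos: "1 + z\<^sup>2 > 0" for z :: real by (simp add: add_pos_nonneg)
  have "f 0 \<le> f x"
  proof (rule DERIV_nonneg_imp_nondecreasing[OF x, where f = f])
    fix z :: real
    have "(f has_real_derivative (inverse (1 + z\<^sup>2) - (1 - z\<^sup>2))) (at z)"
      unfolding f_def by (auto intro!: derivative_eq_intros)
    moreover have "inverse (1 + z\<^sup>2) - (1 - z\<^sup>2) = (z\<^sup>2)\<^sup>2 / (1 + z\<^sup>2)"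
      using pos[of z] by (simp add: field_simps power2_eq_square) 
    ultimately show "\<exists>D. (f has_real_derivative D) (at z) \<and> 0 \<le> D"
      using pos[of z] by (metis divide_nonneg_pos zero_le_power2)
  qed
  thus "x - x ^ 3 / 3 \<le> arctan x" by (simp add: f_def)
  have "g 0 \<le> g x"
  proof (rule DERIV_nonneg_imp_nondecreasing[OF x, where f = g])
    fix z :: real
    have "(g has_real_derivative (1 - z\<^sup>2 + z ^ 4 - inverse (1 + z\<^sup>2))) (at z)"
      unfolding g_def by (auto intro!: derivative_eq_intros)
    moreover have "1 - z\<^sup>2 + z ^ 4 - inverse (1 + z\<^sup>2) = (z ^ 3)\<^sup>2 / (1 + z\<^sup>2)"
      using pos[of z] by (simp add: field_simps power2_eq_square) (simp add: eval_nat_numeral algebra_simps)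
    ultimately show "\<exists>D. (g has_real_derivative D) (at z) \<and> 0 \<le> D"
      using pos[of z] by (metis divide_nonneg_pos zero_le_power2)
  qed
  thus "arctan x \<le> x - x ^ 3 / 3 + x ^ 5 / 5" by (simp add: g_def)
qed

lemma pi_bounds: "3.1405 \<le> pi" "pi \<le> 3.14163"
proof -
  have "pi = 16 * arctan (1 / 5) - 4 * arctan (1 / 239)" using machin by simp
  thus "3.1405 \<le> pi" "pi \<le> 3.14163"
    using arctan_bounds[of "1 / 5"] arctan_bounds[of "1 / 239"] by (simp_all add: eval_nat_numeral)
qed

lemma pi_squared_bounds: "9.86 \<le> pi\<^sup>2" "pi\<^sup>2 \<le> 9.87"
proof -
  have "(3.1405::real)\<^sup>2 \<le> pi\<^sup>2" "pi\<^sup>2 \<le> 3.14163\<^sup>2"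
    using pi_bounds by (intro power_mono; simp)+
  thus "9.86 \<le> pi\<^sup>2" "pi\<^sup>2 \<le> 9.87" by (simp_all add: power2_eq_square)
qed

lemma exp_ge_taylor:
  assumes "0 \<le> (x::real)"
  shows "(\<Sum>k<n. x ^ k / fact k) \<le> exp x"
proof -
  have "(\<Sum>k<n. x ^ k /\<^sub>R fact k) \<le> exp x"
    unfolding exp_def using assms summable_exp_generic[of x]
    by (intro sum_le_suminf) auto
  thus ?thesis by (simp add: scaleR_conv_of_real divide_inverse mult.commute)
qed

text \<open>13.6 = 0.4 * 34 is the exponent of the minor arc decay at the smallest admissible X; it
  is split as 16 * 0.85 to keep the Taylor polynomial short.\<close>

lemma exp_136_div_10: "790000 \<le> exp (13.6::real)"
proof -
  have "2.338 \<le> exp (0.85::real)"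
    using exp_ge_taylor[of "0.85" 6] by (simp add: eval_nat_numeral)
  hence "2.338 ^ 16 \<le> exp (0.85::real) ^ 16" by (intro power_mono) auto
  also have "\<dots> = exp (13.6)" by (simp flip: exp_of_nat_mult)
  finally show ?thesis by (simp add: eval_nat_numeral)
qed

text \<open>Everything is compared with its value near X = 34: the power grows at most like exp (4 z
  / 34) and the root, bounded by its tangent at 36, like exp (z / 70), together slower than exp (0.4
  z).\<close>

lemma power_sqrt_exp_le:
  assumes X: "34 \<le> (X::real)"
  shows "X ^ 4 * sqrt X * exp (- (0.4 * X)) \<le> 9.9"
proof -
  define z where "z = X - 34"
  have z: "0 \<le> z" "X = 34 + z" using X by (auto simp: z_def)
  have "sqrt X \<le> (X + 36) / 12"
  proof -
    have "0 \<le> (sqrt X - 6)\<^sup>2" by simp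
    thus ?thesis using X by (simp add: power2_eq_square algebra_simps)
  qed
  also have "(X + 36) / 12 = 35 / 6 * (1 + z / 70)" by (simp add: z)
  also have "1 + z / 70 \<le> exp (z / 70)" by (rule exp_ge_add_one_self)
  finally have 1: "sqrt X \<le> 35 / 6 * exp (z / 70)" by simp
  have "X = 34 * (1 + z / 34)" by (simp add: z)
  also have "\<dots> \<le> 34 * exp (z / 34)" by (intro mult_left_mono exp_ge_add_one_self) auto
  finally have "X ^ 4 \<le> (34 * exp (z / 34)) ^ 4" using X by (intro power_mono) auto
  also have "\<dots> = 34 ^ 4 * exp (4 * z / 34)" by (simp add: power_mult_distrib flip: exp_of_nat_mult)
  finally have 2: "X ^ 4 \<le> 34 ^ 4 * exp (4 * z / 34)" .
  have "X ^ 4 * sqrt X \<le> (34 ^ 4 * exp (4 * z / 34)) * (35 / 6 * exp (z / 70))"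
    using 1 2 X by (intro mult_mono) auto
  also have "\<dots> = 34 ^ 4 * (35 / 6) * exp (4 * z / 34 + z / 70)" by (simp only: exp_add mult_ac)
  also have "\<dots> \<le> 34 ^ 4 * (35 / 6) * exp (0.4 * z)" using z by (intro mult_left_mono) auto
  finally have "X ^ 4 * sqrt X * exp (- (0.4 * X)) \<le> 34 ^ 4 * (35 / 6) * exp (0.4 * z) * exp (- (0.4 * X))"
    by (intro mult_right_mono) auto
  also have "\<dots> = 34 ^ 4 * (35 / 6) * (exp (0.4 * z) * exp (- (0.4 * X)))" by simp
  also have "exp (0.4 * z) * exp (- (0.4 * X)) = inverse (exp 13.6)"
  proof -
    have "0.4 * z + - (0.4 * X) = - 13.6" by (simp add: z_def field_simps)
    thus ?thesis by (simp only: exp_add[symmetric] exp_minus[symmetric])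
  qed
  also have "34 ^ 4 * (35 / 6) * inverse (exp 13.6) \<le> 34 ^ 4 * (35 / 6) * inverse (790000::real)"
    using exp_136_div_10 by (intro mult_left_mono le_imp_inverse_le) auto
  also have "\<dots> \<le> 9.9" by simp
  finally show ?thesis .
qed

text \<open>
  The end points of the arc have argument \<open>\<plusminus> arccos (7 / 25)\<close>: this nearly minimizes the bound
  \<open>e\<^bsup>0.6 X\<^esup>\<close> on the minor arcs, and all the trigonometric values involved are rational.
\<close>

lemma overpartition_count_estimate:
  fixes n :: nat
  assumes n: "118 \<le> n"
  defines "X \<equiv> pi * sqrt (real n)"
  shows "34 \<le> X" "\<bar>8 * real n * real (overpartition_count n) * exp (- X) - (1 - 1 / X)\<bar> \<le> 3 / X ^ 3"
proof -
  define s where "s = sqrt (real n)"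
  have s2: "s\<^sup>2 = real n" by (simp add: s_def)
  \<comment> \<open>118 exceeds 10.86^2, and 3.1405 * 10.86 exceeds 34, the value from which the
    numerical estimates hold.\<close>
  have "sqrt (10.86\<^sup>2) \<le> s" unfolding s_def using n by (intro real_sqrt_le_mono) (simp add: power2_eq_square)
  hence s: "10.86 \<le> s" by simp
  have "3.1405 * 10.86 \<le> pi * s" using pi_bounds s by (intro mult_mono) auto
  thus X: "34 \<le> X" by (simp add: X_def s_def)
  have Xs: "X = pi * s" by (simp add: X_def s_def)
  have nX: "real n = X\<^sup>2 / pi\<^sup>2" by (simp add: Xs power_mult_distrib s2)
  \<comment> \<open>The positive zero of the derivative n - pi^2 / (4 t^2), that is, the saddle
    point on the real axis.\<close>
  define \<rho> where "\<rho> = pi / (2 * s)"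
  have rhoX: "\<rho> = pi\<^sup>2 / (2 * X)" using s by (simp add: \<rho>_def Xs power2_eq_square)
  have rho: "\<rho> > 0" using s by (simp add: \<rho>_def)
  have X1: "\<rho> * n = X / 2" using s unfolding \<rho>_def s2[symmetric] Xs by (simp add: power2_eq_square)
  have X2: "pi\<^sup>2 / \<rho> = 2 * X" using X by (simp add: rhoX)
  have X0: "X > 0" using X by simp
  define \<theta> where "\<theta> = arccos (7 / 25)"
  have cosT: "cos \<theta> = 7 / 25" by (simp add: \<theta>_def)
  have th: "0 < \<theta>" "\<theta> < pi / 2"
    unfolding \<theta>_def using arccos_lt_bounded[of "7 / 25"] arccos_less_arccos[of 0 "7 / 25"] by auto
  have sin_pos: "0 < sin \<theta>" "0 < sin (\<theta> / 2)" using th by (auto intro!: sin_gt_zero)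
  have sinT: "sin \<theta> = 24 / 25"
  proof -
    have "(sin \<theta>)\<^sup>2 = 1 - (7 / 25)\<^sup>2" unfolding sin_squared_eq cosT ..
    also have "\<dots> = (24 / 25)\<^sup>2" by (simp add: power2_eq_square)
    finally have "(sin \<theta>)\<^sup>2 = (24 / 25)\<^sup>2" .
    thus ?thesis using sin_pos by (simp add: power2_eq_iff)
  qed
  have sinT2: "sin (\<theta> / 2) = 3 / 5"
  proof -
    have "(sin (\<theta> / 2))\<^sup>2 = (3 / 5)\<^sup>2" using cos_double_sin[of "\<theta> / 2"] cosT by (simp add: power2_eq_square)
    thus ?thesis using sin_pos by (simp add: power2_eq_iff)
  qed
  define y where "y = \<rho> * cos \<theta>"
  have yX: "y = 7 * pi\<^sup>2 / (50 * X)" by (simp add: y_def cosT rhoX)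
  have y: "0 < y" "y \<le> 41 / 1000"
  proof -
    show "0 < y" using rho by (simp add: y_def cosT)
    have "7 * pi\<^sup>2 / (50 * X) \<le> 7 * 9.87 / (50 * 34)"
      using X pi_squared_bounds by (intro frac_le) auto
    thus "y \<le> 41 / 1000" by (simp add: yX)
  qed

  define b where "b = sqrt (2 * X)"
  define g where "g = sqrt (pi / (2 * X))"
  \<comment> \<open>0.72 = 1 - cos \<theta>, so \<open>E\<close> compares the integrand at the ends
    of the arc with its peak; the same exponent is K^2.\<close>
  define E where "E = exp (- (0.72 * X))"
  define K where "K = b * (3 / 5)"
  define \<Phi> where "\<Phi> = integral {0..K} (\<lambda>x. exp (- x\<^sup>2))"
  define J where "J = 2 * exp X * ((1 - 1 / X) * (2 * \<Phi> / b) + 6 / 5 / X * E)"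
  define D where "D = \<rho> * sqrt (\<rho> / pi)"
  have b: "8.2 \<le> b" unfolding b_def by (rule real_le_rsqrt) (use X in \<open>simp add: power2_eq_square\<close>)
  have b2: "b\<^sup>2 = 2 * X" using X0 by (simp add: b_def)
  have K2: "K\<^sup>2 = 0.72 * X"
    unfolding K_def power_mult_distrib b2 by (simp add: power2_eq_square)
  have K0: "0 < K" using b by (simp add: K_def)
  have gb: "g * b = sqrt pi" using X0 by (simp add: g_def b_def flip: real_sqrt_mult)
  have g: "0 < g" "g \<le> 0.22"
  proof -
    show "0 < g" using X0 by (simp add: g_def)
    have "pi / (2 * X) \<le> 3.14163 / (2 * 34)" using X pi_bounds by (intro frac_le) auto
    hence "pi / (2 * X) \<le> 0.22\<^sup>2" by (simp add: power2_eq_square)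
    hence "g \<le> sqrt (0.22\<^sup>2)" unfolding g_def by (rule real_sqrt_le_mono)
    thus "g \<le> 0.22" by simp
  qed
  have DX: "D = pi\<^sup>2 / (2 * X) * g"
    using X0 by (simp add: D_def rhoX g_def power2_eq_square)
  have J: "((\<lambda>u. exp (X * cos u) * cos (3 / 2 * u)) has_integral J) {-\<theta>..\<theta>}"
  proof -
    have K': "sqrt (2 * X) * sin (\<theta> / 2) = K" by (simp add: K_def b_def sinT2)
    have E': "exp (- K\<^sup>2) = E" by (simp add: E_def K2)
    have "\<theta> < pi" using th by simp
    from arc_integral_real[OF X0 th(1) this, unfolded K', unfolded E' b_def[symmetric] \<Phi>_def[symmetric] sinT2]
    show ?thesis by (simp add: J_def)
  qed
  have small: "exp (- 2 * X * cos \<theta>) \<le> 1 / 2"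
  proof -
    have "exp (- 2 * X * cos \<theta>) = inverse (exp (2 * X * cos \<theta>))" by (simp flip: exp_minus)
    also have "\<dots> \<le> inverse (1 + 2 * X * cos \<theta>)"
      using X by (intro le_imp_inverse_le exp_ge_add_one_self) (simp add: cosT add_pos_nonneg)
    also have "\<dots> \<le> inverse 2" using X by (intro le_imp_inverse_le) (auto simp: cosT)
    finally show ?thesis by simp
  qed
  define I where "I = integral {-\<theta>..\<theta>} (\<lambda>u. overpartition_integrand n (\<rho> * cis u) * (\<rho> * cis u))"
  have arc: "\<bar>Re I - D / 2 * J\<bar> \<le> D * pi"
    using arc_integral_estimate[OF X0 X1 X2 rho th small J] by (simp add: D_def I_def)
  define C where "C = sqrt (y / pi) / 2 * exp (pi\<^sup>2 / (4 * y) - 11 / (6 * y) + real n * y)"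
  have "norm (of_real (2 * pi) * of_nat (overpartition_count n) - I) \<le> 2 * pi * C"
    unfolding I_def
  proof (rule overpartition_count_arc_estimate[OF rho th])
    have "\<rho> * sin \<theta> = 24 / 7 * y" by (simp add: y_def sinT cosT)
    also have "\<dots> \<le> 24 / 7 * (41 / 1000)" using y by simp
    also have "\<dots> \<le> pi" using pi_bounds by simp
    finally show "\<rho> * sin \<theta> \<le> pi" .
    fix x assume x: "\<rho> * sin \<theta> \<le> \<bar>x\<bar>" "\<bar>x\<bar> \<le> pi"
    have "24 / 7 * y \<le> \<bar>x\<bar>" using x by (simp add: y_def sinT cosT)
    from overpartition_gf_minor_arc[OF y this x(2)]
    have "norm (overpartition_integrand n (Complex y x)) \<le> (sqrt (y / pi) / 2 * exp (pi\<^sup>2 / (4 * y) - 11 / (6 * y))) * exp (real n * y)"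
      unfolding overpartition_integrand_def norm_mult using y
      by (intro mult_mono mult_nonneg_nonneg) auto
    also have "\<dots> = C" unfolding C_def by (simp add: exp_add)
    finally show "norm (overpartition_integrand n (Complex (\<rho> * cos \<theta>) x)) \<le> C" by (simp add: y_def)
  qed
  hence "\<bar>Re (of_real (2 * pi) * of_nat (overpartition_count n) - I)\<bar> \<le> 2 * pi * C"
    using abs_Re_le_cmod order_trans by blast
  hence minor: "\<bar>2 * pi * real (overpartition_count n) - Re I\<bar> \<le> 2 * pi * C" by simp
  have est: "\<bar>real (overpartition_count n) - D * J / (4 * pi)\<bar> \<le> C + D / 2"
  proof -
    have "\<bar>2 * pi * real (overpartition_count n) - D / 2 * J\<bar> \<le> 2 * pi * C + D * pi"
      using arc minor by linarith
    also have "2 * pi * real (overpartition_count n) - D / 2 * J = 2 * pi * (real (overpartition_count n) - D * J / (4 * pi))"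
      by (simp add: right_diff_distrib)
    finally have "2 * pi * \<bar>real (overpartition_count n) - D * J / (4 * pi)\<bar> \<le> 2 * pi * (C + D / 2)"
      by (simp add: abs_mult distrib_left mult.commute[of D])
    thus ?thesis by simp
  qed

  \<comment> \<open>The reciprocal of the leading term e^X / (8 n), written with n = X^2 /
    pi^2.\<close>
  define m where "m = 8 * X\<^sup>2 / pi\<^sup>2 * exp (- X)"
  have m: "m > 0" using X0 by (simp add: m_def)
  have mn: "8 * real n * real (overpartition_count n) * exp (- X) = m * real (overpartition_count n)"
    by (simp add: m_def nX)
  have est': "\<bar>m * real (overpartition_count n) - m * (D * J / (4 * pi))\<bar> \<le> m * C + m * (D / 2)"
  proof -
    have "\<bar>m * p - m * q\<bar> \<le> m * c + m * d" if "\<bar>p - q\<bar> \<le> c + d" for p q c d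
    proof -
      have "\<bar>m * p - m * q\<bar> = m * \<bar>p - q\<bar>" using m by (simp add: abs_mult flip: right_diff_distrib)
      also have "\<dots> \<le> m * (c + d)" using that m by (intro mult_left_mono) auto
      finally show ?thesis by (simp only: distrib_left)
    qed
    thus ?thesis using est by blast
  qed
  have mD: "m * D = 4 * X * g * exp (- X)"
    using X0 by (simp add: m_def DX power2_eq_square)
  have main: "m * (D * J / (4 * pi)) = (1 - 1 / X) * (2 * \<Phi> / sqrt pi) + 12 / 5 * g / pi * E"
  proof -
    have "m * (D * J / (4 * pi)) = (m * D) * J / (4 * pi)" by simp
    also have "\<dots> = X * g / pi * (exp (- X) * J)" unfolding mD by simp
    also have "exp (- X) * J = 2 * ((1 - 1 / X) * (2 * \<Phi> / b) + 6 / 5 / X * E)"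
    proof -
      have "exp (- X) * J = (exp (- X) * exp X) * (2 * ((1 - 1 / X) * (2 * \<Phi> / b) + 6 / 5 / X * E))"
        unfolding J_def by simp
      also have "exp (- X) * exp X = 1" by (simp flip: exp_add)
      finally show ?thesis by simp
    qed
    also have "X * g / pi * (2 * ((1 - 1 / X) * (2 * \<Phi> / b) + 6 / 5 / X * E)) =
        (1 - 1 / X) * (2 * \<Phi> * (2 * X * g / (pi * b))) + 12 / 5 * g / pi * E"
      using X0 b by (simp add: field_simps)
    also have "2 * X * g / (pi * b) = 1 / sqrt pi"
    proof -
      have "2 * X * g / (pi * b) = b * g / pi" using b unfolding b2[symmetric] by (simp add: power2_eq_square)
      also have "\<dots> = sqrt pi / (sqrt pi * sqrt pi)" using gb by (simp add: mult.commute)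
      also have "\<dots> = 1 / sqrt pi" by (rule nonzero_divide_mult_cancel_left) simp
      finally show ?thesis .
    qed
    finally show ?thesis by simp
  qed
  have E0: "0 < E" by (simp add: E_def)
  have sqrtpi: "1.7 \<le> sqrt pi" by (rule real_le_rsqrt) (use pi_bounds in \<open>simp add: power2_eq_square\<close>)
  have main_err: "\<bar>m * (D * J / (4 * pi)) - (1 - 1 / X)\<bar> \<le> E"
  proof -
    have P1: "2 * \<Phi> / sqrt pi \<le> 1" using gaussian_integral_bounds(1)[OF K0] sqrtpi
      by (simp add: \<Phi>_def field_simps)
    have "sqrt pi / 2 - \<Phi> \<le> E / (2 * K)"
      using gaussian_integral_bounds(2)[OF K0] unfolding K2 by (simp add: \<Phi>_def E_def)
    also have "\<dots> \<le> E / (2 * 4.92)" using b E0 by (intro divide_left_mono) (auto simp: K_def)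
    finally have "sqrt pi - 2 * \<Phi> \<le> E / 4.92" by simp
    hence "(sqrt pi - 2 * \<Phi>) / sqrt pi \<le> (E / 4.92) / 1.7" using sqrtpi E0 by (intro frac_le) auto
    hence P2: "1 - 2 * \<Phi> / sqrt pi \<le> (1 / 5) * E" using sqrtpi E0 by (simp add: diff_divide_distrib)
    have "g / pi \<le> 0.22 / 3.1405" using g pi_bounds by (intro frac_le) auto
    hence "g / pi \<le> (2 / 25)" by simp
    hence h1: "g / pi * E \<le> (2 / 25) * E" using E0 by (intro mult_right_mono) auto
    define h where "h = g / pi * E"
    have h0: "0 \<le> h" using g E0 by (simp add: h_def)
    have eq: "12 / 5 * g / pi * E = 12 / 5 * h" by (simp add: h_def)
    have Q: "0 \<le> 12 / 5 * g / pi * E \<and> 12 / 5 * g / pi * E \<le> (1 / 5) * E"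
      unfolding eq using h0 h1[folded h_def] E0 by linarith
    have c: "0 \<le> 1 - 1 / X" "1 - 1 / X \<le> 1" using X by (auto simp: field_simps)
    have "(1 - 1 / X) * (1 - 2 * \<Phi> / sqrt pi) \<le> 1 * ((1 / 5) * E)" using P1 P2 c E0 by (intro mult_mono) auto
    moreover have "0 \<le> (1 - 1 / X) * (1 - 2 * \<Phi> / sqrt pi)" using P1 c by (intro mult_nonneg_nonneg) auto
    moreover have "m * (D * J / (4 * pi)) - (1 - 1 / X) = 12 / 5 * g / pi * E - (1 - 1 / X) * (1 - 2 * \<Phi> / sqrt pi)"
      unfolding main by (simp add: algebra_simps)
    ultimately show ?thesis using Q E0 by linarith
  qed

  \<comment> \<open>The order of the minor arc bound after normalisation, X^2 * X^(-1/2) * e^(0.6 X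
    - X). The other errors are much smaller and are expressed in the same unit.\<close>
  define F where "F = X * sqrt X * exp (- (0.4 * X))"
  have F0: "0 < F" using X0 by (simp add: F_def)
  have sqX: "5.8 \<le> sqrt X" by (rule real_le_rsqrt) (use X in \<open>simp add: power2_eq_square\<close>)
  have "34 * 5.8 \<le> X * sqrt X" using X sqX by (intro mult_mono) auto
  hence XsqX: "197 \<le> X * sqrt X" by simp
  have e1: "E \<le> (1 / 100) * F"
  proof -
    have "E \<le> 1 * exp (- (0.4 * X))" using X0 by (simp add: E_def)
    also have "\<dots> \<le> ((1 / 100) * (X * sqrt X)) * exp (- (0.4 * X))" using XsqX by (intro mult_right_mono) auto
    finally show ?thesis by (simp add: F_def)
  qed
  have e2: "m * (D / 2) \<le> (1 / 1000) * F"
  proof -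
    have "m * (D / 2) = 2 * X * g * exp (- X)" using mD by simp
    also have "\<dots> = 2 * X * g * (exp (- (0.6 * X)) * exp (- (0.4 * X)))" by (simp flip: exp_add)
    also have "\<dots> \<le> 2 * X * 0.22 * ((1 / 1000) * exp (- (0.4 * X)))"
    proof (intro mult_mono mult_left_mono mult_right_mono)
      have "1000 \<le> (4.4::real) ^ 6" by (simp add: eval_nat_numeral)
      also have "\<dots> \<le> (1 + 0.1 * X) ^ 6" using X by (intro power_mono) auto
      also have "\<dots> \<le> exp (0.1 * X) ^ 6" using X by (intro power_mono exp_ge_add_one_self) auto
      also have "\<dots> = exp (0.6 * X)" by (simp flip: exp_of_nat_mult)
      finally have "inverse (exp (0.6 * X)) \<le> inverse 1000" by (intro le_imp_inverse_le) auto
      thus "exp (- (0.6 * X)) \<le> (1 / 1000)" by (simp add: exp_minus)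
    qed (use X0 g in auto)
    also have "\<dots> \<le> (1 / 1000) * (X * sqrt X * exp (- (0.4 * X)))"
    proof -
      have "0.44 * X \<le> X * sqrt X" using X0 sqX by simp
      from mult_right_mono[OF this, of "(1 / 1000) * exp (- (0.4 * X))"] show ?thesis by simp
    qed
    finally show ?thesis by (simp add: F_def)
  qed
  have e3: "m * C \<le> (271 / 1000) * F"
  proof -
    have "y / pi \<le> 0.44 / X"
    proof -
      have "y / pi = 7 * pi / (50 * X)" by (simp add: yX power2_eq_square)
      also have "\<dots> = (7 / 50 * pi) / X" by simp
      also have "\<dots> \<le> 0.44 / X" using pi_bounds X0 by (intro divide_right_mono) auto
      finally show ?thesis .
    qed
    hence "sqrt (y / pi) \<le> sqrt (0.44 / X)" by simp
    also have "\<dots> = sqrt 0.44 / sqrt X" by (rule real_sqrt_divide)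
    also have "\<dots> \<le> 0.6634 / sqrt X"
      using X0 by (intro divide_right_mono real_le_lsqrt) (auto simp: power2_eq_square)
    finally have sq: "sqrt (y / pi) \<le> 0.6634 / sqrt X" .
    \<comment> \<open>With y = 7 pi^2 / (50 X) the three terms are (25 / 14) X, - 550 X / (42 pi^2)
      and 0.14 X; their sum is just below 0.6 X.\<close>
    have ex: "pi\<^sup>2 / (4 * y) - 11 / (6 * y) + real n * y \<le> 0.6 * X"
    proof -
      have "pi\<^sup>2 / (4 * y) = 25 / 14 * X" using X0 by (simp add: yX)
      moreover have "real n * y = 0.14 * X" unfolding nX yX using X0 by (simp add: power2_eq_square)
      moreover have "11 / (6 * y) = 550 / 42 * X / pi\<^sup>2" using X0 by (simp add: yX)
      moreover have "550 / 42 * X / 9.87 \<le> 550 / 42 * X / pi\<^sup>2"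
        using X0 pi_squared_bounds by (intro divide_left_mono) auto
      ultimately show ?thesis using X0 by simp
    qed
    have "m * C = 4 * X\<^sup>2 / pi\<^sup>2 * sqrt (y / pi) * (exp (- X) * exp (pi\<^sup>2 / (4 * y) - 11 / (6 * y) + real n * y))"
      by (simp add: m_def C_def)
    also have "\<dots> \<le> 4 * X\<^sup>2 / 9.86 * (0.6634 / sqrt X) * (exp (- X) * exp (0.6 * X))"
      using ex sq pi_squared_bounds X0 y by (intro mult_mono divide_left_mono mult_left_mono) auto
    also have "exp (- X) * exp (0.6 * X) = exp (- (0.4 * X))" by (simp flip: exp_add)
    also have "4 * X\<^sup>2 / 9.86 * (0.6634 / sqrt X) = 4 * 0.6634 / 9.86 * (X * (X / sqrt X))"
      by (simp add: power2_eq_square)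
    also have "X / sqrt X = sqrt X" using X0 by (simp add: real_div_sqrt)
    also have "4 * 0.6634 / 9.86 * (X * sqrt X) * exp (- (0.4 * X)) \<le> (271 / 1000) * (X * sqrt X) * exp (- (0.4 * X))"
      using X0 by (intro mult_right_mono) auto
    finally show ?thesis by (simp add: F_def)
  qed
  \<comment> \<open>0.282 = 0.01 + 0.001 + 0.271, and 0.282 * 9.9 is below 3.\<close>
  have "\<bar>m * real (overpartition_count n) - (1 - 1 / X)\<bar> \<le> (282 / 1000) * F"
    using est' main_err e1 e2 e3 by linarith
  also have "F = X ^ 4 * sqrt X * exp (- (0.4 * X)) / X ^ 3"
    using X0 by (simp add: F_def eval_nat_numeral)
  also have "(282 / 1000) * (X ^ 4 * sqrt X * exp (- (0.4 * X)) / X ^ 3) \<le> (282 / 1000) * (9.9 / X ^ 3)"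
    using power_sqrt_exp_le[OF X] X0 by (intro mult_left_mono divide_right_mono) auto
  also have "\<dots> \<le> 3 / X ^ 3" using X0 by (simp add: field_simps)
  finally show "\<bar>8 * real n * real (overpartition_count n) * exp (- X) - (1 - 1 / X)\<bar> \<le> 3 / X ^ 3"
    unfolding mn .
qed

section \<open>Convexity of the main term\<close>

text \<open>Monotonicity is applied twice: the lower bound on f'' makes \<open>k\<close>
  nonnegative, and \<open>k\<close> is the derivative of \<open>g\<close>. No continuity of f'' is
  required.\<close>

lemma second_difference_ge:
  fixes f f' f'' :: "real \<Rightarrow> real"
  assumes f: "\<And>x. a - d \<le> x \<Longrightarrow> x \<le> a + d \<Longrightarrow> (f has_real_derivative f' x) (at x)"
    and f': "\<And>x. a - d \<le> x \<Longrightarrow> x \<le> a + d \<Longrightarrow> (f' has_real_derivative f'' x) (at x)"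
    and m: "\<And>x. a - d \<le> x \<Longrightarrow> x \<le> a + d \<Longrightarrow> m \<le> f'' x"
    and d: "0 \<le> d"
  shows "m * d\<^sup>2 \<le> f (a + d) + f (a - d) - 2 * f a"
proof -
  define k where "k t = f' (a + t) - f' (a - t) - 2 * m * t" for t
  define g where "g t = f (a + t) + f (a - t) - m * t\<^sup>2" for t
  have k: "0 \<le> k t" if t: "0 \<le> t" "t \<le> d" for t
  proof -
    have "k 0 \<le> k t"
    proof (rule DERIV_nonneg_imp_nondecreasing[OF t(1), where f = k])
      fix s assume s: "0 \<le> s" "s \<le> t"
      have 1: "((\<lambda>t. f' (a + t)) has_real_derivative f'' (a + s) * 1) (at s)"
        using f'[of "a + s"] s t by (intro DERIV_chain2[of f']) (auto intro!: derivative_eq_intros)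
      have 2: "((\<lambda>t. f' (a - t)) has_real_derivative f'' (a - s) * (-1)) (at s)"
        using f'[of "a - s"] s t by (intro DERIV_chain2[of f']) (auto intro!: derivative_eq_intros)
      have "(k has_real_derivative (f'' (a + s) * 1 - f'' (a - s) * (-1) - 2 * m * 1)) (at s)"
        unfolding k_def by (intro DERIV_diff DERIV_cmult DERIV_ident 1 2)
      moreover have "0 \<le> f'' (a + s) * 1 - f'' (a - s) * (-1) - 2 * m * 1"
        using m[of "a + s"] m[of "a - s"] s t by simp
      ultimately show "\<exists>D. (k has_real_derivative D) (at s) \<and> 0 \<le> D" by blast
    qed
    thus ?thesis by (simp add: k_def)
  qed
  have "g 0 \<le> g d"
  proof (rule DERIV_nonneg_imp_nondecreasing[OF d, where f = g])
    fix s assume s: "0 \<le> s" "s \<le> d"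
    have 1: "((\<lambda>t. f (a + t)) has_real_derivative f' (a + s) * 1) (at s)"
      using f[of "a + s"] s by (intro DERIV_chain2[of f]) (auto intro!: derivative_eq_intros)
    have 2: "((\<lambda>t. f (a - t)) has_real_derivative f' (a - s) * (-1)) (at s)"
      using f[of "a - s"] s by (intro DERIV_chain2[of f]) (auto intro!: derivative_eq_intros)
    have 3: "((\<lambda>t. m * t\<^sup>2) has_real_derivative m * (2 * s)) (at s)"
      by (auto intro!: derivative_eq_intros)
    have "(g has_real_derivative (f' (a + s) * 1 + f' (a - s) * (-1) - m * (2 * s))) (at s)"
      unfolding g_def by (intro DERIV_diff DERIV_add 1 2 3)
    moreover have "0 \<le> f' (a + s) * 1 + f' (a - s) * (-1) - m * (2 * s)"
      using k[OF s] by (simp add: k_def)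
    ultimately show "\<exists>D. (g has_real_derivative D) (at s) \<and> 0 \<le> D" by blast
  qed
  thus ?thesis by (simp add: g_def)
qed

text \<open>3.46 = 0.35 + 3.11: the cubic remainder of ln (1 - z), slightly above z^3 / 3, plus the
  relative perturbation \<eta> / (1 - z) with the loss from taking its logarithm.\<close>

lemma ln_perturbation:
  fixes z \<eta> :: real
  assumes z: "0 < z" "z \<le> 1 / 34" and eta: "\<bar>\<eta>\<bar> \<le> 3 * z ^ 3"
  shows "0 < 1 - z + \<eta>" "\<bar>ln (1 - z + \<eta>) + z + z\<^sup>2 / 2\<bar> \<le> 3.46 * z ^ 3"
proof -
  define f where "f t = - ln (1 - t) - t - t\<^sup>2 / 2" for t :: real
  define g where "g t = 0.35 * t ^ 3 - f t" for t :: real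
  have df: "(f has_real_derivative t\<^sup>2 / (1 - t)) (at t)" if "t \<le> 1 / 34" for t
  proof -
    have 1: "((\<lambda>t. ln (1 - t)) has_real_derivative 1 / (1 - t) * (0 - 1)) (at t)"
      using that by (intro DERIV_chain2[OF DERIV_ln_divide] DERIV_diff DERIV_const DERIV_ident) auto
    have 2: "((\<lambda>t. t\<^sup>2 / 2) has_real_derivative t) (at t)"
      by (auto intro!: derivative_eq_intros)
    have "(f has_real_derivative (1 / (1 - t) - 1 - t)) (at t)"
      using DERIV_diff[OF DERIV_diff[OF DERIV_minus[OF 1] DERIV_ident] 2] by (simp add: f_def[abs_def])
    also have "1 / (1 - t) - 1 - t = t\<^sup>2 / (1 - t)" using that by (simp add: field_simps power2_eq_square)
    finally show ?thesis .
  qed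
  have "f 0 \<le> f z"
  proof (rule DERIV_nonneg_imp_nondecreasing[of 0 z f])
    fix t assume "0 \<le> t" "t \<le> z"
    thus "\<exists>D. (f has_real_derivative D) (at t) \<and> 0 \<le> D"
      using df[of t] z by (intro exI[of _ "t\<^sup>2 / (1 - t)"]) auto
  qed (use z in auto)
  moreover have "g 0 \<le> g z"
  proof (rule DERIV_nonneg_imp_nondecreasing[of 0 z g])
    fix t assume t: "0 \<le> t" "t \<le> z"
    have "(g has_real_derivative (1.05 * t\<^sup>2 - t\<^sup>2 / (1 - t))) (at t)"
      unfolding g_def using t z by (auto intro!: derivative_eq_intros df)
    moreover have "t\<^sup>2 / (1 - t) \<le> t\<^sup>2 / (33 / 34)" using t z by (intro divide_left_mono) auto
    moreover have "t\<^sup>2 / (33 / 34) \<le> 1.05 * t\<^sup>2" by simp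
    ultimately show "\<exists>D. (g has_real_derivative D) (at t) \<and> 0 \<le> D"
      by (intro exI[of _ "1.05 * t\<^sup>2 - t\<^sup>2 / (1 - t)"]) linarith
  qed (use z in auto)
  ultimately have lnz: "0 \<le> - ln (1 - z) - z - z\<^sup>2 / 2" "- ln (1 - z) - z - z\<^sup>2 / 2 \<le> 0.35 * z ^ 3"
    by (simp_all add: f_def g_def)
  define \<epsilon> where "\<epsilon> = \<eta> / (1 - z)"
  have z3: "z ^ 3 \<le> 1 / 39304"
  proof -
    have "z ^ 3 \<le> (1 / 34) ^ 3" using z by (intro power_mono) auto
    thus ?thesis by (simp add: eval_nat_numeral)
  qed
  have z3pos: "0 < z ^ 3" using z by simp
  have "\<bar>\<epsilon>\<bar> = \<bar>\<eta>\<bar> / (1 - z)" using z by (simp add: \<epsilon>_def abs_divide)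
  also have "\<dots> \<le> 3 * z ^ 3 / (33 / 34)" using z eta by (intro frac_le) auto
  finally have eps: "\<bar>\<epsilon>\<bar> \<le> 3.1 * z ^ 3" using z3pos by simp
  hence eps1: "\<bar>\<epsilon>\<bar> \<le> 1 / 1000" using z3 by simp
  have eq: "1 - z + \<eta> = (1 - z) * (1 + \<epsilon>)" using z by (simp add: \<epsilon>_def field_simps)
  show "0 < 1 - z + \<eta>" unfolding eq using z eps1 by (intro mult_pos_pos) auto
  have "ln (1 - z + \<eta>) = ln (1 - z) + ln (1 + \<epsilon>)"
    unfolding eq using z eps1 by (intro ln_mult_pos) auto
  moreover have "ln (1 + \<epsilon>) \<le> \<epsilon>" using eps1 by (intro ln_add_one_self_le_self2) auto
  moreover have "- (3.11 * z ^ 3) \<le> ln (1 + \<epsilon>)"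
  proof -
    have "- ln (1 + \<epsilon>) = ln (inverse (1 + \<epsilon>))" using eps1 by (simp add: ln_inverse)
    also have "\<dots> \<le> inverse (1 + \<epsilon>) - 1" using eps1 by (intro ln_le_minus_one) auto
    also have "\<dots> = - \<epsilon> / (1 + \<epsilon>)" using eps1 by (simp add: field_simps)
    also have "\<dots> \<le> \<bar>\<epsilon>\<bar> / (1 + \<epsilon>)" using eps1 by (intro divide_right_mono) auto
    also have "\<dots> \<le> 3.1 * z ^ 3 / 0.999" using eps eps1 z by (intro frac_le) auto
    also have "\<dots> \<le> 3.11 * z ^ 3" using z3pos by simp
    finally show ?thesis by simp
  qed
  ultimately show "\<bar>ln (1 - z + \<eta>) + z + z\<^sup>2 / 2\<bar> \<le> 3.46 * z ^ 3"
    using lnz eps z3pos unfolding abs_le_iff by (intro conjI; simp)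
qed

text \<open>The expansion of ln (p(n) / n) / n at x = n: (X - ln 8 - 2 ln x - 1 / X - 1 / (2 X^2)) /
  x with X = pi sqrt x, the last two terms coming from ln (1 - 1 / X). Powers, and powers times ln
  x, are used throughout because differentiation preserves this shape.\<close>

definition main_log :: "real \<Rightarrow> real" where
  "main_log x = pi * x powr (-1/2) + (- ln 8) * x powr (-1) + (-2) * (ln x * x powr (-1))
     + (- (1 / pi)) * x powr (-3/2) + (- (1 / (2 * pi\<^sup>2))) * x powr (-2)"

definition main_log' :: "real \<Rightarrow> real" where
  "main_log' x = - pi / 2 * x powr (-3/2) + (ln 8 - 2) * x powr (-2) + 2 * (ln x * x powr (-2))
     + 3 / (2 * pi) * x powr (-5/2) + 1 / pi\<^sup>2 * x powr (-3)"

definition main_log'' :: "real \<Rightarrow> real" where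
  "main_log'' x = 3 * pi / 4 * x powr (-5/2) + (6 - 2 * ln 8) * x powr (-3) - 4 * (ln x * x powr (-3))
     - 15 / (4 * pi) * x powr (-7/2) - 3 / pi\<^sup>2 * x powr (-4)"

lemma DERIV_powr_const:
  fixes x a b :: real
  shows "0 < x \<Longrightarrow> b = a - 1 \<Longrightarrow> ((\<lambda>x. x powr a) has_real_derivative a * x powr b) (at x)"
  using has_real_derivative_powr[of x a] by simp

lemma DERIV_ln_powr:
  fixes x a b :: real
  assumes "0 < x" "b = a - 1"
  shows "((\<lambda>x. ln x * x powr a) has_real_derivative x powr b + a * (ln x * x powr b)) (at x)"
proof -
  have "((\<lambda>x. ln x * x powr a) has_real_derivative 1 / x * x powr a + a * x powr b * ln x) (at x)"
    using assms by (intro DERIV_mult DERIV_powr_const DERIV_ln_divide) auto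
  moreover have "1 / x * x powr a = x powr b" using assms by (simp add: powr_diff)
  ultimately show ?thesis by (simp add: mult_ac)
qed

lemma main_log_deriv: "0 < x \<Longrightarrow> (main_log has_real_derivative main_log' x) (at x)"
proof -
  assume x: "0 < x"
  have "(main_log has_real_derivative (pi * (-1/2 * x powr (-3/2)) + (- ln 8) * (-1 * x powr (-2))
      + (-2) * (x powr (-2) + -1 * (ln x * x powr (-2))) + (- (1 / pi)) * (-3/2 * x powr (-5/2))
      + (- (1 / (2 * pi\<^sup>2))) * (-2 * x powr (-3)))) (at x)"
    unfolding main_log_def using x by (intro DERIV_add DERIV_cmult DERIV_powr_const DERIV_ln_powr) auto
  thus ?thesis by (simp add: main_log'_def algebra_simps)
qed

lemma main_log'_deriv: "0 < x \<Longrightarrow> (main_log' has_real_derivative main_log'' x) (at x)"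
proof -
  assume x: "0 < x"
  have "(main_log' has_real_derivative (- pi / 2 * (-3/2 * x powr (-5/2)) + (ln 8 - 2) * (-2 * x powr (-3))
      + 2 * (x powr (-3) + -2 * (ln x * x powr (-3))) + 3 / (2 * pi) * (-5/2 * x powr (-7/2))
      + 1 / pi\<^sup>2 * (-3 * x powr (-4)))) (at x)"
    unfolding main_log'_def using x by (intro DERIV_add DERIV_cmult DERIV_powr_const DERIV_ln_powr) auto
  thus ?thesis by (simp add: main_log''_def algebra_simps)
qed

text \<open>After x^(-5/2) is factored out, 3 pi / 4 competes with (6 - 2 ln 8 - 4 ln x) / sqrt x,
  which near x = 120 is still about -1.6. The margin is moderate, so ln (sqrt x) is bounded by its
  tangent at 11, close to sqrt 120.\<close>

lemma main_log''_ge: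
  assumes x: "120 \<le> x"
  shows "11 / 20 * x powr (-5/2) \<le> main_log'' x"
proof -
  define u where "u = sqrt x"
  have u: "10.9 \<le> u" unfolding u_def by (rule real_le_rsqrt) (use x in \<open>simp add: power2_eq_square\<close>)
  have xu: "x = u\<^sup>2" using x by (simp add: u_def)
  have x0: "0 < x" using x by simp
  have p1: "x powr (-1/2) = 1 / u" using powr_minus_divide[of x "1/2"] x0 by (simp add: u_def powr_half_sqrt)
  have pm1: "x powr (-1) = 1 / x" using x0 by (simp add: powr_minus divide_inverse)
  have p2: "x powr (-3) = x powr (-5/2) * (1 / u)"
    unfolding p1[symmetric] powr_add[symmetric] by simp
  have p3: "x powr (-7/2) = x powr (-5/2) * (1 / x)"
    unfolding pm1[symmetric] powr_add[symmetric] by simp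
  have p4: "x powr (-4) = x powr (-5/2) * (1 / x * (1 / u))"
    unfolding p1[symmetric] pm1[symmetric] powr_add[symmetric] by simp
  have M: "main_log'' x = x powr (-5/2) * (3 * pi / 4 + (6 - 2 * ln 8 - 4 * ln x) / u - 15 / (4 * pi) / x - 3 / pi\<^sup>2 / (x * u))"
    unfolding main_log''_def p2 p3 p4 by (simp add: algebra_simps diff_divide_distrib add_divide_distrib)
  have ln8: "ln (8::real) = 3 * ln 2" using ln_realpow[of 2 3] by simp
  have ln8b: "ln (8::real) \<le> 2.0834" unfolding ln8 using ln2_le_25_over_36 by simp
  have "ln (11::real) = ln 8 + ln (11 / 8)" using ln_mult_pos[of 8 "11 / 8"] by simp
  also have "ln (11 / 8 :: real) \<le> 11 / 8 - 1" by (rule ln_le_minus_one) simp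
  finally have ln11: "ln (11::real) \<le> 2.4584" using ln8b by simp
  have "ln x = 2 * ln u" unfolding xu using u by (simp add: ln_realpow)
  also have "ln u = ln 11 + ln (u / 11)" using u ln_mult_pos[of 11 "u / 11"] by simp
  also have "ln (u / 11) \<le> u / 11 - 1" using u by (intro ln_le_minus_one) auto
  finally have lnx: "ln x \<le> 2 * (2.4584 + (u / 11 - 1))" using ln11 by simp
  have num: "- ((6 - 2 * ln 8 - 4 * ln x) / u) \<le> 1.65"
  proof -
    have "- (6 - 2 * ln 8 - 4 * ln x) \<le> 1.65 * u" using lnx ln8b u by simp
    thus ?thesis using u by (simp add: divide_simps)
  qed
  have "15 / (4 * pi) / x \<le> 15 / (4 * 3) / 120"
    using x pi_gt3 by (intro frac_le) auto
  moreover have "3 / pi\<^sup>2 / (x * u) \<le> 3 / 9 / (120 * 10)"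
  proof -
    have "3\<^sup>2 \<le> pi\<^sup>2" using pi_gt3 by (intro power_mono) auto
    thus ?thesis using x u by (intro frac_le mult_mono) auto
  qed
  ultimately have "11 / 20 \<le> 3 * pi / 4 + (6 - 2 * ln 8 - 4 * ln x) / u - 15 / (4 * pi) / x - 3 / pi\<^sup>2 / (x * u)"
    using num pi_gt3 by simp
  hence "x powr (-5/2) * (11 / 20) \<le> x powr (-5/2) * (3 * pi / 4 + (6 - 2 * ln 8 - 4 * ln x) / u - 15 / (4 * pi) / x - 3 / pi\<^sup>2 / (x * u))"
    by (intro mult_left_mono) auto
  thus ?thesis unfolding M by simp
qed

text \<open>With z = 1 / X, taking logarithms and dividing by n turns the error 3.46 z^3 into (3.46
  / pi^3) n^(-5/2); 14 / 125 is a rational upper bound for 3.46 / pi^3.\<close>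

lemma log_overpartition_estimate:
  fixes n p :: nat
  assumes n: "118 \<le> n"
  defines "X \<equiv> pi * sqrt (real n)"
  assumes X: "34 \<le> X" and est: "\<bar>8 * real n * real p * exp (- X) - (1 - 1 / X)\<bar> \<le> 3 / X ^ 3"
  shows "0 < p" "\<bar>ln (real p / real n) / real n - main_log (real n)\<bar> \<le> 14 / 125 * real n powr (-5/2)"
proof -
  define N where "N = real n"
  have N: "0 < N" using n by (simp add: N_def)
  define s where "s = sqrt N"
  have s: "0 < s" "s\<^sup>2 = N" using N by (auto simp: s_def)
  have Xs: "X = pi * s" by (simp add: X_def s_def N_def)
  define z where "z = 1 / X"
  define \<eta> where "\<eta> = 8 * N * real p * exp (- X) - (1 - 1 / X)"
  have z: "0 < z" "z \<le> 1 / 34" using X by (auto simp: z_def intro!: divide_left_mono)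
  have eta: "\<bar>\<eta>\<bar> \<le> 3 * z ^ 3" using est by (simp add: \<eta>_def z_def N_def power_one_over)
  note P = ln_perturbation[OF z eta]
  have "1 - z + \<eta> = 8 * N * real p * exp (- X)" by (simp add: \<eta>_def z_def)
  hence pe: "8 * N * real p * exp (- X) = 1 - z + \<eta>" by simp
  have "p \<noteq> 0"
  proof
    assume "p = 0"
    thus False using P(1) unfolding pe[symmetric] by simp
  qed
  thus p: "0 < p" by simp
  have "ln (real p / N) = ln ((8 * N * real p * exp (- X)) * (exp X / (8 * N\<^sup>2)))"
    using N by (simp add: exp_minus power2_eq_square)
  also have "\<dots> = ln (1 - z + \<eta>) + (X - ln 8 - 2 * ln N)"
    unfolding pe using P(1) N by (simp add: ln_mult_pos ln_div ln_realpow)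
  finally have l: "ln (real p / N) = ln (1 - z + \<eta>) + (X - ln 8 - 2 * ln N)" .
  have q1: "N powr (-1/2) = 1 / s" using powr_minus_divide[of N "1/2"] N by (simp add: s_def powr_half_sqrt)
  have q2: "N powr (-1) = 1 / N" using N by (simp add: powr_minus divide_inverse)
  have q3: "N powr (-3/2) = 1 / (N * s)"
  proof -
    have "N powr (-3/2) = N powr (-1) * N powr (-1/2)" unfolding powr_add[symmetric] by simp
    thus ?thesis by (simp only: q1 q2) simp
  qed
  have q4: "N powr (-2) = 1 / N\<^sup>2"
  proof -
    have "N powr (-2) = N powr (-1) * N powr (-1)" unfolding powr_add[symmetric] by simp
    thus ?thesis by (simp only: q2) (simp add: power2_eq_square)
  qed
  have q5: "N powr (-5/2) = 1 / (N * (N * s))"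
  proof -
    have "N powr (-5/2) = N powr (-1) * N powr (-3/2)" unfolding powr_add[symmetric] by simp
    thus ?thesis by (simp only: q2 q3) simp
  qed
  have "main_log N = (X - ln 8 - 2 * ln N - z - z\<^sup>2 / 2) / N"
  proof -
    have "pi * (1 / s) = X / N" using s by (simp add: Xs s(2)[symmetric] power2_eq_square)
    moreover have "(- (1 / pi)) * (1 / (N * s)) = - z / N" using s by (simp add: z_def Xs)
    moreover have "(- (1 / (2 * pi\<^sup>2))) * (1 / N\<^sup>2) = - (z\<^sup>2 / 2) / N"
      using N s by (simp add: z_def Xs power_mult_distrib power_one_over s(2)) (simp add: power2_eq_square)
    ultimately show ?thesis
      unfolding main_log_def q1 q2 q3 q4 by (simp add: diff_divide_distrib add_divide_distrib)
  qed
  hence "ln (real p / N) / N - main_log N = (ln (1 - z + \<eta>) + z + z\<^sup>2 / 2) / N"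
    unfolding l by (simp add: diff_divide_distrib add_divide_distrib)
  hence "\<bar>ln (real p / N) / N - main_log N\<bar> = \<bar>ln (1 - z + \<eta>) + z + z\<^sup>2 / 2\<bar> / N"
    using N by (simp add: abs_divide)
  also have "\<dots> \<le> 3.46 * z ^ 3 / N"
    using P(2) N by (intro divide_right_mono) auto
  also have "\<dots> \<le> 14 / 125 * N powr (-5/2)"
  proof -
    have "(3.14::real) ^ 3 \<le> pi ^ 3" using pi_bounds by (intro power_mono) auto
    hence "3.46 / pi ^ 3 \<le> 3.46 / 3.14 ^ 3" by (intro divide_left_mono) auto
    also have "\<dots> \<le> (14 / 125::real)" by (simp add: eval_nat_numeral)
    finally have "3.46 / pi ^ 3 * (1 / (N * (N * s))) \<le> 14 / 125 * (1 / (N * (N * s)))"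
      using N s by (intro mult_right_mono) auto
    moreover have "3.46 * z ^ 3 / N = 3.46 / pi ^ 3 * (1 / (N * (N * s)))"
      using s by (simp add: z_def Xs power_one_over power_mult_distrib s(2)[symmetric] eval_nat_numeral)
    ultimately show ?thesis by (simp only: q5)
  qed
  finally show "\<bar>ln (real p / real n) / real n - main_log (real n)\<bar> \<le> 14 / 125 * real n powr (-5/2)"
    by (simp add: N_def)
qed

text \<open>A second difference collects four errors, 56 / 125 in total, against the convexity 11 /
  20. The errors are bounded at N - 1 and the convexity at N + 1; the margin absorbs the quotient of
  these powers, at most (122 / 120)^3.\<close>

lemma log_convexity_from_estimate:
  fixes a :: "nat \<Rightarrow> real" and n :: nat
  assumes n: "121 \<le> n"
    and a: "\<And>m. n - 1 \<le> m \<Longrightarrow> m \<le> n + 1 \<Longrightarrow> \<bar>a m - main_log (real m)\<bar> \<le> 14 / 125 * real m powr (-5/2)"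
  shows "2 * a n \<le> a (n - 1) + a (n + 1)"
proof -
  define N where "N = real n"
  have N: "121 \<le> N" "real (n - 1) = N - 1" "real (n + 1) = N + 1" using n by (auto simp: N_def of_nat_diff)
  have conv: "11 / 20 * (N + 1) powr (-5/2) * 1\<^sup>2 \<le> main_log (N + 1) + main_log (N - 1) - 2 * main_log N"
  proof (rule second_difference_ge)
    fix x assume x: "N - 1 \<le> x" "x \<le> N + 1"
    hence x': "120 \<le> x" using N by simp
    show "(main_log has_real_derivative main_log' x) (at x)" using x' by (intro main_log_deriv) auto
    show "(main_log' has_real_derivative main_log'' x) (at x)" using x' by (intro main_log'_deriv) auto
    have "11 / 20 * (N + 1) powr (-5/2) \<le> 11 / 20 * x powr (-5/2)"
      using x x' by (intro mult_left_mono powr_mono2') auto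
    thus "11 / 20 * (N + 1) powr (-5/2) \<le> main_log'' x" using main_log''_ge[OF x'] by simp
  qed simp
  have "\<bar>a n - main_log N\<bar> \<le> 14 / 125 * (N - 1) powr (-5/2)"
  proof -
    have "N powr (-5/2) \<le> (N - 1) powr (-5/2)" using N by (intro powr_mono2') auto
    thus ?thesis using a[of n] by (simp add: N_def)
  qed
  moreover have "\<bar>a (n - 1) - main_log (N - 1)\<bar> \<le> 14 / 125 * (N - 1) powr (-5/2)"
    using a[of "n - 1"] N by simp
  moreover have "\<bar>a (n + 1) - main_log (N + 1)\<bar> \<le> 14 / 125 * (N - 1) powr (-5/2)"
  proof -
    have "(N + 1) powr (-5/2) \<le> (N - 1) powr (-5/2)" using N by (intro powr_mono2') auto
    moreover have "n - 1 \<le> n + 1" by simp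
    note a[OF this order_refl, unfolded N(3)]
    ultimately show ?thesis by linarith
  qed
  moreover have "56 / 125 * (N - 1) powr (-5/2) \<le> 11 / 20 * (N + 1) powr (-5/2)"
  proof -
    have "((N + 1) / (N - 1)) powr (5/2) \<le> ((N + 1) / (N - 1)) powr 3"
      using N by (intro powr_mono) auto
    also have "\<dots> = ((N + 1) / (N - 1)) ^ 3" using N by (simp add: powr_numeral)
    also have "\<dots> \<le> (122 / 120) ^ 3" using N by (intro power_mono) (auto simp: field_simps)
    also have "\<dots> \<le> (11 / 20) / (56 / 125)" by (simp add: eval_nat_numeral)
    finally have "((N + 1) / (N - 1)) powr (5/2) \<le> (11 / 20) / (56 / 125)" .
    moreover have "((N + 1) / (N - 1)) powr (5/2) = (N - 1) powr (-5/2) / (N + 1) powr (-5/2)"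
      using N by (simp add: powr_divide powr_minus divide_simps)
    ultimately have "(N - 1) powr (-5/2) / (N + 1) powr (-5/2) \<le> (11 / 20) / (56 / 125)" by simp
    moreover have "0 < (N + 1) powr (-5/2)" using N by simp
    ultimately have "(N - 1) powr (-5/2) \<le> (11 / 20) / (56 / 125) * (N + 1) powr (-5/2)"
      by (simp only: pos_divide_le_eq)
    thus ?thesis by simp
  qed
  ultimately show ?thesis
    using conv[unfolded power_one mult_1_right] by linarith
qed

section \<open>Exact values\<close>

text \<open>The power series coefficients of \<open>theta4\<close>. A square has the parity of its
  root, so the sign can be read off \<open>i\<close> itself.\<close>

definition theta4_coeff :: "nat \<Rightarrow> int" where
  "theta4_coeff i = (if i = 0 then 1 else if \<exists>k. i = k\<^sup>2 then 2 * (-1) ^ i else 0)"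

lemma minus_one_power_square: "(-1 :: 'a::ring_1) ^ k\<^sup>2 = (-1) ^ k"
  by (cases "even k") auto

lemma theta4_coeff_sums:
  assumes q: "0 < q" "q < (1::real)"
  shows "(\<lambda>i. of_int (theta4_coeff i) * q ^ i) sums theta4 q"
proof -
  define g where "g k = (Suc k)\<^sup>2" for k
  define a where "a i = (if i = 0 then 0 else of_int (theta4_coeff i) :: real)" for i
  have "strict_mono g" unfolding strict_mono_Suc_iff g_def by (simp add: power2_eq_square)
  hence "(\<lambda>k. a (g k) * q ^ g k) sums (2 * (\<Sum>k. theta4_series q k)) \<longleftrightarrow> (\<lambda>i. a i * q ^ i) sums (2 * (\<Sum>k. theta4_series q k))"
  proof (rule sums_mono_reindex)
    fix i assume i: "i \<notin> range g"
    have "\<not> (\<exists>k. i = k\<^sup>2)" if "i > 0"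
    proof
      assume "\<exists>k. i = k\<^sup>2"
      then obtain k where k: "i = k\<^sup>2" by blast
      hence "i = g (k - 1)" using that by (cases k) (auto simp: g_def)
      thus False using i by blast
    qed
    thus "a i * q ^ i = 0" by (auto simp: a_def theta4_coeff_def)
  qed
  moreover have "(\<lambda>k. a (g k) * q ^ g k) sums (2 * (\<Sum>k. theta4_series q k))"
  proof -
    have "a (g k) * q ^ g k = 2 * theta4_series q k" for k
    proof -
      have "\<exists>l. g k = l\<^sup>2" by (auto simp: g_def)
      moreover have "(-1 :: real) ^ g k = (-1) ^ Suc k" by (simp only: g_def minus_one_power_square)
      moreover have "g k \<noteq> 0" by (simp add: g_def)
      ultimately show ?thesis by (simp add: a_def theta4_coeff_def theta4_series_def) (simp add: g_def)
    qed
    moreover have "theta4_series q sums (\<Sum>k. theta4_series q k)"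
      using summable_norm_cancel[OF summable_theta4_series[of q]] q by (intro summable_sums) auto
    ultimately show ?thesis by (simp add: sums_mult)
  qed
  ultimately have "(\<lambda>i. a i * q ^ i) sums (2 * (\<Sum>k. theta4_series q k))" by blast
  from sums_add[OF sums_single[of 0 "\<lambda>_. 1::real"] this]
  have "(\<lambda>i. (if i = 0 then 1 else 0) + a i * q ^ i) sums theta4 q" by (simp add: theta4_def)
  also have "(\<lambda>i. (if i = 0 then 1 else 0) + a i * q ^ i) = (\<lambda>i. of_int (theta4_coeff i) * q ^ i)"
    by (auto simp: a_def theta4_coeff_def)
  finally show ?thesis .
qed

text \<open>Comparing coefficients in theta_4 times generating function = 1. The identity is known
  on (0, 1) only, but a power series with a nonzero coefficient of positive index and value 0 at 0
  cannot vanish arbitrarily close to 0.\<close>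

lemma overpartition_convolution:
  assumes n: "n > 0"
  shows "(\<Sum>i\<le>n. theta4_coeff i * int (overpartition_count (n - i))) = 0"
proof -
  define c where "c n = (\<Sum>i\<le>n. theta4_coeff i * int (overpartition_count (n - i)))" for n
  define d where "d n = real_of_int (c n) - (if n = 0 then 1 else 0)" for n
  have summ_a: "summable (\<lambda>i. norm (of_int (theta4_coeff i) * q ^ i))" if "norm q < 1" for q :: real
  proof (rule summable_comparison_test')
    show "summable (\<lambda>i. 2 * norm q ^ i)" using that by (intro summable_mult summable_geometric) auto
    fix i
    have "\<bar>real_of_int (theta4_coeff i)\<bar> \<le> 2" by (auto simp: theta4_coeff_def abs_mult)
    thus "norm (norm (of_int (theta4_coeff i) * q ^ i)) \<le> 2 * norm q ^ i"
      by (simp add: abs_mult power_abs mult_right_mono)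
  qed
  have conv: "(\<lambda>k. real_of_int (c k) * q ^ k) sums ((\<Sum>i. of_int (theta4_coeff i) * q ^ i) * overpartition_gf q)"
    if q: "norm q < 1" for q :: real
  proof -
    have "summable (\<lambda>k. norm (of_nat (overpartition_count k) * q ^ k))"
      using summable_overpartition[of "norm q"] q by (simp add: abs_mult power_abs)
    from Cauchy_product_sums[OF summ_a[OF q] this]
    have "(\<lambda>k. \<Sum>i\<le>k. of_int (theta4_coeff i) * q ^ i * (of_nat (overpartition_count (k - i)) * q ^ (k - i)))
        sums ((\<Sum>i. of_int (theta4_coeff i) * q ^ i) * overpartition_gf q)"
      by (simp add: overpartition_gf_def)
    also have "(\<lambda>k. \<Sum>i\<le>k. of_int (theta4_coeff i) * q ^ i * (of_nat (overpartition_count (k - i)) * q ^ (k - i)))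
       = (\<lambda>k. real_of_int (c k) * q ^ k)"
    proof
      fix k
      have "of_int (theta4_coeff i) * q ^ i * (of_nat (overpartition_count (k - i)) * q ^ (k - i)) =
         real_of_int (theta4_coeff i * int (overpartition_count (k - i))) * q ^ k" if "i \<in> {..k}" for i
      proof -
        have "q ^ k = q ^ i * q ^ (k - i)" using that by (simp flip: power_add)
        thus ?thesis by simp
      qed
      thus "(\<Sum>i\<le>k. of_int (theta4_coeff i) * q ^ i * (of_nat (overpartition_count (k - i)) * q ^ (k - i)))
       = real_of_int (c k) * q ^ k"
        unfolding c_def of_int_sum sum_distrib_right by (intro sum.cong) auto
    qed
    finally show ?thesis .
  qed
  define f where "f q = (\<Sum>i. of_int (theta4_coeff i) * q ^ i) * overpartition_gf q - 1" for q :: real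
  have sd: "(\<lambda>k. d k * (q - 0) ^ k) sums f q" if q: "norm (q - 0) < 1" for q
  proof -
    have "(\<lambda>k. real_of_int (c k) * q ^ k - (if k = 0 then 1 else 0)) sums f q"
      unfolding f_def by (intro sums_diff conv sums_single) (use q in auto)
    also have "(\<lambda>k. real_of_int (c k) * q ^ k - (if k = 0 then 1 else 0)) = (\<lambda>k. d k * (q - 0) ^ k)"
      by (auto simp: d_def)
    finally show ?thesis .
  qed
  have f0: "f q = 0" if "0 < q" "q < 1" for q
    using theta4_coeff_sums[OF that] overpartition_gf_theta4_real[OF that]
    by (simp add: f_def sums_iff mult.commute)
  have "f 0 = 0"
  proof -
    have "(\<lambda>k. d k * (0 - 0) ^ k) sums f 0" by (rule sd) simp
    hence "f 0 = d 0" using powser_sums_zero[of d] sums_unique2 by fastforce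
    also have "d 0 = 0" by (simp add: d_def c_def theta4_coeff_def overpartition_count_0)
    finally show ?thesis .
  qed
  have "d n = 0"
  proof (rule ccontr)
    assume "d n \<noteq> 0"
    from powser_0_nonzero[OF zero_less_one sd \<open>f 0 = 0\<close> this n]
    obtain s where s: "0 < s" "\<And>z. z \<in> cball 0 s - {0} \<Longrightarrow> f z \<noteq> 0" by blast
    have "f (min s (1 / 2)) \<noteq> 0" using s(1) by (intro s(2)) auto
    thus False using f0[of "min s (1 / 2)"] s(1) by simp
  qed
  hence "c n = 0" using n by (simp add: d_def)
  thus ?thesis by (simp only: c_def)
qed

lemma sum_theta4_coeff:
  fixes f :: "nat \<Rightarrow> int"
  assumes "n < (Suc K)\<^sup>2"
  shows "(\<Sum>i\<le>n. theta4_coeff i * f i) = f 0 + (\<Sum>k=1..K. if k\<^sup>2 \<le> n then 2 * (-1) ^ k * f (k\<^sup>2) else 0)"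
proof -
  have "(\<Sum>i\<le>n. theta4_coeff i * f i) = (\<Sum>i\<in>insert 0 {1..n}. theta4_coeff i * f i)"
    by (intro sum.cong) auto
  also have "\<dots> = f 0 + (\<Sum>i=1..n. theta4_coeff i * f i)" by (simp add: theta4_coeff_def)
  also have "(\<Sum>i=1..n. theta4_coeff i * f i) = (\<Sum>i\<in>{i\<in>{1..n}. (\<exists>k. i = k\<^sup>2)}. theta4_coeff i * f i)"
    by (intro sum.mono_neutral_right) (auto simp: theta4_coeff_def)
  also have "\<dots> = (\<Sum>k\<in>{k\<in>{1..K}. k\<^sup>2 \<le> n}. theta4_coeff (k\<^sup>2) * f (k\<^sup>2))"
  proof (rule sum.reindex_bij_betw[symmetric])
    show "bij_betw (\<lambda>k. k\<^sup>2) {k\<in>{1..K}. k\<^sup>2 \<le> n} {i\<in>{1..n}. \<exists>k. i = k\<^sup>2}"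
    proof (rule bij_betwI')
      fix i assume "i \<in> {i\<in>{1..n}. \<exists>k. i = k\<^sup>2}"
      then obtain k where k: "i = k\<^sup>2" "1 \<le> i" "i \<le> n" by auto
      have "k\<^sup>2 < (Suc K)\<^sup>2" using k assms by simp
      hence "k < Suc K" by (rule power_less_imp_less_base) simp
      moreover have "1 \<le> k" using k by (cases k) auto
      ultimately show "\<exists>k\<in>{k\<in>{1..K}. k\<^sup>2 \<le> n}. i = k\<^sup>2" using k by auto
    qed auto
  qed
  also have "\<dots> = (\<Sum>k\<in>{k\<in>{1..K}. k\<^sup>2 \<le> n}. 2 * (-1) ^ k * f (k\<^sup>2))"
    by (intro sum.cong) (auto simp: theta4_coeff_def minus_one_power_square)
  also have "\<dots> = (\<Sum>k=1..K. if k\<^sup>2 \<le> n then 2 * (-1) ^ k * f (k\<^sup>2) else 0)"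
    by (rule sum.inter_filter) simp
  finally show ?thesis .
qed

section \<open>A rational convexity test\<close>

text \<open>The recurrence p(n) = 2 p(n - 1) - 2 p(n - 4) + 2 p(n - 9) - ... The newest value stands
  first in the list, so p(n - k^2) has position k^2 - 1; squares up to 11^2 suffice for n <
  144.\<close>

definition overpartition_next :: "int list \<Rightarrow> int" where
  "overpartition_next xs = (\<Sum>k\<leftarrow>[1, 2, 3, 4, 5, 6, 7, 8, 9, 10, 11].
     if k * k \<le> length xs then (if even k then -2 else 2) * xs ! (k * k - 1) else 0)"

text \<open>Kept separate so that the recursion for the table mentions the previous table only once
  and evaluation does not recompute it.\<close>

definition overpartition_step :: "int list \<Rightarrow> int list" where
  "overpartition_step xs = overpartition_next xs # xs"

primrec overpartition_table :: "nat \<Rightarrow> int list" where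
  "overpartition_table 0 = [1]"
| "overpartition_table (Suc n) = overpartition_step (overpartition_table n)"

lemma overpartition_table_correct:
  assumes "n < 143"
  shows "overpartition_table n = map (\<lambda>i. int (overpartition_count i)) (rev [0..<Suc n])"
  using assms
proof (induction n)
  case 0
  thus ?case by (simp add: overpartition_count_0)
next
  case (Suc n)
  define xs where "xs = overpartition_table n"
  have xs: "xs = map (\<lambda>i. int (overpartition_count i)) (rev [0..<Suc n])" using Suc by (simp add: xs_def)
  have len: "length xs = Suc n" by (simp add: xs)
  have nth: "xs ! i = int (overpartition_count (n - i))" if "i \<le> n" for i
    using that unfolding xs by (simp add: rev_nth del: upt_Suc)
  define f where "f i = int (overpartition_count (Suc n - i))" for i
  have "overpartition_next xs = (\<Sum>k=1..11. if k * k \<le> length xs then (if even k then -2 else 2) * xs ! (k * k - 1) else 0)"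
  proof -
    have "(\<Sum>k\<leftarrow>[1, 2, 3, 4, 5, 6, 7, 8, 9, 10, 11]. h k) = (\<Sum>k=1..11. h k)" for h :: "nat \<Rightarrow> int"
    proof -
      have "[1, 2, 3, 4, 5, 6, 7, 8, 9, 10, 11] = [1..<12::nat]" by (simp add: upt_rec)
      thus ?thesis by (simp only: sum_list_distinct_conv_sum_set distinct_upt set_upt)
         (intro sum.cong; auto)
    qed
    thus ?thesis by (simp only: overpartition_next_def)
  qed
  also have "\<dots> = - (\<Sum>k=1..11. if k\<^sup>2 \<le> Suc n then 2 * (-1) ^ k * f (k\<^sup>2) else 0)"
    unfolding sum_negf[symmetric]
  proof (rule sum.cong[OF refl])
    fix k :: nat assume k: "k \<in> {1..11}"
    have "xs ! (k * k - 1) = f (k\<^sup>2)" if "k\<^sup>2 \<le> Suc n"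
    proof -
      have "n - (k * k - 1) = Suc n - k\<^sup>2" using k that by (auto simp: power2_eq_square Suc_le_eq)
      thus ?thesis using that by (subst nth) (auto simp: f_def power2_eq_square)
    qed
    thus "(if k * k \<le> length xs then (if even k then -2 else 2) * xs ! (k * k - 1) else 0)
        = - (if k\<^sup>2 \<le> Suc n then 2 * (-1) ^ k * f (k\<^sup>2) else 0)"
      by (simp add: len power2_eq_square)
  qed
  also have "\<dots> = f 0"
  proof -
    have "(\<Sum>i\<le>Suc n. theta4_coeff i * f i) = f 0 + (\<Sum>k=1..11. if k\<^sup>2 \<le> Suc n then 2 * (-1) ^ k * f (k\<^sup>2) else 0)"
      using Suc.prems by (intro sum_theta4_coeff) (simp add: power2_eq_square)
    moreover have "(\<Sum>i\<le>Suc n. theta4_coeff i * f i) = 0"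
      unfolding f_def by (rule overpartition_convolution) simp
    ultimately show ?thesis by linarith
  qed
  finally have "overpartition_next xs = int (overpartition_count (Suc n))" by (simp add: f_def)
  thus ?case using xs by (simp add: overpartition_step_def xs_def[symmetric])
qed

section \<open>Rational bounds for the logarithm and their rounding to integers\<close>

lemma ln_ge_pade:
  assumes w: "1 \<le> (w::real)"
  shows "3 * (w\<^sup>2 - 1) / (w\<^sup>2 + 4 * w + 1) \<le> ln w"
proof -
  define f where "f t = ln t - 3 * (t\<^sup>2 - 1) / (t\<^sup>2 + 4 * t + 1)" for t :: real
  have "f 1 \<le> f w"
  proof (rule DERIV_nonneg_imp_nondecreasing[OF w, where f = f])
    fix t assume t: "1 \<le> t" "t \<le> w"
    have d: "t\<^sup>2 + 4 * t + 1 > 0" using t by (simp add: add_pos_nonneg)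
    have "(f has_real_derivative (1 / t - (3 * (2 * t) * (t\<^sup>2 + 4 * t + 1) - 3 * (t\<^sup>2 - 1) * (2 * t + 4)) / (t\<^sup>2 + 4 * t + 1)\<^sup>2)) (at t)"
      unfolding f_def using t d
      by (auto intro!: derivative_eq_intros simp: power2_eq_square)
    \<comment> \<open>The fourth power of t - 1 reflects that the Pade approximant agrees with ln to
      fourth order at 1.\<close>
    also have "1 / t - (3 * (2 * t) * (t\<^sup>2 + 4 * t + 1) - 3 * (t\<^sup>2 - 1) * (2 * t + 4)) / (t\<^sup>2 + 4 * t + 1)\<^sup>2
       = ((t - 1) * (t - 1) * ((t - 1) * (t - 1))) / (t * (t\<^sup>2 + 4 * t + 1)\<^sup>2)"
      using t d by (simp add: divide_simps) (simp add: power2_eq_square algebra_simps)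
    finally have "(f has_real_derivative ((t - 1) * (t - 1) * ((t - 1) * (t - 1))) / (t * (t\<^sup>2 + 4 * t + 1)\<^sup>2)) (at t)" .
    moreover have "0 \<le> ((t - 1) * (t - 1) * ((t - 1) * (t - 1))) / (t * (t\<^sup>2 + 4 * t + 1)\<^sup>2)" using t by simp
    ultimately show "\<exists>D. (f has_real_derivative D) (at t) \<and> 0 \<le> D" by blast
  qed
  thus ?thesis by (simp add: f_def)
qed

text \<open>An upper counterpart of smaller degree: the derivative of the difference contains the
  factor (t - 1)^3, so the contact at 1 is of third order.\<close>

lemma ln_le_pade:
  assumes w: "1 \<le> (w::real)"
  shows "ln w \<le> (w - 1) * (w + 5) / (4 * w + 2)"
proof -
  define f where "f t = (t - 1) * (t + 5) / (4 * t + 2) - ln t" for t :: real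
  have "f 1 \<le> f w"
  proof (rule DERIV_nonneg_imp_nondecreasing[OF w, where f = f])
    fix t assume t: "1 \<le> t" "t \<le> w"
    have d: "4 * t + 2 > 0" using t by simp
    have "(f has_real_derivative (((2 * t + 4) * (4 * t + 2) - (t - 1) * (t + 5) * 4) / (4 * t + 2)\<^sup>2 - 1 / t)) (at t)"
      unfolding f_def using t d
      by (auto intro!: derivative_eq_intros simp: power2_eq_square algebra_simps)
    also have "((2 * t + 4) * (4 * t + 2) - (t - 1) * (t + 5) * 4) / (4 * t + 2)\<^sup>2 - 1 / t
       = 4 * (t - 1) ^ 3 / (t * (4 * t + 2)\<^sup>2)"
      using t d by (simp add: divide_simps) (simp add: power2_eq_square power3_eq_cube algebra_simps)
    finally have "(f has_real_derivative 4 * (t - 1) ^ 3 / (t * (4 * t + 2)\<^sup>2)) (at t)" .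
    moreover have "0 \<le> 4 * (t - 1) ^ 3 / (t * (4 * t + 2)\<^sup>2)" using t by simp
    ultimately show "\<exists>D. (f has_real_derivative D) (at t) \<and> 0 \<le> D" by blast
  qed
  thus ?thesis by (simp add: f_def)
qed

text \<open>The derivative of the difference is (1 - 1 / t)^2 / 2. Contact of second order is
  enough, as the bound is applied only to b^2 against a c, whose normalised quotient is very close
  to 1.\<close>

lemma ln_ge_half_diff_inverse:
  assumes w: "0 < w" "w \<le> (1::real)"
  shows "(w - 1 / w) / 2 \<le> ln w"
proof -
  define f where "f t = (t - inverse t) / 2 - ln t" for t :: real
  have "f w \<le> f 1"
  proof (rule DERIV_nonneg_imp_nondecreasing[OF w(2), where f = f])
    fix t assume t: "w \<le> t" "t \<le> 1"
    have t0: "t > 0" using t w by simp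
    have "(f has_real_derivative ((1 - - (inverse t ^ Suc (Suc 0))) / 2 - 1 / t)) (at t)"
      unfolding f_def using t0
      by (intro DERIV_diff DERIV_cdivide DERIV_ident DERIV_inverse DERIV_ln_divide) auto
    also have "(1 - - (inverse t ^ Suc (Suc 0))) / 2 - 1 / t = (1 - 1 / t)\<^sup>2 / 2"
      using t0 by (simp add: power2_eq_square field_simps)
    finally have "(f has_real_derivative (1 - 1 / t)\<^sup>2 / 2) (at t)" .
    moreover have "0 \<le> (1 - 1 / t)\<^sup>2 / 2" by simp
    ultimately show "\<exists>D. (f has_real_derivative D) (at t) \<and> 0 \<le> D" by blast
  qed
  thus ?thesis by (simp add: f_def inverse_eq_divide)
qed

lemma real_of_int_div_le: "b > 0 \<Longrightarrow> real_of_int (a div b) \<le> real_of_int a / real_of_int b"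
  using floor_divide_of_int_eq[of a b, where ?'a = real] of_int_floor_le by metis

text \<open>The bound of \<open>ln_ge_pade\<close> at u / v with denominators cleared, in units of
  10^(-4); \<open>div\<close> rounds down and so preserves a lower bound.\<close>

definition log_ratio_lower :: "int \<Rightarrow> int \<Rightarrow> int" where
  "log_ratio_lower u v = (30000 * (u * u - v * v)) div (u * u + 4 * u * v + v * v)"

lemma log_ratio_lower:
  assumes "0 < v" "v \<le> u"
  shows "real_of_int (log_ratio_lower u v) \<le> 10000 * ln (real_of_int u / real_of_int v)"
proof -
  define U V where "U = real_of_int u" and "V = real_of_int v"
  have UV: "0 < V" "V \<le> U" using assms by (auto simp: U_def V_def)
  have "real_of_int (log_ratio_lower u v) \<le> real_of_int (30000 * (u * u - v * v)) / real_of_int (u * u + 4 * u * v + v * v)"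
    unfolding log_ratio_lower_def using assms by (intro real_of_int_div_le) (auto intro!: add_pos_pos mult_pos_pos)
  also have "\<dots> = 10000 * (3 * ((U / V)\<^sup>2 - 1) / ((U / V)\<^sup>2 + 4 * (U / V) + 1))"
  proof -
    have "u * u + 4 * u * v + v * v > 0" using assms by (auto intro!: add_pos_pos mult_pos_pos)
    hence d: "U * U + 4 * U * V + V * V > 0"
      unfolding U_def V_def by (metis of_int_0_less_iff of_int_add of_int_mult of_int_numeral)
    have "(U / V)\<^sup>2 + 4 * (U / V) + 1 = (U * U + 4 * U * V + V * V) / V\<^sup>2"
      using UV by (simp add: field_simps power2_eq_square)
    moreover have "(U / V)\<^sup>2 - 1 = (U * U - V * V) / V\<^sup>2"
      using UV by (simp add: field_simps power2_eq_square)
    ultimately show ?thesis using UV d by (simp add: U_def[symmetric] V_def[symmetric])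
  qed
  also have "\<dots> \<le> 10000 * ln (U / V)" using UV by (intro mult_left_mono ln_ge_pade) auto
  finally show ?thesis by (simp add: U_def V_def)
qed

text \<open>The bound of \<open>ln_le_pade\<close> at u / v. The factor v - u and the outer minus
  sign make \<open>div\<close> round upwards.\<close>

definition log_ratio_upper :: "int \<Rightarrow> int \<Rightarrow> int" where
  "log_ratio_upper u v = - ((1000000 * (v - u) * (u + 5 * v)) div (v * (4 * u + 2 * v)))"

lemma log_ratio_upper:
  assumes "0 < v" "v \<le> u"
  shows "1000000 * ln (real_of_int u / real_of_int v) \<le> real_of_int (log_ratio_upper u v)"
proof -
  define U V where "U = real_of_int u" and "V = real_of_int v"
  have UV: "0 < V" "V \<le> U" using assms by (auto simp: U_def V_def)
  have "1000000 * ln (U / V) \<le> 1000000 * ((U / V - 1) * (U / V + 5) / (4 * (U / V) + 2))"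
    using UV by (intro mult_left_mono ln_le_pade) auto
  also have "\<dots> = - ((1000000 * (V - U) * (U + 5 * V)) / (V * (4 * U + 2 * V)))"
  proof -
    have "4 * (U / V) + 2 = (4 * U + 2 * V) / V" "U / V - 1 = (U - V) / V" "U / V + 5 = (U + 5 * V) / V"
      using UV by (simp_all add: field_simps)
    hence "1000000 * ((U / V - 1) * (U / V + 5) / (4 * (U / V) + 2)) = 1000000 * ((U - V) * (U + 5 * V) / (V * (4 * U + 2 * V)))"
      using UV by simp
    also have "U - V = - (V - U)" by simp
    also have "1000000 * (- d * e / D) = - (1000000 * d * e / D)" for d e D :: real by simp
    finally show ?thesis .
  qed
  also have "\<dots> = - (real_of_int (1000000 * (v - u) * (u + 5 * v)) / real_of_int (v * (4 * u + 2 * v)))"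
    by (simp add: U_def V_def)
  also have "\<dots> \<le> real_of_int (log_ratio_upper u v)"
    unfolding log_ratio_upper_def of_int_minus neg_le_iff_le using assms by (intro real_of_int_div_le) auto
  finally show ?thesis by (simp add: U_def V_def)
qed

text \<open>The finest scale is reserved for this quantity, because the test multiplies it by
  n^2.\<close>

definition log_near_1_lower :: "int \<Rightarrow> int \<Rightarrow> int" where
  "log_near_1_lower u v = (100000000 * (u * u - v * v)) div (2 * u * v)"

lemma log_near_1_lower:
  assumes "0 < u" "u \<le> v"
  shows "real_of_int (log_near_1_lower u v) \<le> 100000000 * ln (real_of_int u / real_of_int v)"
proof -
  define U V where "U = real_of_int u" and "V = real_of_int v"
  have UV: "0 < U" "U \<le> V" using assms by (auto simp: U_def V_def)
  have "real_of_int (log_near_1_lower u v) \<le> real_of_int (100000000 * (u * u - v * v)) / real_of_int (2 * u * v)"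
    unfolding log_near_1_lower_def using assms by (intro real_of_int_div_le) auto
  also have "\<dots> = 100000000 * ((U / V - 1 / (U / V)) / 2)"
    using UV by (simp add: U_def[symmetric] V_def[symmetric] field_simps)
  also have "\<dots> \<le> 100000000 * ln (U / V)" using UV by (intro mult_left_mono ln_ge_half_diff_inverse) auto
  finally show ?thesis by (simp add: U_def V_def)
qed

text \<open>
  With \<open>x, y, z\<close> the logarithms of \<open>a / (n - 1)\<close>, \<open>b / n\<close>, \<open>c / (n + 1)\<close>, the second difference
  multiplied by \<open>n (n\<^sup>2 - 1)\<close> is \<open>n\<^sup>2 (x + z - 2 y) - n (z - x) + 2 y\<close>, so \<open>y\<close> is only needed to low
  accuracy.  Logarithms are represented by integers, scaled by \<open>10\<^sup>8\<close>, \<open>10\<^sup>6\<close> and \<open>10\<^sup>4\<close> respectively.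
\<close>

definition convexity_test :: "int \<Rightarrow> int \<Rightarrow> int \<Rightarrow> int \<Rightarrow> int \<Rightarrow> bool" where
  "convexity_test n L a b c \<longleftrightarrow>
     a * n \<le> b * (n - 1) \<and> b * (n + 1) \<le> c * n \<and> a * c * (n * n) \<le> b * b * (n * n - 1) \<and>
     0 \<le> n * n * log_near_1_lower (a * c * (n * n)) (b * b * (n * n - 1))
       - 100 * n * (log_ratio_upper (b * (n - 1)) (a * n) + log_ratio_upper (c * n) (b * (n + 1)))
       + 20000 * L"

lemma convexity_test_sound:
  assumes pos: "0 < a" "0 < b" "0 < c" "1 < n"
    and L: "real_of_int L \<le> 10000 * ln (real_of_int b / real_of_int n)"
    and test: "convexity_test n L a b c"
  shows "2 * (ln (real_of_int b / real_of_int n) / real_of_int n) \<le>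
     ln (real_of_int a / real_of_int (n - 1)) / real_of_int (n - 1) +
     ln (real_of_int c / real_of_int (n + 1)) / real_of_int (n + 1)"
proof -
  define N where "N = real_of_int n"
  define x where "x = ln (real_of_int a / (N - 1))"
  define y where "y = ln (real_of_int b / N)"
  define z where "z = ln (real_of_int c / (N + 1))"
  have N: "1 < N" using pos by (simp add: N_def)
  have T: "a * n \<le> b * (n - 1)" "b * (n + 1) \<le> c * n" "a * c * (n * n) \<le> b * b * (n * n - 1)"
    "0 \<le> n * n * log_near_1_lower (a * c * (n * n)) (b * b * (n * n - 1))
       - 100 * n * (log_ratio_upper (b * (n - 1)) (a * n) + log_ratio_upper (c * n) (b * (n + 1)))
       + 20000 * L"
    using test by (auto simp: convexity_test_def)
  have r1: "1000000 * (y - x) \<le> real_of_int (log_ratio_upper (b * (n - 1)) (a * n))"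
  proof -
    have "ln (real_of_int (b * (n - 1)) / real_of_int (a * n)) = y - x"
      using pos N by (simp add: x_def y_def N_def[symmetric] ln_div ln_mult_pos)
    thus ?thesis using log_ratio_upper[of "a * n" "b * (n - 1)"] T pos by simp
  qed
  have r2: "1000000 * (z - y) \<le> real_of_int (log_ratio_upper (c * n) (b * (n + 1)))"
  proof -
    have "ln (real_of_int (c * n) / real_of_int (b * (n + 1))) = z - y"
      using pos N by (simp add: z_def y_def N_def[symmetric] ln_div ln_mult_pos)
    thus ?thesis using log_ratio_upper[of "b * (n + 1)" "c * n"] T pos by simp
  qed
  have r3: "real_of_int (log_near_1_lower (a * c * (n * n)) (b * b * (n * n - 1))) \<le> 100000000 * (x + z - 2 * y)"
  proof -
    have "real_of_int (a * c * (n * n)) / real_of_int (b * b * (n * n - 1)) =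
       (real_of_int a / (N - 1)) * (real_of_int c / (N + 1)) / ((real_of_int b / N) * (real_of_int b / N))"
      using pos N by (simp add: N_def[symmetric] field_simps)
    hence "ln (real_of_int (a * c * (n * n)) / real_of_int (b * b * (n * n - 1))) = x + z - 2 * y"
      using pos N by (simp add: x_def y_def z_def ln_div ln_mult_pos)
    moreover have "0 < a * c * (n * n)" using pos by simp
    ultimately show ?thesis using log_near_1_lower[of "a * c * (n * n)" "b * b * (n * n - 1)"] T by simp
  qed
  have "real_of_int 0 \<le> real_of_int (n * n * log_near_1_lower (a * c * (n * n)) (b * b * (n * n - 1))
       - 100 * n * (log_ratio_upper (b * (n - 1)) (a * n) + log_ratio_upper (c * n) (b * (n + 1)))
       + 20000 * L)"
    using T(4) by (simp only: of_int_le_iff)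
  also have "\<dots> = N * N * real_of_int (log_near_1_lower (a * c * (n * n)) (b * b * (n * n - 1)))
       - 100 * N * (real_of_int (log_ratio_upper (b * (n - 1)) (a * n)) + real_of_int (log_ratio_upper (c * n) (b * (n + 1))))
       + 20000 * real_of_int L"
    by (simp add: N_def)
  \<comment> \<open>The weights n^2, 100 n and 20000 bring the scales 10^8, 10^6 and 2 * 10^4 to the
    common factor 10^8.\<close>
  also have "\<dots> \<le> N * N * (100000000 * (x + z - 2 * y)) - 100 * N * (1000000 * (y - x) + 1000000 * (z - y)) + 20000 * (10000 * y)"
    using r1 r2 r3 L N by (intro add_mono diff_mono mult_left_mono) (auto simp: y_def N_def)
  finally have "0 \<le> N * N * (x + z - 2 * y) - N * (z - x) + 2 * y" by (simp add: algebra_simps)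
  also have "\<dots> = N * (N - 1) * (N + 1) * (x / (N - 1) + z / (N + 1) - 2 * (y / N))"
  proof -
    have "N * (N - 1) * (N + 1) * (x / (N - 1)) = N * (N + 1) * x"
      "N * (N - 1) * (N + 1) * (z / (N + 1)) = N * (N - 1) * z"
      "N * (N - 1) * (N + 1) * (2 * (y / N)) = 2 * ((N - 1) * (N + 1) * y)"
      using N by simp_all
    thus ?thesis by (simp only: right_diff_distrib distrib_left) (simp add: algebra_simps)
  qed
  finally have "0 \<le> N * (N - 1) * (N + 1) * (x / (N - 1) + z / (N + 1) - 2 * (y / N))" .
  moreover have "0 < N * (N - 1) * (N + 1)" using N by (intro mult_pos_pos) auto
  ultimately have "0 \<le> x / (N - 1) + z / (N + 1) - 2 * (y / N)"
    by (simp only: zero_le_mult_iff) linarith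
  thus ?thesis by (simp add: x_def y_def z_def N_def)
qed

text \<open>A window of three entries slides along the list. \<open>L\<close> is a running lower
  bound for 10^4 ln (b / n), updated by a lower bound for the logarithm of the quotient of
  neighbouring terms, so only its initial value has to be supplied.\<close>

fun convexity_check :: "int \<Rightarrow> int \<Rightarrow> int list \<Rightarrow> bool" where
  "convexity_check n L (a # b # c # xs) \<longleftrightarrow>
     convexity_test n L a b c \<and>
     convexity_check (n + 1) (L + log_ratio_lower (c * n) (b * (n + 1))) (b # c # xs)"
| "convexity_check n L xs \<longleftrightarrow> True"

lemma convexity_check_sound:
  assumes "convexity_check n L xs" "1 < n" "\<And>x. x \<in> set xs \<Longrightarrow> 0 < x"
    and "1 < length xs \<Longrightarrow> real_of_int L \<le> 10000 * ln (real_of_int (xs ! 1) / real_of_int n)"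
    and "i + 2 < length xs"
  shows "2 * (ln (real_of_int (xs ! (i + 1)) / real_of_int (n + int i)) / real_of_int (n + int i)) \<le>
     ln (real_of_int (xs ! i) / real_of_int (n + int i - 1)) / real_of_int (n + int i - 1) +
     ln (real_of_int (xs ! (i + 2)) / real_of_int (n + int i + 1)) / real_of_int (n + int i + 1)"
  using assms
proof (induction n L xs arbitrary: i rule: convexity_check.induct)
  case (1 n L a b c xs)
  have pos: "0 < a" "0 < b" "0 < c" using "1.prems"(3) by simp_all
  have L: "real_of_int L \<le> 10000 * ln (real_of_int b / real_of_int n)" using "1.prems"(4) by simp
  have test: "convexity_test n L a b c" using "1.prems"(1) by simp
  show ?case
  proof (cases i)
    case 0
    thus ?thesis using convexity_test_sound[OF pos \<open>1 < n\<close> L test] by (simp add: numeral_2_eq_2)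
  next
    case (Suc j)
    have "real_of_int (log_ratio_lower (c * n) (b * (n + 1))) \<le> 10000 * ln (real_of_int (c * n) / real_of_int (b * (n + 1)))"
      using pos \<open>1 < n\<close> test by (intro log_ratio_lower) (auto simp: convexity_test_def)
    also have "ln (real_of_int (c * n) / real_of_int (b * (n + 1))) = ln (real_of_int c / real_of_int (n + 1)) - ln (real_of_int b / real_of_int n)"
      using pos \<open>1 < n\<close> by (simp add: ln_div ln_mult_pos)
    finally have L': "real_of_int (L + log_ratio_lower (c * n) (b * (n + 1))) \<le> 10000 * ln (real_of_int c / real_of_int (n + 1))"
      using L by simp
    have "2 * (ln (real_of_int ((b # c # xs) ! (j + 1)) / real_of_int (n + 1 + int j)) / real_of_int (n + 1 + int j)) \<le>
     ln (real_of_int ((b # c # xs) ! j) / real_of_int (n + 1 + int j - 1)) / real_of_int (n + 1 + int j - 1) +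
     ln (real_of_int ((b # c # xs) ! (j + 2)) / real_of_int (n + 1 + int j + 1)) / real_of_int (n + 1 + int j + 1)"
    proof (rule "1.IH")
      show "convexity_check (n + 1) (L + log_ratio_lower (c * n) (b * (n + 1))) (b # c # xs)"
        using "1.prems"(1) by simp
      show "1 < n + 1" using \<open>1 < n\<close> by simp
      show "0 < x" if "x \<in> set (b # c # xs)" for x using that "1.prems"(3)[of x] by simp
      show "real_of_int (L + log_ratio_lower (c * n) (b * (n + 1))) \<le> 10000 * ln (real_of_int ((b # c # xs) ! 1) / real_of_int (n + 1))"
        using L' by simp
      show "j + 2 < length (b # c # xs)" using "1.prems"(5) Suc by simp
    qed
    moreover have "(a # b # c # xs) ! i = (b # c # xs) ! j" "(a # b # c # xs) ! (i + 1) = (b # c # xs) ! (j + 1)"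
      "(a # b # c # xs) ! (i + 2) = (b # c # xs) ! (j + 2)" "n + int i = n + 1 + int j"
      by (simp_all add: Suc)
    ultimately show ?thesis by (simp only:)
  qed
qed auto

section \<open>The main result\<close>

lemma overpartition_count_pos: "0 < overpartition_count n"
proof (cases "n = 0")
  case False
  hence "[(n, False)] \<in> {xs. is_overpartition n xs}" by (simp add: is_overpartition_Cons is_overpartition_Nil)
  thus ?thesis unfolding overpartition_count_def using finite_overpartitions by (auto simp: card_gt_0_iff)
qed (simp add: overpartition_count_0)

text \<open>The n-th root is exp (ln (v n) / n), so log-convexity becomes convexity of the
  exponents.\<close>

lemma log_convex_fromI:
  fixes v :: "nat \<Rightarrow> real"
  assumes n0: "0 < n0" and pos: "\<And>n. n0 \<le> n \<Longrightarrow> 0 < v n"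
    and conv: "\<And>n. n0 < n \<Longrightarrow> 2 * (ln (v n) / real n) \<le> ln (v (n - 1)) / real (n - 1) + ln (v (n + 1)) / real (n + 1)"
  shows "log_convex_from n0 (\<lambda>n. root n (v n))"
proof -
  have root_exp: "root n (v n) = exp (ln (v n) / real n)" if "n0 \<le> n" for n
    using that n0 pos[of n] by (simp add: root_powr_inverse powr_def)
  show ?thesis
    unfolding log_convex_from_def
  proof (intro conjI allI impI)
    fix n assume "n0 \<le> n"
    thus "0 < root n (v n)" using pos[of n] n0 by simp
  next
    fix n assume n: "n0 + 1 \<le> n"
    hence "(root n (v n))\<^sup>2 = exp (2 * (ln (v n) / real n))"
      by (simp add: root_exp power2_eq_square flip: exp_add)
    also have "\<dots> \<le> exp (ln (v (n - 1)) / real (n - 1) + ln (v (n + 1)) / real (n + 1))"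
      using conv[of n] n by simp
    also have "\<dots> = root (n - 1) (v (n - 1)) * root (n + 1) (v (n + 1))"
      using root_exp[of "n - 1"] root_exp[of "n + 1"] n by (simp add: exp_add)
    finally show "(root n (v n))\<^sup>2 - root (n - 1) (v (n - 1)) * root (n + 1) (v (n + 1)) \<le> 0" by simp
  qed
qed

text \<open>The second derivative of ln x / x is x^(-3) (2 ln x - 3), nonnegative since x \<ge> 6
  exceeds e^(3/2). It transfers convexity from p(n) / n to p(n).\<close>

lemma ln_over_self_convex:
  assumes n: "6 < n"
  shows "2 * (ln (real n) / real n) \<le> ln (real (n - 1)) / real (n - 1) + ln (real (n + 1)) / real (n + 1)"
proof -
  define f :: "real \<Rightarrow> real" where "f x = ln x * x powr (-1)" for x
  define f' :: "real \<Rightarrow> real" where "f' x = x powr (-2) - ln x * x powr (-2)" for x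
  define f'' :: "real \<Rightarrow> real" where "f'' x = x powr (-3) * (2 * ln x - 3)" for x
  have "0 * 1\<^sup>2 \<le> f (real n + 1) + f (real n - 1) - 2 * f (real n)"
  proof (rule second_difference_ge)
    fix x assume "real n - 1 \<le> x" "x \<le> real n + 1"
    hence x: "6 \<le> x" using n by simp
    have "(f has_real_derivative (x powr (-2) + -1 * (ln x * x powr (-2)))) (at x)"
      unfolding f_def using x by (intro DERIV_ln_powr) auto
    thus "(f has_real_derivative f' x) (at x)" by (simp add: f'_def)
    have "(f' has_real_derivative (-2 * x powr (-3) - (x powr (-3) + -2 * (ln x * x powr (-3))))) (at x)"
      unfolding f'_def using x by (intro DERIV_diff DERIV_powr_const DERIV_ln_powr) auto
    thus "(f' has_real_derivative f'' x) (at x)" by (simp add: f''_def algebra_simps)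
    have "3 / 2 \<le> ln (5::real)"
    proof -
      have "ln (5::real) = 2 * ln 2 + ln (5 / 4)" using ln_mult_pos[of 4 "5 / 4"] ln_realpow[of 2 2] by simp
      moreover have "3 * ((5 / 4)\<^sup>2 - 1) / ((5 / 4)\<^sup>2 + 4 * (5 / 4) + 1) \<le> ln (5 / 4 :: real)" by (rule ln_ge_pade) simp
      ultimately show ?thesis using ln2_ge_two_thirds by (simp add: power2_eq_square)
    qed
    also have "\<dots> \<le> ln x" using x by simp
    finally show "0 \<le> f'' x" by (simp add: f''_def)
  qed simp
  moreover have "f (real k) = ln (real k) / real k" for k by (cases "k = 0") (simp_all add: f_def powr_minus divide_inverse)
  from this[of n] this[of "n - 1"] this[of "n + 1"]
  have "f (real n) = ln (real n) / real n" "f (real n - 1) = ln (real (n - 1)) / real (n - 1)"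
    "f (real n + 1) = ln (real (n + 1)) / real (n + 1)" using n by (simp_all add: of_nat_diff add.commute)
  ultimately show ?thesis by simp
qed

text \<open>1.3957 lies just above e^(1/3); the Pade bound is accurate enough there, and cubing
  gives the bound for e.\<close>

lemma exp_1_le: "exp 1 \<le> (2.72 :: real)"
proof -
  have "3 * ((1.3957)\<^sup>2 - 1) / ((1.3957)\<^sup>2 + 4 * 1.3957 + 1) \<le> ln (1.3957 :: real)"
    by (rule ln_ge_pade) simp
  hence "1 \<le> 3 * ln (1.3957 :: real)" by (simp add: power2_eq_square)
  also have "\<dots> = ln (1.3957 ^ 3)" by (subst ln_realpow) simp_all
  finally have "exp 1 \<le> (1.3957 :: real) ^ 3" by (subst (asm) ln_ge_iff) simp_all
  also have "\<dots> \<le> 2.72" by (simp add: eval_nat_numeral)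
  finally show ?thesis .
qed

lemma ln_powers_le:
  fixes a b c :: real
  assumes "0 < a" "0 < b" "0 < c" "b ^ l \<le> a ^ k * c ^ m"
  shows "real l * ln b \<le> real k * ln a + real m * ln c"
proof -
  have "real l * ln b = ln (b ^ l)" using assms by (simp add: ln_realpow)
  also have "\<dots> \<le> ln (a ^ k * c ^ m)" using assms by simp
  also have "\<dots> = real k * ln a + real m * ln c" using assms by (simp add: ln_mult_pos ln_realpow)
  finally show ?thesis .
qed

lemma rev_overpartition_table:
  assumes "n < 143"
  shows "rev (overpartition_table n) = map (\<lambda>i. int (overpartition_count i)) [0..<Suc n]"
  unfolding overpartition_table_correct[OF assms] by (simp add: rev_map del: upt_Suc)

text \<open>The list runs from p(19) to p(121), the outer neighbours of the range 20 to 120. The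
  start value 59000 is slightly below 10^4 ln (p(20) / 20).\<close>

lemma convexity_check_20_120: "convexity_check 20 59000 (drop 19 (rev (overpartition_table 121)))"
  by code_simp

lemma overpartition_count_20: "overpartition_count 20 = 7336"
proof -
  have "rev (overpartition_table 20) ! 20 = 7336" by code_simp
  thus ?thesis by (simp add: rev_overpartition_table del: upt_Suc overpartition_table.simps)
qed

lemma overpartition_ratio_convex_20_120:
  assumes n: "20 \<le> n" "n \<le> 120"
  shows "2 * (ln (real (overpartition_count n) / real n) / real n) \<le>
     ln (real (overpartition_count (n - 1)) / real (n - 1)) / real (n - 1) +
     ln (real (overpartition_count (n + 1)) / real (n + 1)) / real (n + 1)"
proof -
  define xs where "xs = drop 19 (rev (overpartition_table 121))"
  have xs: "xs = map (\<lambda>i. int (overpartition_count i)) [19..<122]"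
    unfolding xs_def by (simp add: rev_overpartition_table drop_map del: upt_Suc overpartition_table.simps)
  have nth: "xs ! i = int (overpartition_count (i + 19))" if "i < 103" for i
  proof -
    have "xs ! i = int (overpartition_count ([19..<122] ! i))" unfolding xs using that by (intro nth_map) simp
    also have "[19..<122] ! i = 19 + i" using that by (intro nth_upt) simp
    finally show ?thesis by (simp add: add.commute)
  qed
  obtain i where i: "n = i + 20" using n by (metis add.commute le_iff_add)
  have L: "real_of_int 59000 \<le> 10000 * ln (real_of_int (xs ! 1) / real_of_int 20)"
  proof -
    \<comment> \<open>59000 / 10000 = 5.9 is multiplied by 10, so that only integer powers of e and
      of p(20) / 20 = 7336 / 20 are compared.\<close>
    have "exp 59 = exp (1::real) ^ 59" by (simp flip: exp_of_nat_mult)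
    also have "\<dots> \<le> 2.72 ^ 59" by (intro power_mono exp_1_le) simp
    also have "\<dots> \<le> (7336 / 20) ^ 10" by (simp add: power_divide)
    finally have "59 \<le> ln ((7336 / 20 :: real) ^ 10)" by (subst ln_ge_iff) auto
    also have "\<dots> = 10 * ln (7336 / 20)" by (subst ln_realpow) auto
    finally show ?thesis by (simp add: nth overpartition_count_20)
  qed
  have "2 * (ln (real_of_int (xs ! (i + 1)) / real_of_int (20 + int i)) / real_of_int (20 + int i)) \<le>
     ln (real_of_int (xs ! i) / real_of_int (20 + int i - 1)) / real_of_int (20 + int i - 1) +
     ln (real_of_int (xs ! (i + 2)) / real_of_int (20 + int i + 1)) / real_of_int (20 + int i + 1)"
  proof (rule convexity_check_sound)
    show "convexity_check 20 59000 xs" unfolding xs_def by (rule convexity_check_20_120)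
    show "i + 2 < length xs" using n by (simp add: xs i del: upt_Suc)
    show "0 < x" if "x \<in> set xs" for x using that overpartition_count_pos by (auto simp: xs)
  qed (use L in auto)
  moreover have "xs ! i = int (overpartition_count (n - 1))" "xs ! (i + 1) = int (overpartition_count n)"
    "xs ! (i + 2) = int (overpartition_count (n + 1))"
    using n by (simp_all add: nth i add.commute)
  moreover have "20 + int i = int n" "int n - 1 = int (n - 1)" "int n + 1 = int (n + 1)"
    using n by (simp_all add: i)
  ultimately show ?thesis by (simp only: of_int_of_nat_eq)
qed

lemma overpartition_ratio_convex:
  assumes n: "20 \<le> n"
  shows "2 * (ln (real (overpartition_count n) / real n) / real n) \<le>
     ln (real (overpartition_count (n - 1)) / real (n - 1)) / real (n - 1) +
     ln (real (overpartition_count (n + 1)) / real (n + 1)) / real (n + 1)"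
proof (cases "n \<le> 120")
  case True
  thus ?thesis by (rule overpartition_ratio_convex_20_120[OF n])
next
  case False
  hence n': "121 \<le> n" by simp
  show ?thesis
  proof (rule log_convexity_from_estimate[OF n'])
    fix m assume "n - 1 \<le> m"
    hence m: "118 \<le> m" using n' by simp
    show "\<bar>ln (real (overpartition_count m) / real m) / real m - main_log (real m)\<bar> \<le> 14 / 125 * real m powr (-5/2)"
      by (rule log_overpartition_estimate(2)[OF m overpartition_count_estimate[OF m]])
  qed
qed

text \<open>The checker divides each entry by its index; feeding it n p(n) therefore tests p(n)
  itself. The start value 40000 is below 10^4 ln 64, where 64 = p(7).\<close>

lemma convexity_check_7_19:
  "convexity_check 7 40000 (map2 (*) [6, 7, 8, 9, 10, 11, 12, 13, 14, 15, 16, 17, 18, 19, 20] (drop 6 (rev (overpartition_table 20))))"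
  by code_simp

lemma overpartition_counts_4_7:
  "overpartition_count 4 = 14" "overpartition_count 5 = 24" "overpartition_count 6 = 40" "overpartition_count 7 = 64"
proof -
  have "rev (overpartition_table 7) ! 4 = 14" "rev (overpartition_table 7) ! 5 = 24"
    "rev (overpartition_table 7) ! 6 = 40" "rev (overpartition_table 7) ! 7 = 64" by code_simp+
  thus "overpartition_count 4 = 14" "overpartition_count 5 = 24" "overpartition_count 6 = 40" "overpartition_count 7 = 64"
    by (simp_all add: rev_overpartition_table del: upt_Suc overpartition_table.simps)
qed

lemma overpartition_convex_7_19:
  assumes n: "7 \<le> n" "n \<le> 19"
  shows "2 * (ln (real (overpartition_count n)) / real n) \<le>
     ln (real (overpartition_count (n - 1))) / real (n - 1) + ln (real (overpartition_count (n + 1))) / real (n + 1)"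
proof -
  define xs where "xs = map2 (*) [6, 7, 8, 9, 10, 11, 12, 13, 14, 15, 16, 17, 18, 19, 20] (drop 6 (rev (overpartition_table 20)))"
  have "[6, 7, 8, 9, 10, 11, 12, 13, 14, 15, 16, 17, 18, 19, 20] = map int [6..<21]" by (simp add: upt_rec)
  hence xs: "xs = map (\<lambda>i. int i * int (overpartition_count i)) [6..<21]"
    unfolding xs_def by (simp only: rev_overpartition_table[of 20, simplified less_numeral_extra] drop_map)
      (simp add: rev_overpartition_table drop_map map2_map_map del: upt_Suc overpartition_table.simps)
  have nth: "xs ! i = int (i + 6) * int (overpartition_count (i + 6))" if "i < 15" for i
  proof -
    have "xs ! i = int ([6..<21] ! i) * int (overpartition_count ([6..<21] ! i))" unfolding xs using that by (intro nth_map) simp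
    also have "[6..<21] ! i = 6 + i" using that by (intro nth_upt) simp
    finally show ?thesis by (simp add: add.commute)
  qed
  obtain i where i: "n = i + 7" using n by (metis add.commute le_iff_add)
  have L: "real_of_int 40000 \<le> 10000 * ln (real_of_int (xs ! 1) / real_of_int 7)"
  proof -
    have "4 \<le> 6 * ln (2::real)" using ln2_ge_two_thirds by simp
    also have "6 * ln (2::real) = ln 64" using ln_realpow[of 2 6] by simp
    finally show ?thesis by (simp add: nth overpartition_counts_4_7)
  qed
  have "2 * (ln (real_of_int (xs ! (i + 1)) / real_of_int (7 + int i)) / real_of_int (7 + int i)) \<le>
     ln (real_of_int (xs ! i) / real_of_int (7 + int i - 1)) / real_of_int (7 + int i - 1) +
     ln (real_of_int (xs ! (i + 2)) / real_of_int (7 + int i + 1)) / real_of_int (7 + int i + 1)"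
  proof (rule convexity_check_sound)
    show "convexity_check 7 40000 xs" unfolding xs_def by (rule convexity_check_7_19)
    show "i + 2 < length xs" using n by (simp add: xs i del: upt_Suc)
    show "0 < x" if "x \<in> set xs" for x using that overpartition_count_pos by (auto simp: xs)
  qed (use L in auto)
  moreover have "xs ! i = int (n - 1) * int (overpartition_count (n - 1))" "xs ! (i + 1) = int n * int (overpartition_count n)"
    "xs ! (i + 2) = int (n + 1) * int (overpartition_count (n + 1))"
    using n by (simp_all add: nth i add.commute)
  moreover have "7 + int i = int n" "int n - 1 = int (n - 1)" "int n + 1 = int (n + 1)"
    using n by (simp_all add: i)
  moreover have "real_of_int (int k * int c) / real_of_int (int k) = real c" if "0 < k" for k c :: nat
    using that by simp
  ultimately show ?thesis using n by (simp only: of_int_of_nat_eq)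
qed

text \<open>From 20 on the statement is the sum of the convexity for p(n) / n and that of ln n / n.
  The second sequence starts earlier, which leaves the indices 5 to 19 to direct
  verification.\<close>

lemma overpartition_convex:
  assumes n: "4 < n"
  shows "2 * (ln (real (overpartition_count n)) / real n) \<le>
     ln (real (overpartition_count (n - 1))) / real (n - 1) + ln (real (overpartition_count (n + 1))) / real (n + 1)"
proof -
  consider "n = 5" | "n = 6" | "7 \<le> n" "n \<le> 19" | "20 \<le> n" using n by linarith
  thus ?thesis
  proof cases
    case 1
    \<comment> \<open>Clearing the denominators 4, 5, 6 with the factor 120 reduces the claim to the
      integer inequality 24^48 \<le> 14^30 * 40^20; the next case is similar with 210.\<close>
    have "real 48 * ln 24 \<le> real 30 * ln (14::real) + real 20 * ln 40" by (rule ln_powers_le) simp_all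
    thus ?thesis using 1 by (simp add: overpartition_counts_4_7)
  next
    case 2
    have "real 70 * ln 40 \<le> real 42 * ln (24::real) + real 30 * ln 64" by (rule ln_powers_le) simp_all
    thus ?thesis using 2 by (simp add: overpartition_counts_4_7)
  next
    case 3
    thus ?thesis by (rule overpartition_convex_7_19)
  next
    case 4
    have split: "ln (real (overpartition_count k)) / real k = ln (real (overpartition_count k) / real k) / real k + ln (real k) / real k"
      if "0 < k" for k
      using that overpartition_count_pos[of k] by (simp add: ln_div diff_divide_distrib)
    show ?thesis
      using overpartition_ratio_convex[OF 4] ln_over_self_convex[of n] 4
      by (simp only: split[of n] split[of "n - 1"] split[of "n + 1"]) simp
  qed
qed

theorem corollary1p3:
  shows "log_convex_from 19 (\<lambda>n. root n (real (overpartition_count n) / real n)) \<and>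
         log_convex_from 4 (\<lambda>n. root n (real (overpartition_count n)))"
proof (intro conjI log_convex_fromI)
  fix n :: nat
  show "0 < real (overpartition_count n) / real n" if "19 \<le> n"
    using that overpartition_count_pos[of n] by simp
  show "0 < real (overpartition_count n)" using overpartition_count_pos[of n] by simp
qed (use overpartition_ratio_convex overpartition_convex in auto)

end
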